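(* Let $\Delta\geq 3$ be an integer, $q\geq 1$ and $p<p_c(q,\Delta)$. Then there exists a constant $\delta>0$ such that, as $n\to\infty$, the following holds with probability $1-o(1)$ over the choice of a uniformly random $\Delta$-regular graph $G=(V,E)$ with $n$ vertices: the output of Algorithm SampleRC on input $G$ is a set $S\subseteq E$ whose distribution $\nu_S$ satisfies $\|\nu_S-\varphi_G\|_{\mathrm{TV}}=O(1/n^{\delta})$, where $\varphi_G$ is the random-cluster distribution on $G$ with parameters $p,q$.
   Context: Random-cluster distribution: $\varphi_G(S)=p^{|S|}(1-p)^{|E\setminus S|}q^{k(S)}/Z$ for $S\subseteq E$, where $k(S)$ is the number of connected components (isolated vertices count) of $(V,S)$. $p_c(q,\Delta)=1-\frac{1}{1+\inf_{y>1}h(y)}$ with $h(y)=\frac{(y-1)(y^{\Delta-1}+q-1)}{y^{\Delta-1}-y}$. A cycle in an $n$-vertex graph is short if its length is at most $\frac15\log_{\Delta-1}n$. Algorithm SampleRC (parameters $p\in(0,1)$, $q\ge1$), on input $G=(V,E)$: let $E'$ be the set of edges of $G$ that belong to some short cycle and $G'=(V,E')$. If $G'$ has a connected component that is neither a cycle nor an isolated vertex, output Fail. Otherwise, sample $S'\subseteq E'$ according to $\varphi_{G'}$ (exactly), then add to $S'$ each edge of $E\setminus E'$ independently with probability $p/(p+(1-p)q)$, and output the resulting set $S$. *)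

theory Defs
  imports "HOL-Probability.Probability"
begin

text \<open>
  A finite simple graph is given by a vertex set \<open>V\<close> and a set \<open>E\<close> of two-element subsets of \<open>V\<close>.
\<close>

definition regular_graphs :: "nat \<Rightarrow> nat \<Rightarrow> nat set set set" where
  "regular_graphs \<Delta> n =
     {E. (\<forall>e\<in>E. e \<subseteq> {..<n} \<and> card e = 2) \<and> (\<forall>v<n. card {e\<in>E. v \<in> e} = \<Delta>)}"

text \<open>Meaningful whenever a \<open>\<Delta>\<close>-regular graph on \<open>n\<close> vertices exists, i.e. \<open>\<Delta> < n\<close> and \<open>\<Delta> * n\<close> even.\<close>

definition random_regular_graph :: "nat \<Rightarrow> nat \<Rightarrow> nat set set pmf" where
  "random_regular_graph \<Delta> n = pmf_of_set (regular_graphs \<Delta> n)"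

definition connected_rel :: "'a set \<Rightarrow> 'a set set \<Rightarrow> ('a \<times> 'a) set" where
  "connected_rel V S = {(u, v). u \<in> V \<and> v \<in> V \<and> (u, v) \<in> {(x, y). {x, y} \<in> S}\<^sup>*}"

definition graph_components :: "'a set \<Rightarrow> 'a set set \<Rightarrow> 'a set set" where
  "graph_components V S = V // connected_rel V S"

definition rc_weight :: "'a set \<Rightarrow> 'a set set \<Rightarrow> real \<Rightarrow> real \<Rightarrow> 'a set set \<Rightarrow> real" where
  "rc_weight V E p q S =
     p ^ card S * (1 - p) ^ card (E - S) * q ^ card (graph_components V S)"

definition rc_partition :: "'a set \<Rightarrow> 'a set set \<Rightarrow> real \<Rightarrow> real \<Rightarrow> real" where
  "rc_partition V E p q = (\<Sum>S\<in>Pow E. rc_weight V E p q S)"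

definition random_cluster :: "'a set \<Rightarrow> 'a set set \<Rightarrow> real \<Rightarrow> real \<Rightarrow> 'a set set pmf" where
  "random_cluster V E p q =
     embed_pmf (\<lambda>S. if S \<subseteq> E then rc_weight V E p q S / rc_partition V E p q else 0)"

text \<open>The function above is indeed a probability mass function:\<close>

lemma pmf_random_cluster:
  assumes "finite E" and "0 < p" and "p < 1" and "0 < q"
  shows "pmf (random_cluster V E p q) S =
           (if S \<subseteq> E then rc_weight V E p q S / rc_partition V E p q else 0)"
proof -
  let ?f = "\<lambda>S. if S \<subseteq> E then rc_weight V E p q S / rc_partition V E p q else 0"
  have w: "rc_weight V E p q T > 0" for T
    using assms by (simp add: rc_weight_def)
  have Z: "rc_partition V E p q > 0"
    unfolding rc_partition_def using assms(1) w by (intro sum_pos) auto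
  have nn: "?f T \<ge> 0" for T
    using w[of T] Z by (simp add: less_imp_le)
  have "(\<integral>\<^sup>+T. ennreal (?f T) \<partial>count_space UNIV) = (\<Sum>T\<in>Pow E. ennreal (?f T))"
    using assms(1) by (intro nn_integral_count_space') auto
  also have "\<dots> = ennreal (\<Sum>T\<in>Pow E. ?f T)"
    by (intro sum_ennreal) (rule nn)
  also have "(\<Sum>T\<in>Pow E. ?f T) = (\<Sum>T\<in>Pow E. rc_weight V E p q T) / rc_partition V E p q"
    by (simp add: sum_divide_distrib)
  also have "\<dots> = 1"
    using Z by (simp add: rc_partition_def)
  finally have "(\<integral>\<^sup>+T. ennreal (?f T) \<partial>count_space UNIV) = 1"
    by simp
  then show ?thesis
    unfolding random_cluster_def using nn by (subst pmf_embed_pmf) auto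
qed

definition pc_fun :: "real \<Rightarrow> nat \<Rightarrow> real \<Rightarrow> real" where
  "pc_fun q \<Delta> y = (y - 1) * (y ^ (\<Delta> - 1) + q - 1) / (y ^ (\<Delta> - 1) - y)"

definition p_c :: "real \<Rightarrow> nat \<Rightarrow> real" where
  "p_c q \<Delta> = 1 - 1 / (1 + (INF y\<in>{1<..}. pc_fun q \<Delta> y))"

text \<open>A cycle is listed by its distinct vertices in cyclic order; its length is that of the list.\<close>

definition cycle_edges :: "'a list \<Rightarrow> 'a set set" where
  "cycle_edges vs = {{vs ! i, vs ! (Suc i mod length vs)} | i. i < length vs}"

definition is_cycle :: "'a set set \<Rightarrow> 'a list \<Rightarrow> bool" where
  "is_cycle E vs \<longleftrightarrow> length vs \<ge> 3 \<and> distinct vs \<and> cycle_edges vs \<subseteq> E"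

definition short_cycle_edges :: "nat \<Rightarrow> 'a set \<Rightarrow> 'a set set \<Rightarrow> 'a set set" where
  "short_cycle_edges \<Delta> V E =
     {e\<in>E. \<exists>vs. is_cycle E vs \<and> e \<in> cycle_edges vs \<and>
                real (length vs) \<le> 1 / 5 * log (real \<Delta> - 1) (real (card V))}"

text \<open>In the next definition \<open>C\<close> is the vertex set of a connected component of the graph \<open>(V, E)\<close>.\<close>

definition component_is_cycle :: "'a set set \<Rightarrow> 'a set \<Rightarrow> bool" where
  "component_is_cycle E C \<longleftrightarrow>
     (\<exists>vs. is_cycle E vs \<and> set vs = C \<and> {e\<in>E. e \<subseteq> C} = cycle_edges vs)"

text \<open>The outcome \<open>None\<close> stands for Fail.\<close>

definition sample_rc ::
  "nat \<Rightarrow> real \<Rightarrow> real \<Rightarrow> 'a set \<Rightarrow> 'a set set \<Rightarrow> 'a set set option pmf" where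
  "sample_rc \<Delta> p q V E =
     (let E' = short_cycle_edges \<Delta> V E in
      if \<exists>C\<in>graph_components V E'. \<not> component_is_cycle E' C \<and> \<not> (\<exists>v. C = {v})
      then return_pmf None
      else do {
        S' \<leftarrow> random_cluster V E' p q;
        b \<leftarrow> Pi_pmf (E - E') False (\<lambda>_. bernoulli_pmf (p / (p + (1 - p) * q)));
        return_pmf (Some (S' \<union> {e \<in> E - E'. b e}))
      })"

definition tv_dist :: "'a pmf \<Rightarrow> 'a pmf \<Rightarrow> real" where
  "tv_dist \<mu> \<nu> = (SUP A. \<bar>measure_pmf.prob \<mu> A - measure_pmf.prob \<nu> A\<bar>)"

end

theory Submission
  imports Defs "HOL-Real_Asymp.Real_Asymp"
begin

text \<open>
Let \<open>d = \<Delta> - 1\<close> and \<open>r = p / (p + (1 - p) q)\<close>. Adding an edge outside \<open>E'\<close> to a configuration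
merges two components unless it closes a cycle, and that cycle is then long. Hence the weight of
\<open>S\<close> under \<open>\<phi>\<^sub>G\<close> is at least a constant times its probability under the sampler, with equality if \<open>S\<close> has
no long cycle, and the total variation distance is at most the \<open>\<phi>\<^sub>G\<close>-probability of a long open cycle.

To bound the latter, reveal the edges of a path one at a time. If the neighbourhood of the next
endpoint is a tree disjoint from the revealed part, the edge is open with probability at most
\<open>r + \<epsilon>\<close>: the ratio of the weights with and without a connection from the root of a hanging tree to
its leaves obeys, in every environment, the recursion of the wired tree, whose only fixed point
for \<open>p < p_c\<close> is the trivial one. Positions with a bad neighbourhood create surplus edges, so there are
boundedly many of them along paths of logarithmic length in a random regular graph.

Since \<open>d r < 1\<close>, while a random \<open>\<Delta>\<close>-regular graph has on average about \<open>d\<^sup>l\<close> cycles of length \<open>l\<close>, the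
sum over all cycles longer than \<open>1/5 log\<^sub>d n\<close> decays polynomially. The expected numbers of subgraphs
are obtained by switchings, without the configuration model.
\<close>

section \<open>Connected components\<close>

text \<open>The random-cluster weight is not local: whether opening an edge divides the weight by
  \<open>q\<close> depends on connections through the whole graph, including the part already
  revealed. This shapes the induction. A hanging tree is judged only by whether its root reaches a
  vertex outside the interior, and the bounds quantify over all edge sets \<open>R\<close> avoiding
  the interior. If the root does not get out, \<open>R\<close> cannot touch its cluster and weights
  factorise exactly. If it does, an inequality from \<open>q \<ge> 1\<close> suffices, and it points
  in the favourable direction. No correlation inequality is used.

  Strict inequalities leave room, and this orders the constants: a depth \<open>h\<close> with
  \<open>\<kappa> < 1 / d\<close>, a loss \<open>\<eta> > 1\<close> from the switchings with
  \<open>\<rho> = d \<eta> \<kappa> < 1\<close>, a length \<open>T\<close> of order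
  \<open>ln n\<close> with \<open>\<rho> ^ T\<close> about \<open>n powr - 2\<close>, and last a
  surplus \<open>m\<close> that paths of this length do not reach.

  Fail is excluded by the same notion of sparsity: short cycles that meet give surplus 2 along at
  most \<open>2/5 log\<^sub>d n\<close> vertices, whose probability is at most
  \<open>n powr (1 + 4/5 - 2)\<close> up to powers of \<open>ln n\<close>.\<close>

definition link :: "'a set set \<Rightarrow> ('a \<times> 'a) set" where
  "link S = {(x, y). {x, y} \<in> S}\<^sup>*"

lemma link_refl [simp]: "(x, x) \<in> link S"
  by (simp add: link_def)

lemma link_sym: "(x, y) \<in> link S \<Longrightarrow> (y, x) \<in> link S"
proof -
  have "sym {(x, y). {x, y} \<in> S}" by (auto intro!: symI simp: insert_commute)
  then show "(x, y) \<in> link S \<Longrightarrow> (y, x) \<in> link S"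
    unfolding link_def by (meson sym_rtrancl symD)
qed

lemma link_trans: "(x, y) \<in> link S \<Longrightarrow> (y, z) \<in> link S \<Longrightarrow> (x, z) \<in> link S"
  unfolding link_def by (rule rtrancl_trans)

lemma link_mono: "S \<subseteq> T \<Longrightarrow> (x, y) \<in> link S \<Longrightarrow> (x, y) \<in> link T"
  unfolding link_def by (erule rtrancl_mono[THEN subsetD, rotated]) auto

lemma link_edge: "{x, y} \<in> S \<Longrightarrow> (x, y) \<in> link S"
  unfolding link_def by auto

lemma link_induct [consumes 1, case_names base step]:
  assumes "(x, y) \<in> link S" "P x"
    "\<And>y z. (x, y) \<in> link S \<Longrightarrow> {y, z} \<in> S \<Longrightarrow> P y \<Longrightarrow> P z"
  shows "P y"
  using assms unfolding link_def by (induction rule: rtrancl_induct) auto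

text \<open>A walk through the new edge can be cut down to one that crosses it at most once; the
  last two cases are the two directions of crossing.\<close>

lemma link_insert:
  "(x, y) \<in> link (insert {a, b} S) \<longleftrightarrow>
     (x, y) \<in> link S \<or> (x, a) \<in> link S \<and> (b, y) \<in> link S \<or> (x, b) \<in> link S \<and> (a, y) \<in> link S"
  (is "?L \<longleftrightarrow> ?R")
proof
  assume ?L
  then show ?R
  proof (induction rule: link_induct)
    case (step y z)
    show ?case
    proof (cases "{y, z} \<in> S")
      case True
      show ?thesis using step.IH link_trans[OF _ link_edge[OF True]] by blast
    next
      case False
      then have "y = a \<and> z = b \<or> y = b \<and> z = a" using step by (auto simp: doubleton_eq_iff)
      then show ?thesis using step.IH by auto
    qed
  qed simp
next
  have ab: "(a, b) \<in> link (insert {a, b} S)" "(b, a) \<in> link (insert {a, b} S)"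
    by (auto intro!: link_edge simp: insert_commute)
  assume ?R
  then show ?L
    using link_mono[OF subset_insertI, of _ _ S "{a, b}"] link_trans[OF link_trans[OF _ ab(1)], of x y]
      link_trans[OF link_trans[OF _ ab(2)], of x y] by blast
qed

abbreviation ncomp :: "'a set \<Rightarrow> 'a set set \<Rightarrow> nat" where
  "ncomp V S \<equiv> card (graph_components V S)"

definition comp_of :: "'a set \<Rightarrow> 'a set set \<Rightarrow> 'a \<Rightarrow> 'a set" where
  "comp_of V S x = {y \<in> V. (x, y) \<in> link S}"

lemma graph_components_eq: "graph_components V S = comp_of V S ` V"
  unfolding graph_components_def quotient_def connected_rel_def comp_of_def link_def
  by auto

lemma comp_of_eq_iff: "x \<in> V \<Longrightarrow> y \<in> V \<Longrightarrow> comp_of V S x = comp_of V S y \<longleftrightarrow> (x, y) \<in> link S"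
proof
  assume "x \<in> V" "y \<in> V" "comp_of V S x = comp_of V S y"
  then have "y \<in> comp_of V S x" by (simp add: comp_of_def)
  then show "(x, y) \<in> link S" by (simp add: comp_of_def)
next
  assume "(x, y) \<in> link S"
  then have "(x, z) \<in> link S \<longleftrightarrow> (y, z) \<in> link S" for z
    using link_trans[of x y S z] link_trans[of y x S z] link_sym[of x y S] by blast
  then show "comp_of V S x = comp_of V S y" by (simp add: comp_of_def)
qed

lemma ncomp_insert_linked:
  assumes "(a, b) \<in> link S"
  shows "graph_components V (insert {a, b} S) = graph_components V S"
proof -
  have "(x, y) \<in> link (insert {a, b} S) \<longleftrightarrow> (x, y) \<in> link S" for x y
    unfolding link_insert using link_trans[OF link_trans[OF _ assms], of x y]
      link_trans[OF link_trans[OF _ link_sym[OF assms]], of x y] by blast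
  then show ?thesis by (simp add: graph_components_eq comp_of_def)
qed

text \<open>Only the classes of \<open>a\<close> and \<open>b\<close> change: their union
  \<open>?M\<close> replaces them. It was no class before, so the count drops by exactly
  one.\<close>

lemma ncomp_insert_unlinked:
  assumes "finite V" "a \<in> V" "b \<in> V" "(a, b) \<notin> link S"
  shows "ncomp V S = Suc (ncomp V (insert {a, b} S))"
proof -
  let ?C = "comp_of V S" and ?C' = "comp_of V (insert {a, b} S)"
  let ?M = "?C a \<union> ?C b"
  have C': "?C' x = (if x \<in> ?M then ?M else ?C x)" if "x \<in> V" for x
  proof (cases "x \<in> ?M")
    case True
    then have *: "(a, x) \<in> link S \<or> (b, x) \<in> link S" by (auto simp: comp_of_def)
    have "(x, y) \<in> link (insert {a, b} S) \<longleftrightarrow> (a, y) \<in> link S \<or> (b, y) \<in> link S" for y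
      unfolding link_insert using * link_sym[of a x S] link_sym[of b x S]
        link_trans[of a x S y] link_trans[of x a S y] link_trans[of b x S y] link_trans[of x b S y]
      by blast
    then show ?thesis using True by (auto simp: comp_of_def)
  next
    case False
    then have *: "(a, x) \<notin> link S" "(b, x) \<notin> link S" using that by (auto simp: comp_of_def)
    have "(x, y) \<in> link (insert {a, b} S) \<longleftrightarrow> (x, y) \<in> link S" for y
      unfolding link_insert using * link_sym[of x a S] link_sym[of x b S] by blast
    then show ?thesis using False by (auto simp: comp_of_def)
  qed
  have aC: "a \<in> ?C a" "b \<in> ?C b" using assms by (auto simp: comp_of_def)
  have ne: "?C a \<noteq> ?C b" using assms by (simp add: comp_of_eq_iff)
  have eqC: "?C x = ?C a" if "x \<in> V" "x \<in> ?C a" for x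
    using that assms comp_of_eq_iff[of a V x S] by (auto simp: comp_of_def)
  have eqCb: "?C x = ?C b" if "x \<in> V" "x \<in> ?C b" for x
    using that assms comp_of_eq_iff[of b V x S] by (auto simp: comp_of_def)
  have self: "x \<in> ?C x" if "x \<in> V" for x using that by (auto simp: comp_of_def)
  have im: "?C' ` V = insert ?M (?C ` V - {?C a, ?C b})"
  proof (rule set_eqI, rule iffI)
    fix D assume "D \<in> ?C' ` V"
    then obtain x where x: "x \<in> V" "D = ?C' x" by auto
    show "D \<in> insert ?M (?C ` V - {?C a, ?C b})"
    proof (cases "x \<in> ?M")
      case True then show ?thesis using x C' by auto
    next
      case False
      then have "?C x \<noteq> ?C a" "?C x \<noteq> ?C b" using self x(1) by auto
      then show ?thesis using False x C' by auto
    qed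
  next
    fix D assume D: "D \<in> insert ?M (?C ` V - {?C a, ?C b})"
    show "D \<in> ?C' ` V"
    proof (cases "D = ?M")
      case True
      then have "D = ?C' a" using C'[of a] assms aC by auto
      then show ?thesis using assms by auto
    next
      case False
      then obtain x where x: "x \<in> V" "D = ?C x" "?C x \<noteq> ?C a" "?C x \<noteq> ?C b" using D by auto
      then have "x \<notin> ?M" using eqC eqCb by auto
      then have "D = ?C' x" using C' x by auto
      then show ?thesis using x by auto
    qed
  qed
  have notin: "?M \<notin> ?C ` V"
  proof
    assume "?M \<in> ?C ` V"
    then obtain x where x: "x \<in> V" "?C x = ?M" by auto
    have "a \<in> ?C x" "b \<in> ?C x" using aC unfolding x(2) by blast+
    then have "(x, a) \<in> link S" "(x, b) \<in> link S" by (simp_all add: comp_of_def)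
    then show False using assms(4) link_trans[OF link_sym[of x a S], of b] by blast
  qed
  have fin: "finite (?C ` V)" using assms by auto
  have "card (?C' ` V) = Suc (card (?C ` V - {?C a, ?C b}))"
    unfolding im using fin notin by (subst card_insert_disjoint) auto
  also have "card (?C ` V - {?C a, ?C b}) = card (?C ` V) - 2"
    using fin ne assms by (subst card_Diff_subset) auto
  finally have 1: "card (?C' ` V) = Suc (card (?C ` V) - 2)" .
  have "card {?C a, ?C b} \<le> card (?C ` V)" using assms fin by (intro card_mono) auto
  then have "2 \<le> card (?C ` V)" using ne by simp
  then show ?thesis using 1 by (simp add: graph_components_eq)
qed

lemma ncomp_insert_le:
  assumes "finite V" "a \<in> V" "b \<in> V"
  shows "ncomp V (insert {a, b} S) \<le> ncomp V S" "ncomp V S \<le> Suc (ncomp V (insert {a, b} S))"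
  using ncomp_insert_linked[of a b S V] ncomp_insert_unlinked[OF assms, of S] by fastforce+

definition path_in :: "'a set set \<Rightarrow> 'a list \<Rightarrow> bool" where
  "path_in S xs \<longleftrightarrow> xs \<noteq> [] \<and> distinct xs \<and> successively (\<lambda>x y. {x, y} \<in> S) xs"

text \<open>Loop erasure: when the walk returns to a vertex of the path, the path is cut
  there.\<close>

lemma link_imp_path:
  assumes "(x, y) \<in> link S"
  shows "\<exists>xs. path_in S xs \<and> hd xs = x \<and> last xs = y"
  using assms
proof (induction rule: link_induct)
  case base
  show ?case by (rule exI[of _ "[x]"]) (auto simp: path_in_def)
next
  case (step y z)
  then obtain xs where xs: "path_in S xs" "hd xs = x" "last xs = y" by auto
  show ?case
  proof (cases "z \<in> set xs")
    case True
    then obtain us vs where us: "xs = us @ z # vs" by (auto simp: in_set_conv_decomp)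
    have "path_in S (us @ [z])" using xs us by (auto simp: path_in_def successively_append_iff)
    moreover have "hd (us @ [z]) = x" using xs us by (cases us) auto
    ultimately show ?thesis by (metis last_snoc)
  next
    case False
    have "path_in S (xs @ [z])" using xs step False
      by (auto simp: path_in_def successively_append_iff)
    moreover have "hd (xs @ [z]) = x" using xs by (cases xs) (auto simp: path_in_def)
    ultimately show ?thesis by (metis last_snoc)
  qed
qed

lemma path_imp_link: "path_in S xs \<Longrightarrow> (hd xs, last xs) \<in> link S"
  unfolding path_in_def
proof (induction xs rule: induct_list012)
  case (3 x y zs)
  then show ?case using link_edge link_trans by fastforce
qed auto

section \<open>Message passing on hanging trees\<close>

lemma sum_Pow_Un_disjoint:
  fixes g :: "'a set \<Rightarrow> 'b::comm_monoid_add"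
  assumes "A \<inter> B = {}"
  shows "(\<Sum>S\<in>Pow (A \<union> B). g S) = (\<Sum>U\<in>Pow A. \<Sum>W\<in>Pow B. g (U \<union> W))"
proof -
  have "bij_betw (\<lambda>(U, W). U \<union> W) (Pow A \<times> Pow B) (Pow (A \<union> B))"
    by (rule bij_betw_byWitness[where f' = "\<lambda>S. (S \<inter> A, S \<inter> B)"]) (use assms in auto)
  then have "(\<Sum>x\<in>Pow A \<times> Pow B. g ((\<lambda>(U, W). U \<union> W) x)) = (\<Sum>S\<in>Pow (A \<union> B). g S)"
    by (rule sum.reindex_bij_betw)
  then show ?thesis by (simp add: sum.cartesian_product case_prod_beta')
qed

lemma sum_Pow_insert:
  fixes g :: "'a set \<Rightarrow> 'b::comm_monoid_add"
  assumes "f \<notin> A"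
  shows "(\<Sum>S\<in>Pow (insert f A). g S) = (\<Sum>U\<in>Pow A. g U + g (insert f U))"
proof -
  have "(\<Sum>S\<in>Pow (A \<union> {f}). g S) = (\<Sum>U\<in>Pow A. \<Sum>W\<in>Pow {f}. g (U \<union> W))"
    by (rule sum_Pow_Un_disjoint) (use assms in auto)
  then show ?thesis by (simp add: Pow_insert add.commute)
qed

text \<open>\<open>I\<close> is the interior of a tree hanging from \<open>w\<close>. The leaves lie
  outside \<open>I\<close>, and reaching one through the open tree edges \<open>U\<close> is the
  only way in which the rest of the graph can meet the cluster of \<open>w\<close>.\<close>

definition escapes :: "'a set \<Rightarrow> 'a \<Rightarrow> 'a set set \<Rightarrow> bool" where
  "escapes I w U \<longleftrightarrow> (\<exists>z. z \<notin> I \<and> (w, z) \<in> link U)"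

text \<open>An edge of \<open>R\<close> could join the cluster only at a vertex of \<open>I\<close>,
  and \<open>R\<close> avoids \<open>I\<close>. So a cluster that stays inside is the same in every
  environment.\<close>

lemma not_escapes_cluster:
  assumes "\<not> escapes I w U" "\<forall>e\<in>R. e \<inter> I = {}" "(w, z) \<in> link (R \<union> U)"
  shows "z \<in> I \<and> (w, z) \<in> link U"
  using assms(3)
proof (induction rule: link_induct)
  case base
  then show ?case using assms(1) by (auto simp: escapes_def)
next
  case (step y z)
  then have "{y, z} \<in> U" using assms(2) by fastforce
  then have "(w, z) \<in> link U" using step.IH link_edge link_trans by metis
  then show ?case using assms(1) by (auto simp: escapes_def)
qed

lemma link_end_touched:
  assumes "(w, z) \<in> link U" "w \<noteq> z"
  shows "\<exists>e\<in>U. z \<in> e"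
  using assms by (induction rule: link_induct) auto

locale rc_params =
  fixes V :: "'a set" and p q :: real
  assumes finite_V: "finite V" and p_pos: "0 < p" and p_less: "p < 1" and q_ge: "1 \<le> q"
begin

text \<open>The total weight of an edge whose ends are not otherwise connected: \<open>1 - p\<close>
  if closed, and \<open>p / q\<close> if open because one component is lost. The edge probability
  \<open>p / (p + (1 - p) * q)\<close> of the sampler equals \<open>p / q / cc\<close>.\<close>

definition cc :: real where "cc = 1 - p + p / q"

text \<open>The edges of \<open>R\<close> are open and act only through connectivity; their own
  factors \<open>p\<close> are left out, so that \<open>R\<close> can absorb frozen parts of a
  configuration.\<close>

definition wt :: "'a set set \<Rightarrow> 'a set set \<Rightarrow> 'a set set \<Rightarrow> real" where
  "wt T R U = p ^ card U * (1 - p) ^ card (T - U) * q ^ ncomp V (R \<union> U)"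

lemma wt_nonneg: "0 \<le> wt T R U"
  using p_pos p_less q_ge by (simp add: wt_def)

lemma cc_pos: "0 < cc"
  using p_pos p_less q_ge by (simp add: cc_def add_pos_pos)

definition tree_ok :: "'a \<Rightarrow> 'a set \<Rightarrow> 'a set set \<Rightarrow> bool" where
  "tree_ok w I T \<longleftrightarrow> finite T \<and> w \<in> V \<and> (\<forall>e\<in>T. e \<inter> I \<noteq> {})"

text \<open>With \<open>N\<^sub>1\<close> and \<open>N\<^sub>0\<close> the total weights of the configurations in which \<open>w\<close> does and does not
  escape, this says \<open>q N\<^sub>1 + N\<^sub>0 \<le> X N\<^sub>0\<close>, for every environment \<open>R\<close>.\<close>

definition root_bound :: "'a \<Rightarrow> 'a set \<Rightarrow> 'a set set \<Rightarrow> real \<Rightarrow> bool" where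
  "root_bound w I T X \<longleftrightarrow> tree_ok w I T \<and> w \<in> I \<and>
     (\<forall>R. (\<forall>e\<in>R. e \<inter> I = {}) \<longrightarrow>
       (\<Sum>U\<in>Pow T. wt T R U * (if escapes I w U then q else 1))
         \<le> X * (\<Sum>U\<in>Pow T. wt T R U * (if escapes I w U then 0 else 1)))"

text \<open>The edge from \<open>x\<close> to its parent is already summed out. Below a parent that
  does not escape by other edges it has weight \<open>1 - p\<close> closed and \<open>p / q\<close>
  open, and the open edge makes the parent escape exactly if \<open>x\<close> does, which then
  brings a factor \<open>q\<close>. This gives \<open>1\<close> and \<open>cc\<close> in the upper
  sum, \<open>1 - p\<close> and \<open>cc\<close> in the lower one. The alternative
  \<open>I = {} \<and> T = {}\<close> is a branch of depth 0, a leaf.\<close>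

definition branch_bound :: "'a \<Rightarrow> 'a set \<Rightarrow> 'a set set \<Rightarrow> real \<Rightarrow> bool" where
  "branch_bound x I T y \<longleftrightarrow> tree_ok x I T \<and> (x \<in> I \<or> I = {} \<and> T = {}) \<and>
     (\<forall>R. (\<forall>e\<in>R. e \<inter> I = {}) \<longrightarrow>
       (\<Sum>U\<in>Pow T. wt T R U * (if escapes I x U then 1 else cc))
         \<le> y * (\<Sum>U\<in>Pow T. wt T R U * (if escapes I x U then 1 - p else cc)))"

text \<open>With \<open>B = 1 / (1 - p)\<close> this is
  \<open>(B * X + q - 1) / (X + B + q - 2)\<close>, the message recursion of the Potts model on a
  tree.\<close>

definition msg :: "real \<Rightarrow> real" where
  "msg X = (cc * q + (X - 1)) / (cc * q + (1 - p) * (X - 1))"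

lemma root_bound_single: "w \<in> V \<Longrightarrow> root_bound w {w} {} 1"
proof -
  have "\<not> escapes {w} w {}" unfolding escapes_def
    using link_end_touched[of w _ "{}"] by auto
  then show "w \<in> V \<Longrightarrow> root_bound w {w} {} 1"
    by (simp add: root_bound_def tree_ok_def)
qed

text \<open>A leaf lies outside its empty interior and so counts as escaping at once: the wired
  boundary condition. The value is the limit of \<open>msg X\<close> for large
  \<open>X\<close>.\<close>

lemma branch_bound_leaf: "x \<in> V \<Longrightarrow> branch_bound x {} {} (1 / (1 - p))"
proof -
  have "escapes {} x {}" by (auto simp: escapes_def intro!: exI[of _ x])
  then show "x \<in> V \<Longrightarrow> branch_bound x {} {} (1 / (1 - p))"
    using p_less by (simp add: branch_bound_def tree_ok_def)
qed

lemma root_bound_mono: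
  assumes "root_bound w I T X" "X \<le> Y"
  shows "root_bound w I T Y"
  unfolding root_bound_def
proof (intro conjI allI impI)
  show "tree_ok w I T" "w \<in> I" using assms(1) by (auto simp: root_bound_def)
  fix R :: "'a set set" assume "\<forall>e\<in>R. e \<inter> I = {}"
  then have "(\<Sum>U\<in>Pow T. wt T R U * (if escapes I w U then q else 1))
         \<le> X * (\<Sum>U\<in>Pow T. wt T R U * (if escapes I w U then 0 else 1))"
    using assms(1) unfolding root_bound_def by blast
  also have "\<dots> \<le> Y * (\<Sum>U\<in>Pow T. wt T R U * (if escapes I w U then 0 else 1))"
    using wt_nonneg by (intro mult_right_mono assms(2) sum_nonneg) simp
  finally show "(\<Sum>U\<in>Pow T. wt T R U * (if escapes I w U then q else 1))
         \<le> Y * (\<Sum>U\<in>Pow T. wt T R U * (if escapes I w U then 0 else 1))" .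
qed

text \<open>The quotient of the two sums of a branch increases with \<open>N1 / N0\<close>. It is
  therefore largest in the extreme case \<open>q * N1 = (X - 1) * N0\<close>, where it equals
  \<open>msg X\<close>.\<close>

lemma root_imp_branch:
  assumes "root_bound w I T X" "1 \<le> X"
  shows "branch_bound w I T (msg X)"
  unfolding branch_bound_def
proof (intro conjI allI impI)
  show "tree_ok w I T" "w \<in> I \<or> I = {} \<and> T = {}" using assms(1) by (auto simp: root_bound_def)
  fix R :: "'a set set" assume R: "\<forall>e\<in>R. e \<inter> I = {}"
  define N1 where "N1 = (\<Sum>U\<in>Pow T. wt T R U * (if escapes I w U then 1 else 0))"
  define N0 where "N0 = (\<Sum>U\<in>Pow T. wt T R U * (if escapes I w U then 0 else 1))"
  have comb: "(\<Sum>U\<in>Pow T. wt T R U * (if escapes I w U then s else t)) = s * N1 + t * N0" for s t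
    unfolding N1_def N0_def sum_distrib_left sum.distrib[symmetric]
    by (rule sum.cong) auto
  have "(\<Sum>U\<in>Pow T. wt T R U * (if escapes I w U then q else 1))
         \<le> X * (\<Sum>U\<in>Pow T. wt T R U * (if escapes I w U then 0 else 1))"
    using assms(1) R unfolding root_bound_def by blast
  then have "q * N1 + 1 * N0 \<le> X * (0 * N1 + 1 * N0)" unfolding comb .
  then have 1: "q * N1 \<le> (X - 1) * N0" by (simp add: algebra_simps)
  have den: "0 < cc * q + (1 - p) * (X - 1)"
    using cc_pos q_ge p_less assms(2) by (intro add_pos_nonneg) auto
  \<comment> \<open>After cross-multiplication the slack of the hypothesis appears with the
    coefficient \<open>p * cc\<close>.\<close>
  have "(1 * N1 + cc * N0) * (cc * q + (1 - p) * (X - 1))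
      = (cc * q + (X - 1)) * ((1 - p) * N1 + cc * N0) - p * cc * ((X - 1) * N0 - q * N1)"
    by (simp add: algebra_simps)
  also have "\<dots> \<le> (cc * q + (X - 1)) * ((1 - p) * N1 + cc * N0)"
    using 1 p_pos cc_pos by simp
  finally show "(\<Sum>U\<in>Pow T. wt T R U * (if escapes I w U then 1 else cc))
         \<le> msg X * (\<Sum>U\<in>Pow T. wt T R U * (if escapes I w U then 1 - p else cc))"
    unfolding comb msg_def using den by (simp add: field_simps)
qed

text \<open>Two readings of one weight: either part of the configuration can be frozen and counted
  to the environment of the other.\<close>

lemma wt_Un:
  assumes "T \<inter> T' = {}" "finite T" "finite T'" "U \<subseteq> T" "U' \<subseteq> T'"
  shows "wt (T \<union> T') R (U \<union> U') = wt T (R \<union> U') U * (p ^ card U' * (1 - p) ^ card (T' - U'))"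
    and "wt (T \<union> T') R (U \<union> U') = wt T' (R \<union> U) U' * (p ^ card U * (1 - p) ^ card (T - U))"
proof -
  have "finite U" "finite U'" using assms by (auto intro: finite_subset)
  then have 1: "card (U \<union> U') = card U + card U'"
    using assms by (intro card_Un_disjoint) auto
  have "T \<union> T' - (U \<union> U') = (T - U) \<union> (T' - U')" using assms by auto
  then have 2: "card (T \<union> T' - (U \<union> U')) = card (T - U) + card (T' - U')"
    using assms by (simp, intro card_Un_disjoint) auto
  have 3: "R \<union> U' \<union> U = R \<union> (U \<union> U')" "R \<union> U \<union> U' = R \<union> (U \<union> U')" by auto
  show "wt (T \<union> T') R (U \<union> U') = wt T (R \<union> U') U * (p ^ card U' * (1 - p) ^ card (T' - U'))"
    "wt (T \<union> T') R (U \<union> U') = wt T' (R \<union> U) U' * (p ^ card U * (1 - p) ^ card (T - U))"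
    unfolding wt_def 1 2 3 by (simp_all add: power_add)
qed

lemma wt_insert_closed:
  assumes "finite T" "f \<notin> T" "U \<subseteq> T"
  shows "wt (insert f T) R U = (1 - p) * wt T R U"
proof -
  have "insert f T - U = insert f (T - U)" using assms by auto
  then show ?thesis using assms by (simp add: wt_def)
qed

lemma wt_insert_open:
  assumes "finite T" "{w, x} \<notin> T" "U \<subseteq> T" "w \<in> V" "x \<in> V"
  shows "wt (insert {w, x} T) R (insert {w, x} U) \<le> p * wt T R U"
    and "(w, x) \<notin> link (R \<union> U) \<Longrightarrow>
          wt (insert {w, x} T) R (insert {w, x} U) = p / q * wt T R U"
proof -
  have fin: "finite U" "{w, x} \<notin> U" using assms finite_subset by auto
  have 1: "insert {w, x} T - insert {w, x} U = T - U" using assms by auto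
  have 2: "R \<union> insert {w, x} U = insert {w, x} (R \<union> U)" by auto
  have "q ^ ncomp V (insert {w, x} (R \<union> U)) \<le> q ^ ncomp V (R \<union> U)"
    using ncomp_insert_le(1)[OF finite_V assms(4,5)] q_ge by (rule power_increasing)
  then show "wt (insert {w, x} T) R (insert {w, x} U) \<le> p * wt T R U"
    unfolding wt_def 1 2 using fin p_pos p_less
    by (simp add: mult.assoc mult_left_mono)
  assume "(w, x) \<notin> link (R \<union> U)"
  then have "ncomp V (R \<union> U) = Suc (ncomp V (insert {w, x} (R \<union> U)))"
    by (intro ncomp_insert_unlinked finite_V assms)
  then show "wt (insert {w, x} T) R (insert {w, x} U) = p / q * wt T R U"
    unfolding wt_def 1 2 using fin q_ge by simp
qed

text \<open>A vertex at which \<open>U\<close> leaves \<open>I\<close> is touched by an edge of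
  \<open>U\<close>, hence lies outside \<open>J\<close> as well; so escaping from one part already
  is escaping from the union.\<close>

lemma escapes_join:
  assumes IJ: "I \<inter> J = {}" "w \<in> I" "x \<notin> I"
    and T: "\<forall>e\<in>U. e \<inter> J = {}" and T': "\<forall>e\<in>U'. e \<inter> I = {}"
  shows "escapes (I \<union> J) w (U \<union> U') \<longleftrightarrow> escapes I w U"
    and "escapes (I \<union> J) w (insert {w, x} (U \<union> U')) \<longleftrightarrow> escapes I w U \<or> escapes J x U'"
proof -
  have a: "\<exists>z. z \<notin> I \<union> J \<and> (w, z) \<in> link (U \<union> U')" if esc: "escapes I w U"
  proof -
    obtain z where z: "z \<notin> I" "(w, z) \<in> link U" using esc by (auto simp: escapes_def)
    then obtain e where "e \<in> U" "z \<in> e" using link_end_touched[of w z U] IJ by auto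
    then have "z \<notin> J" using T by auto
    then show ?thesis using z link_mono[of U "U \<union> U'"] by auto
  qed
  have na: "z \<in> I" if "\<not> escapes I w U" "(w, z) \<in> link (U \<union> U')" for z
    using not_escapes_cluster[OF that(1) T', of z] that(2) by (simp add: Un_commute)
  show "escapes (I \<union> J) w (U \<union> U') \<longleftrightarrow> escapes I w U"
    using a na unfolding escapes_def[of "I \<union> J"] by blast
  have b: "\<exists>z. z \<notin> I \<union> J \<and> (x, z) \<in> link (U \<union> U')" if esc: "escapes J x U'"
  proof -
    obtain z where z: "z \<notin> J" "(x, z) \<in> link U'" using esc by (auto simp: escapes_def)
    have "z \<notin> I"
    proof (cases "x = z")
      case False
      then obtain e where "e \<in> U'" "z \<in> e" using link_end_touched[of x z U'] z by auto
      then show ?thesis using T' by auto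
    qed (use IJ in auto)
    then show ?thesis using z link_mono[of U' "U \<union> U'"] by auto
  qed
  have nb: "z \<in> J" if "\<not> escapes J x U'" "(x, z) \<in> link (U \<union> U')" for z
    using not_escapes_cluster[OF that(1) T, of z] that(2) by auto
  show "escapes (I \<union> J) w (insert {w, x} (U \<union> U')) \<longleftrightarrow> escapes I w U \<or> escapes J x U'"
  proof
    assume "escapes (I \<union> J) w (insert {w, x} (U \<union> U'))"
    then obtain z where z: "z \<notin> I \<union> J" "(w, z) \<in> link (U \<union> U') \<or> (x, z) \<in> link (U \<union> U')"
      by (auto simp: escapes_def link_insert)
    then show "escapes I w U \<or> escapes J x U'" using na[of z] nb[of z] by blast
  next
    assume "escapes I w U \<or> escapes J x U'"
    then show "escapes (I \<union> J) w (insert {w, x} (U \<union> U'))"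
    proof
      assume "escapes I w U"
      then show ?thesis using a unfolding escapes_def[of "I \<union> J"] link_insert by blast
    next
      assume "escapes J x U'"
      then show ?thesis using b link_refl[of w "U \<union> U'"]
        unfolding escapes_def[of "I \<union> J"] link_insert by blast
    qed
  qed
qed

text \<open>Messages multiply because each of the two trees may serve as environment of the other.
  The environment can connect the ends of the new edge only if both \<open>w\<close> and
  \<open>x\<close> escape. Such configurations matter only in the upper sum, where an upper bound
  for the weight is all that is wanted.\<close>

lemma root_bound_join:
  assumes H: "root_bound w I T X" and M: "branch_bound x J T' y" and X: "0 \<le> X"
    and IJ: "I \<inter> J = {}" "x \<notin> I"
    and TJ: "\<forall>e\<in>T. e \<inter> J = {}" and TI: "\<forall>e\<in>T'. e \<inter> I = {}"
    and f: "{w, x} \<notin> T" "{w, x} \<notin> T'"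
  shows "root_bound w (I \<union> J) (insert {w, x} (T \<union> T')) (X * y)"
  unfolding root_bound_def
proof (intro conjI allI impI)
  have w: "w \<in> V" "w \<in> I" "x \<in> V" "finite T" "finite T'"
    and touch: "\<forall>e\<in>T. e \<inter> I \<noteq> {}" "\<forall>e\<in>T'. e \<inter> J \<noteq> {}"
    and xJ: "x \<in> J \<or> J = {}"
    using H M by (auto simp: root_bound_def branch_bound_def tree_ok_def)
  have disj: "T \<inter> T' = {}" using TI touch by auto
  show "tree_ok w (I \<union> J) (insert {w, x} (T \<union> T'))"
    using w touch by (auto simp: tree_ok_def)
  show "w \<in> I \<union> J" using w by auto
  fix R :: "'a set set" assume R: "\<forall>e\<in>R. e \<inter> (I \<union> J) = {}"
  let ?f = "{w, x}" let ?T = "T \<union> T'" let ?G = "insert ?f ?T"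
  let ?a = "escapes I w" let ?b = "escapes J x"
  let ?W = "\<lambda>U U'. wt ?T R (U \<union> U')"
  have fT: "?f \<notin> ?T" using f by auto
  have finT: "finite ?T" using w by auto
  \<comment> \<open>A connection of \<open>w\<close> and \<open>x\<close> by the old edges has to
    leave \<open>I\<close> on the side of \<open>w\<close> and \<open>J\<close> on the side of
    \<open>x\<close>.\<close>
  have unl: "(w, x) \<notin> link (R \<union> (U \<union> U'))" if U: "U \<subseteq> T" "U' \<subseteq> T'" and "\<not> ?a U \<or> \<not> ?b U'" for U U'
  proof
    assume l: "(w, x) \<in> link (R \<union> (U \<union> U'))"
    have 1: "\<forall>e\<in>R \<union> U'. e \<inter> I = {}" "\<forall>e\<in>R \<union> U. e \<inter> J = {}" using R TI TJ U by auto
    have "(w, x) \<in> link ((R \<union> U') \<union> U)" "(x, w) \<in> link ((R \<union> U) \<union> U')"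
      using l link_sym[OF l] by (simp_all add: ac_simps)
    then have "\<not> ?a U \<Longrightarrow> x \<in> I" "\<not> ?b U' \<Longrightarrow> w \<in> J"
      using not_escapes_cluster[OF _ 1(1)] not_escapes_cluster[OF _ 1(2)] by auto
    then show False using that(3) IJ w by auto
  qed
  have esc: "escapes (I \<union> J) w (U \<union> U') \<longleftrightarrow> ?a U"
    "escapes (I \<union> J) w (insert ?f (U \<union> U')) \<longleftrightarrow> ?a U \<or> ?b U'" if "U \<subseteq> T" "U' \<subseteq> T'" for U U'
    using escapes_join[OF IJ(1) w(2) IJ(2), of U U'] TI TJ that by blast+
  have split: "(\<Sum>U\<in>Pow ?G. wt ?G R U * (if escapes (I \<union> J) w U then s else t)) =
     (\<Sum>U\<in>Pow T. \<Sum>U'\<in>Pow T'. (1 - p) * ?W U U' * (if ?a U then s else t)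
        + wt ?G R (insert ?f (U \<union> U')) * (if ?a U \<or> ?b U' then s else t))" for s t
    unfolding sum_Pow_insert[OF fT] sum_Pow_Un_disjoint[OF disj]
  proof (intro sum.cong refl)
    fix U U' assume "U \<in> Pow T" "U' \<in> Pow T'"
    then have U: "U \<subseteq> T" "U' \<subseteq> T'" by auto
    then have "wt ?G R (U \<union> U') = (1 - p) * ?W U U'" using finT fT by (intro wt_insert_closed) auto
    then show "wt ?G R (U \<union> U') * (if escapes (I \<union> J) w (U \<union> U') then s else t) +
       wt ?G R (insert ?f (U \<union> U')) * (if escapes (I \<union> J) w (insert ?f (U \<union> U')) then s else t) =
       (1 - p) * ?W U U' * (if ?a U then s else t)
        + wt ?G R (insert ?f (U \<union> U')) * (if ?a U \<or> ?b U' then s else t)"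
      unfolding esc[OF U] by simp
  qed
  have opn: "wt ?G R (insert ?f (U \<union> U')) \<le> p * ?W U U'"
    "\<not> ?a U \<or> \<not> ?b U' \<Longrightarrow> wt ?G R (insert ?f (U \<union> U')) = p / q * ?W U U'"
    if U: "U \<subseteq> T" "U' \<subseteq> T'" for U U'
    using wt_insert_open[OF finT fT, of "U \<union> U'" R] w U unl[OF U] by blast+
  have q0: "q > 0" using q_ge by simp
  \<comment> \<open>Summing over the two states of the new edge gives the coefficients of
    \<open>branch_bound\<close>, with equality unless both ends escape.\<close>
  have "(\<Sum>U\<in>Pow ?G. wt ?G R U * (if escapes (I \<union> J) w U then q else 1))
     \<le> (\<Sum>U\<in>Pow T. \<Sum>U'\<in>Pow T'. ?W U U' * (if ?a U then q else 1) * (if ?b U' then 1 else cc))"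
    unfolding split
  proof (intro sum_mono)
    fix U U' assume "U \<in> Pow T" "U' \<in> Pow T'"
    then have U: "U \<subseteq> T" "U' \<subseteq> T'" by auto
    show "(1 - p) * ?W U U' * (if ?a U then q else 1)
        + wt ?G R (insert ?f (U \<union> U')) * (if ?a U \<or> ?b U' then q else 1)
        \<le> ?W U U' * (if ?a U then q else 1) * (if ?b U' then 1 else cc)"
    proof (cases "?a U \<and> ?b U'")
      case True
      have "wt ?G R (insert ?f (U \<union> U')) * q \<le> p * ?W U U' * q"
        using opn(1)[OF U] q0 by (simp add: mult_right_mono)
      then show ?thesis using True by (simp add: algebra_simps)
    next
      case False
      then have e: "wt ?G R (insert ?f (U \<union> U')) = p / q * ?W U U'" using opn(2)[OF U] by auto
      show ?thesis unfolding e cc_def using False q0 by (auto simp: field_simps)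
    qed
  qed
  also have "\<dots> = (\<Sum>U'\<in>Pow T'. (\<Sum>U\<in>Pow T. wt T (R \<union> U') U * (if ?a U then q else 1))
       * ((p ^ card U' * (1 - p) ^ card (T' - U')) * (if ?b U' then 1 else cc)))"
    unfolding sum_distrib_right
    by (subst sum.swap, intro sum.cong refl) (simp add: wt_Un(1)[OF disj w(4,5)])
  \<comment> \<open>With \<open>U'\<close> frozen, the tree at \<open>w\<close> sees the environment
    \<open>R \<union> U'\<close>. Afterwards the sums are exchanged, \<open>U\<close> is frozen, and
    the branch at \<open>x\<close> sees \<open>R \<union> U\<close>.\<close>
  also have "\<dots> \<le> (\<Sum>U'\<in>Pow T'. (X * (\<Sum>U\<in>Pow T. wt T (R \<union> U') U * (if ?a U then 0 else 1)))
       * ((p ^ card U' * (1 - p) ^ card (T' - U')) * (if ?b U' then 1 else cc)))"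
  proof (intro sum_mono mult_right_mono)
    fix U' assume U': "U' \<in> Pow T'"
    have "\<forall>e\<in>R \<union> U'. e \<inter> I = {}" using R TI U' by auto
    then show "(\<Sum>U\<in>Pow T. wt T (R \<union> U') U * (if ?a U then q else 1))
      \<le> X * (\<Sum>U\<in>Pow T. wt T (R \<union> U') U * (if ?a U then 0 else 1))"
      using H unfolding root_bound_def by blast
    show "0 \<le> (p ^ card U' * (1 - p) ^ card (T' - U')) * (if ?b U' then 1 else cc)"
      using p_pos p_less cc_pos by auto
  qed
  also have "\<dots> = X * (\<Sum>U\<in>Pow T. (\<Sum>U'\<in>Pow T'. wt T' (R \<union> U) U' * (if ?b U' then 1 else cc))
      * ((p ^ card U * (1 - p) ^ card (T - U)) * (if ?a U then 0 else 1)))"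
    unfolding sum_distrib_left sum_distrib_right
  proof (subst sum.swap, intro sum.cong refl)
    fix U U' assume "U \<in> Pow T" "U' \<in> Pow T'"
    then have U: "U \<subseteq> T" "U' \<subseteq> T'" by auto
    show "X * (wt T (R \<union> U') U * (if ?a U then 0 else 1)) *
         (p ^ card U' * (1 - p) ^ card (T' - U') * (if ?b U' then 1 else cc)) =
      X * (wt T' (R \<union> U) U' * (if ?b U' then 1 else cc) *
         (p ^ card U * (1 - p) ^ card (T - U) * (if ?a U then 0 else 1)))"
      using wt_Un(1)[OF disj w(4,5) U, of R] wt_Un(2)[OF disj w(4,5) U, of R] by simp
  qed
  also have "\<dots> \<le> X * (\<Sum>U\<in>Pow T. (y * (\<Sum>U'\<in>Pow T'. wt T' (R \<union> U) U' * (if ?b U' then 1 - p else cc)))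
      * ((p ^ card U * (1 - p) ^ card (T - U)) * (if ?a U then 0 else 1)))"
  proof (intro mult_left_mono[OF _ X] sum_mono mult_right_mono)
    fix U assume U: "U \<in> Pow T"
    have "\<forall>e\<in>R \<union> U. e \<inter> J = {}" using R TJ U by auto
    then show "(\<Sum>U'\<in>Pow T'. wt T' (R \<union> U) U' * (if ?b U' then 1 else cc))
      \<le> y * (\<Sum>U'\<in>Pow T'. wt T' (R \<union> U) U' * (if ?b U' then 1 - p else cc))"
      using M unfolding branch_bound_def by blast
    show "0 \<le> (p ^ card U * (1 - p) ^ card (T - U)) * (if ?a U then 0 else (1::real))"
      using p_pos p_less by auto
  qed
  also have "\<dots> = (X * y) * (\<Sum>U\<in>Pow T. \<Sum>U'\<in>Pow T'. ?W U U' * ((if ?a U then 0 else 1) * (if ?b U' then 1 - p else cc)))"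
    unfolding sum_distrib_left sum_distrib_right
    by (intro sum.cong refl) (simp add: wt_Un(2)[OF disj w(4,5)] algebra_simps)
  also have "(\<Sum>U\<in>Pow T. \<Sum>U'\<in>Pow T'. ?W U U' * ((if ?a U then 0 else 1) * (if ?b U' then 1 - p else cc)))
     = (\<Sum>U\<in>Pow ?G. wt ?G R U * (if escapes (I \<union> J) w U then 0 else 1))"
    unfolding split
  proof (intro sum.cong refl)
    fix U U' assume "U \<in> Pow T" "U' \<in> Pow T'"
    then have U: "U \<subseteq> T" "U' \<subseteq> T'" by auto
    show "?W U U' * ((if ?a U then 0 else 1) * (if ?b U' then 1 - p else cc)) =
      (1 - p) * ?W U U' * (if ?a U then 0 else 1)
        + wt ?G R (insert ?f (U \<union> U')) * (if ?a U \<or> ?b U' then 0 else 1)"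
      using opn(2)[OF U] q0 unfolding cc_def by (auto simp: field_simps)
  qed
  finally show "(\<Sum>U\<in>Pow ?G. wt ?G R U * (if escapes (I \<union> J) w U then q else 1))
         \<le> X * y * (\<Sum>U\<in>Pow ?G. wt ?G R U * (if escapes (I \<union> J) w U then 0 else 1))" .
qed

section \<open>The conditional probability of one edge above a hanging tree\<close>

definition open_weight :: "'a set set \<Rightarrow> 'a set set \<Rightarrow> real" where
  "open_weight E A = (\<Sum>S\<in>{S. A \<subseteq> S \<and> S \<subseteq> E}. rc_weight V E p q S)"

lemma open_weight_eq:
  assumes "finite E" "A \<subseteq> E"
  shows "open_weight E A = (\<Sum>S\<in>Pow (E - A). p ^ card A * wt (E - A) A S)"
proof -
  have "bij_betw (\<lambda>S. A \<union> S) (Pow (E - A)) {S. A \<subseteq> S \<and> S \<subseteq> E}"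
    by (rule bij_betw_byWitness[where f' = "\<lambda>S. S - A"]) (use assms in auto)
  then have "open_weight E A = (\<Sum>S\<in>Pow (E - A). rc_weight V E p q (A \<union> S))"
    unfolding open_weight_def by (rule sum.reindex_bij_betw[symmetric])
  also have "\<dots> = (\<Sum>S\<in>Pow (E - A). p ^ card A * wt (E - A) A S)"
  proof (intro sum.cong refl)
    fix S assume S: "S \<in> Pow (E - A)"
    then have "card (A \<union> S) = card A + card S"
      using assms by (intro card_Un_disjoint) (auto intro: finite_subset)
    moreover have "E - (A \<union> S) = E - A - S" by auto
    ultimately show "rc_weight V E p q (A \<union> S) = p ^ card A * wt (E - A) A S"
      by (simp add: rc_weight_def wt_def power_add)
  qed
  finally show ?thesis .
qed

text \<open>Fix the configuration \<open>W\<close> of the edges outside the tree. With the weights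
  of the escaping and non-escaping tree configurations called \<open>N1\<close> and
  \<open>N0\<close>, an open edge has weight at most
  \<open>p / q * (q * N1 + N0) \<le> p / q * X * N0\<close>, and both states together have at least
  \<open>cc * N0\<close>, up to a common factor. The quotient is \<open>X\<close> times the edge
  probability of the sampler.\<close>

lemma open_weight_step:
  assumes E: "finite E" "A \<subseteq> E" "{u, w} \<in> E - A" "u \<in> V"
    and H: "root_bound w I T X" and T: "T \<subseteq> E - A - {{u, w}}" "u \<notin> I"
    and all: "\<forall>e\<in>E - {{u, w}}. e \<inter> I \<noteq> {} \<longrightarrow> e \<in> T"
  shows "open_weight E (insert {u, w} A) \<le> p / (p + (1 - p) * q) * X * open_weight E A"
proof -
  let ?e = "{u, w}"
  define Q where "Q = E - A - {?e} - T"
  have w: "w \<in> V" "w \<in> I" using H by (auto simp: root_bound_def tree_ok_def)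
  have q0: "q > 0" using q_ge by simp
  have EA: "E - A = insert ?e (Q \<union> T)" "E - insert ?e A = Q \<union> T" "?e \<notin> Q \<union> T" "Q \<inter> T = {}"
    using E T by (auto simp: Q_def)
  have "finite T" using H by (auto simp: root_bound_def tree_ok_def)
  then have fin: "finite Q" "finite T" "finite A" "finite (Q \<union> T)" using E T
    by (auto simp: Q_def intro: finite_subset)
  have noR: "\<forall>e\<in>A \<union> W. e \<inter> I = {}" if "W \<subseteq> Q" for W
    using all that E T unfolding Q_def by blast
  have open_: "wt (insert ?e (Q \<union> T)) A (insert ?e S) = p * wt (Q \<union> T) (insert ?e A) S" if "S \<subseteq> Q \<union> T" for S
  proof -
    have "finite S" using that fin by (auto intro: finite_subset)
    moreover have "?e \<notin> S" "insert ?e (Q \<union> T) - insert ?e S = Q \<union> T - S"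
      "A \<union> insert ?e S = insert ?e A \<union> S"
      using that EA by auto
    ultimately show ?thesis by (simp add: wt_def)
  qed
  have Z1: "open_weight E (insert ?e A) =
      p ^ card A * (\<Sum>W\<in>Pow Q. \<Sum>U\<in>Pow T. wt (insert ?e (Q \<union> T)) A (insert ?e (W \<union> U)))"
  proof -
    have "open_weight E (insert ?e A) = (\<Sum>S\<in>Pow (Q \<union> T). p ^ Suc (card A) * wt (Q \<union> T) (insert ?e A) S)"
    proof -
      have "insert ?e A \<subseteq> E" "card (insert ?e A) = Suc (card A)" using E fin by auto
      then show ?thesis using open_weight_eq[of E "insert ?e A"] E(1) unfolding EA(2) by simp
    qed
    also have "\<dots> = (\<Sum>S\<in>Pow (Q \<union> T). p ^ card A * wt (insert ?e (Q \<union> T)) A (insert ?e S))"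
      using open_ by (intro sum.cong) auto
    finally show ?thesis by (simp add: sum_distrib_left sum_Pow_Un_disjoint[OF EA(4)])
  qed
  have Z0: "open_weight E A = p ^ card A * (\<Sum>W\<in>Pow Q. \<Sum>U\<in>Pow T.
        (1 - p) * wt (Q \<union> T) A (W \<union> U) + wt (insert ?e (Q \<union> T)) A (insert ?e (W \<union> U)))"
  proof -
    have "open_weight E A = p ^ card A * (\<Sum>S\<in>Pow (Q \<union> T).
        wt (insert ?e (Q \<union> T)) A S + wt (insert ?e (Q \<union> T)) A (insert ?e S))"
      using open_weight_eq[OF E(1,2)] unfolding EA(1)
      by (simp add: sum_distrib_left[symmetric] sum_Pow_insert[OF EA(3)])
    also have "\<dots> = p ^ card A * (\<Sum>S\<in>Pow (Q \<union> T).
        (1 - p) * wt (Q \<union> T) A S + wt (insert ?e (Q \<union> T)) A (insert ?e S))"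
      using wt_insert_closed[OF fin(4) EA(3)] by (intro arg_cong2[where f = "(*)"] sum.cong refl) auto
    finally show ?thesis by (simp add: sum_Pow_Un_disjoint[OF EA(4)])
  qed
  let ?n = "\<lambda>W. p ^ card W * (1 - p) ^ card (Q - W)"
  have main: "(\<Sum>U\<in>Pow T. wt (insert ?e (Q \<union> T)) A (insert ?e (W \<union> U)))
      \<le> p / (p + (1 - p) * q) * X *
        (\<Sum>U\<in>Pow T. (1 - p) * wt (Q \<union> T) A (W \<union> U) + wt (insert ?e (Q \<union> T)) A (insert ?e (W \<union> U)))"
    if W: "W \<in> Pow Q" for W
  proof -
    have WQ: "W \<subseteq> Q" using W by auto
    let ?a = "escapes I w"
    let ?N = "\<Sum>U\<in>Pow T. wt T (A \<union> W) U * (if ?a U then 0 else 1)"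
    have unl: "(u, w) \<notin> link (A \<union> (W \<union> U))" if "\<not> ?a U" for U
    proof
      assume "(u, w) \<in> link (A \<union> (W \<union> U))"
      then have "(w, u) \<in> link ((A \<union> W) \<union> U)" using link_sym by (metis Un_assoc)
      then show False using not_escapes_cluster[OF that noR[OF WQ]] T by auto
    qed
    have eqn: "wt (Q \<union> T) A (W \<union> U) = ?n W * wt T (A \<union> W) U" if "U \<in> Pow T" for U
      using wt_Un(2)[OF EA(4) fin(1,2) WQ, of U A] that by simp
    have o1: "wt (insert ?e (Q \<union> T)) A (insert ?e (W \<union> U)) \<le> p * (?n W * wt T (A \<union> W) U)"
      "\<not> ?a U \<Longrightarrow> wt (insert ?e (Q \<union> T)) A (insert ?e (W \<union> U)) = p / q * (?n W * wt T (A \<union> W) U)"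
      if "U \<in> Pow T" for U
      using wt_insert_open[OF fin(4) EA(3), of "W \<union> U" A] unl[of U] that WQ E w
      unfolding eqn[OF that, symmetric] by blast+
    have n0: "0 \<le> ?n W" using p_pos p_less by auto
    have up: "(\<Sum>U\<in>Pow T. wt (insert ?e (Q \<union> T)) A (insert ?e (W \<union> U))) \<le> p / q * ?n W * X * ?N"
    proof -
      have "(\<Sum>U\<in>Pow T. wt (insert ?e (Q \<union> T)) A (insert ?e (W \<union> U)))
        \<le> (\<Sum>U\<in>Pow T. p / q * ?n W * (wt T (A \<union> W) U * (if ?a U then q else 1)))"
      proof (intro sum_mono)
        fix U assume U: "U \<in> Pow T"
        show "wt (insert ?e (Q \<union> T)) A (insert ?e (W \<union> U))
          \<le> p / q * ?n W * (wt T (A \<union> W) U * (if ?a U then q else 1))"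
          using o1[OF U] q0 by (cases "?a U") (simp_all add: ac_simps)
      qed
      also have "\<dots> = p / q * ?n W * (\<Sum>U\<in>Pow T. wt T (A \<union> W) U * (if ?a U then q else 1))"
        by (simp add: sum_distrib_left)
      also have "\<dots> \<le> p / q * ?n W * (X * ?N)"
        using H noR[OF WQ] n0 p_pos q0 unfolding root_bound_def
        by (intro mult_left_mono) auto
      finally show ?thesis by (simp add: mult.assoc)
    qed
    \<comment> \<open>Configurations in which \<open>w\<close> escapes are dropped from the
      total.\<close>
    have low: "cc * ?n W * ?N \<le>
        (\<Sum>U\<in>Pow T. (1 - p) * wt (Q \<union> T) A (W \<union> U) + wt (insert ?e (Q \<union> T)) A (insert ?e (W \<union> U)))"
      unfolding sum_distrib_left
    proof (intro sum_mono)
      fix U assume U: "U \<in> Pow T"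
      have nn: "0 \<le> wt (Q \<union> T) A (W \<union> U)" "0 \<le> wt (insert ?e (Q \<union> T)) A (insert ?e (W \<union> U))"
        by (rule wt_nonneg)+
      show "cc * ?n W * (wt T (A \<union> W) U * (if ?a U then 0 else 1))
         \<le> (1 - p) * wt (Q \<union> T) A (W \<union> U) + wt (insert ?e (Q \<union> T)) A (insert ?e (W \<union> U))"
      proof (cases "?a U")
        case True then show ?thesis using nn p_less by simp
      next
        case False
        then show ?thesis using o1(2)[OF U] eqn[OF U] by (simp add: cc_def algebra_simps)
      qed
    qed
    have "p / (p + (1 - p) * q) * cc = p / q"
    proof -
      have "p + (1 - p) * q = cc * q" using q0 by (simp add: cc_def field_simps)
      then show ?thesis using cc_pos by simp
    qed
    then have "p / q * ?n W * X * ?N = (p / (p + (1 - p) * q) * cc) * ?n W * X * ?N" by (simp only:)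
    also have "\<dots> = p / (p + (1 - p) * q) * X * (cc * ?n W * ?N)" by (simp only: mult_ac)
    finally have "p / q * ?n W * X * ?N = p / (p + (1 - p) * q) * X * (cc * ?n W * ?N)" .
    \<comment> \<open>\<open>root_bound\<close> forces \<open>X\<close> to be nonnegative: its
      left-hand sum is positive, while \<open>?N\<close> is not negative.\<close>
    moreover have X0: "0 \<le> p / (p + (1 - p) * q) * X"
    proof -
      have "?N \<ge> 0" by (intro sum_nonneg mult_nonneg_nonneg wt_nonneg) auto
      have "wt T (A \<union> W) {} > 0" using p_pos p_less q0 by (simp add: wt_def)
      have "0 < (\<Sum>U\<in>Pow T. wt T (A \<union> W) U * (if ?a U then q else 1))"
        by (rule sum_pos) (use fin p_pos p_less q0 in \<open>auto simp: wt_def\<close>)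
      also have "\<dots> \<le> X * ?N" using H noR[OF WQ] unfolding root_bound_def by auto
      finally have "0 \<le> X" using \<open>?N \<ge> 0\<close> by (metis less_le_not_le linorder_not_less mult_nonneg_nonpos2 mult.commute)
      then show ?thesis using p_pos p_less q0 by simp
    qed
    ultimately show ?thesis using up mult_left_mono[OF low X0] by linarith
  qed
  have "open_weight E (insert ?e A) \<le> p ^ card A * (\<Sum>W\<in>Pow Q. p / (p + (1 - p) * q) * X *
        (\<Sum>U\<in>Pow T. (1 - p) * wt (Q \<union> T) A (W \<union> U) + wt (insert ?e (Q \<union> T)) A (insert ?e (W \<union> U))))"
    unfolding Z1 using p_pos main by (intro mult_left_mono sum_mono) auto
  also have "\<dots> = p / (p + (1 - p) * q) * X * open_weight E A"
    unfolding Z0 sum_distrib_left[symmetric] by (simp only: mult_ac)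
  finally show ?thesis .
qed

end

section \<open>Locally unique paths\<close>

lemma path_in_Cons:
  "xs \<noteq> [] \<Longrightarrow> path_in E (w # xs) \<longleftrightarrow> {w, hd xs} \<in> E \<and> w \<notin> set xs \<and> path_in E xs"
  by (cases xs) (auto simp: path_in_def)

lemma path_in_mono: "path_in E xs \<Longrightarrow> E \<subseteq> F \<Longrightarrow> path_in F xs"
  unfolding path_in_def by (auto elim: successively_mono)

lemma path_in_snoc:
  "xs \<noteq> [] \<Longrightarrow> path_in E (xs @ [w]) \<longleftrightarrow> path_in E xs \<and> {last xs, w} \<in> E \<and> w \<notin> set xs"
  by (auto simp: path_in_def successively_append_iff)

lemma path_in_append1: "path_in E (us @ vs) \<Longrightarrow> us \<noteq> [] \<Longrightarrow> path_in E us"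
  by (auto simp: path_in_def successively_append_iff)

lemma path_vertex_touched: "path_in E xs \<Longrightarrow> v \<in> set xs \<Longrightarrow> v \<noteq> hd xs \<Longrightarrow> \<exists>e\<in>E. v \<in> e"
proof (induction xs)
  case (Cons x xs)
  then have ne: "xs \<noteq> []" by auto
  then have "{x, hd xs} \<in> E" "path_in E xs" using Cons.prems by (auto simp: path_in_Cons)
  then show ?case using Cons by (cases "v = hd xs") auto
qed (simp add: path_in_def)

definition star :: "'a set set \<Rightarrow> 'a \<Rightarrow> 'a set set" where
  "star E w = {e \<in> E. w \<in> e}"

definition touching :: "'a set set \<Rightarrow> 'a set \<Rightarrow> 'a set set" where
  "touching E I = {e \<in> E. e \<inter> I \<noteq> {}}"

text \<open>Lengths count vertices, so this is the interior of the ball of radius \<open>k\<close>;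
  for \<open>k = 0\<close> it is empty and \<open>w\<close> itself is a leaf.\<close>

definition near :: "'a set set \<Rightarrow> 'a \<Rightarrow> nat \<Rightarrow> 'a set" where
  "near E w k = {last xs | xs. path_in E xs \<and> hd xs = w \<and> length xs \<le> k}"

text \<open>A path to an interior vertex is unique even among paths with one more vertex, which
  rules out edges closing a cycle inside. Two paths with \<open>Suc k\<close> vertices may share
  their end: leaves may coincide, since only reaching some leaf matters.\<close>

definition unique_paths :: "'a set set \<Rightarrow> 'a \<Rightarrow> nat \<Rightarrow> bool" where
  "unique_paths E w k \<longleftrightarrow> (\<forall>xs ys. path_in E xs \<and> hd xs = w \<and> length xs \<le> k \<and>
      path_in E ys \<and> hd ys = w \<and> length ys \<le> Suc k \<and> last xs = last ys \<longrightarrow> xs = ys)"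

lemma unique_pathsD:
  assumes "unique_paths E w k" "path_in E xs" "hd xs = w" "length xs \<le> k"
    "path_in E ys" "hd ys = w" "length ys \<le> Suc k" "last xs = last ys"
  shows "xs = ys"
  using assms unfolding unique_paths_def by blast

definition graph_on :: "'a set \<Rightarrow> 'a set set \<Rightarrow> bool" where
  "graph_on V E \<longleftrightarrow> finite V \<and> (\<forall>e\<in>E. e \<subseteq> V \<and> card e = 2)"

lemma graph_on_finite: "graph_on V E \<Longrightarrow> finite E"
  unfolding graph_on_def by (meson Pow_iff finite_Pow_iff rev_finite_subset subsetI)

lemma graph_on_subset: "graph_on V E \<Longrightarrow> F \<subseteq> E \<Longrightarrow> graph_on V F"
  by (auto simp: graph_on_def)

lemma graph_on_edge: "graph_on V E \<Longrightarrow> {a, b} \<in> E \<Longrightarrow> a \<noteq> b \<and> a \<in> V \<and> b \<in> V"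
  by (fastforce simp: graph_on_def card_2_iff doubleton_eq_iff)

lemma graph_on_edgeE:
  assumes "graph_on V E" "e \<in> E" "a \<in> e"
  obtains b where "e = {a, b}" "a \<noteq> b"
proof -
  have "card e = 2" using assms by (auto simp: graph_on_def)
  then obtain x y where "e = {x, y}" "x \<noteq> y" by (auto simp: card_2_iff)
  then show ?thesis using that assms(3) by (cases "a = x") (auto simp: insert_commute)
qed

lemma near_empty [simp]: "near E w 0 = {}"
  by (auto simp: near_def path_in_def)

lemma nearI: "path_in E xs \<Longrightarrow> hd xs = w \<Longrightarrow> length xs \<le> k \<Longrightarrow> last xs \<in> near E w k"
  by (auto simp: near_def)

section \<open>Splitting a tree-like neighbourhood into the branches at the root\<close>

context
  fixes V :: "'a set" and E E2 :: "'a set set" and w :: 'a and k :: nat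
  assumes G: "graph_on V E" and uniq: "unique_paths E w (Suc k)"
  defines "E2 \<equiv> E - star E w"
begin

lemma E2_edge: "e \<in> E2 \<Longrightarrow> e \<in> E \<and> w \<notin> e"
  by (auto simp: E2_def star_def)

lemma path_extend:
  assumes "{w, x} \<in> E" "path_in E2 xs" "hd xs = x"
  shows "path_in E (w # xs)" "w \<notin> set xs"
proof -
  have "x \<noteq> w" using graph_on_edge[OF G assms(1)] by auto
  then show w: "w \<notin> set xs" using path_vertex_touched[OF assms(2), of w] assms(3) E2_edge by auto
  have "xs \<noteq> []" using assms(2) by (auto simp: path_in_def)
  then show "path_in E (w # xs)"
    using w assms path_in_mono[OF assms(2), of E] by (auto simp: path_in_Cons E2_def)
qed

lemma path_tail:
  assumes "path_in E (w # xs)" "xs \<noteq> []"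
  shows "path_in E2 xs" "{w, hd xs} \<in> E"
proof -
  have xs: "w \<notin> set xs" "path_in E xs" "{w, hd xs} \<in> E" using assms by (auto simp: path_in_Cons)
  show "{w, hd xs} \<in> E" by fact
  have "successively (\<lambda>x y. {x, y} \<in> E2) xs"
    using xs(2) unfolding path_in_def
  proof (elim conjE, elim successively_mono)
    fix a b assume "a \<in> set xs" "b \<in> set xs" "{a, b} \<in> E"
    then show "{a, b} \<in> E2" using xs(1) by (auto simp: E2_def star_def)
  qed
  then show "path_in E2 xs" using xs(2) by (auto simp: path_in_def)
qed

lemma unique_paths_child: "{w, x} \<in> E \<Longrightarrow> unique_paths E2 x k"
  unfolding unique_paths_def
proof (intro allI impI, elim conjE)
  fix xs ys assume wx: "{w, x} \<in> E"
    and xs: "path_in E2 xs" "hd xs = x" "length xs \<le> k"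
    and ys: "path_in E2 ys" "hd ys = x" "length ys \<le> Suc k" and last: "last xs = last ys"
  have "xs \<noteq> []" "ys \<noteq> []" using xs ys by (auto simp: path_in_def)
  then have "w # xs = w # ys"
    using xs ys last path_extend[OF wx] by (intro unique_pathsD[OF uniq]) auto
  then show "xs = ys" by simp
qed

lemma child_not_near:
  assumes "{w, x} \<in> E" "{w, x'} \<in> E" "x \<noteq> x'"
  shows "x \<notin> near E2 x' k"
proof
  assume "x \<in> near E2 x' k"
  then obtain ys where ys: "path_in E2 ys" "hd ys = x'" "length ys \<le> k" "last ys = x"
    by (auto simp: near_def)
  have "ys \<noteq> []" using ys by (auto simp: path_in_def)
  have "path_in E [w, x]" using assms graph_on_edge[OF G assms(1)] by (auto simp: path_in_def)
  then have "w # ys = [w, x]"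
    using ys path_extend[OF assms(2)] \<open>ys \<noteq> []\<close> by (intro unique_pathsD[OF uniq]) auto
  then show False using ys assms(3) by auto
qed

lemma near_disjoint:
  assumes "{w, x} \<in> E" "{w, x'} \<in> E" "x \<noteq> x'"
  shows "near E2 x k \<inter> near E2 x' k = {}"
proof (rule ccontr)
  assume "near E2 x k \<inter> near E2 x' k \<noteq> {}"
  then obtain xs ys where ys: "path_in E2 ys" "hd ys = x'" "length ys \<le> k"
    and xs: "path_in E2 xs" "hd xs = x" "length xs \<le> k" "last xs = last ys"
    by (force simp: near_def)
  have "xs \<noteq> []" "ys \<noteq> []" using xs ys by (auto simp: path_in_def)
  then have "w # xs = w # ys"
    using ys xs path_extend[OF assms(2)] path_extend[OF assms(1)]
    by (intro unique_pathsD[OF uniq]) auto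
  then show False using ys xs assms(3) by auto
qed

text \<open>An edge between two branches would let its end \<open>b\<close> be reached from
  \<open>w\<close> through \<open>x\<close> with at most \<open>Suc k\<close> vertices, and through
  \<open>x'\<close> with at most one more. This is what the longer path in
  \<open>unique_paths\<close> is for.\<close>

lemma near_separated:
  assumes "{w, x} \<in> E" "{w, x'} \<in> E" "x \<noteq> x'" "e \<in> E2"
    "e \<inter> near E2 x' k \<noteq> {}" "e \<inter> near E2 x k \<noteq> {}"
  shows False
proof -
  obtain a b where ab: "a \<in> e" "a \<in> near E2 x' k" "b \<in> e" "b \<in> near E2 x k"
    using assms by auto
  have "a \<noteq> b" using ab near_disjoint[OF assms(1-3)] by auto
  have "e \<in> E" using assms(4) E2_edge by auto
  then have e: "e = {a, b}" using graph_on_edgeE[OF G _ ab(1)] ab \<open>a \<noteq> b\<close> by auto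
  obtain ys where ys: "path_in E2 ys" "hd ys = x'" "length ys \<le> k" "last ys = a"
    using ab by (auto simp: near_def)
  obtain xs where xs: "path_in E2 xs" "hd xs = x" "length xs \<le> k" "last xs = b"
    using ab by (auto simp: near_def)
  have ne: "xs \<noteq> []" "ys \<noteq> []" using xs ys by (auto simp: path_in_def)
  show False
  proof (cases "b \<in> set ys")
    case True
    then obtain us vs where us: "ys = (us @ [b]) @ vs" by (auto simp: in_set_conv_decomp)
    then have "path_in E2 (us @ [b])" using ys(1) path_in_append1 by blast
    moreover have "hd (us @ [b]) = x'" using ys us by (cases us) auto
    moreover have "length (us @ [b]) \<le> k" using ys us by auto
    ultimately have "b \<in> near E2 x' k" using nearI[of E2 "us @ [b]"] by auto
    then show False using ab near_disjoint[OF assms(1-3)] by auto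
  next
    case False
    have p: "path_in E2 (ys @ [b])" using ys False assms(4) e ne by (auto simp: path_in_snoc)
    have h: "hd (ys @ [b]) = x'" using ys ne by auto
    have "w # xs = w # (ys @ [b])"
      using path_extend[OF assms(1) xs(1,2)] path_extend[OF assms(2) p h] xs ys ne
      by (intro unique_pathsD[OF uniq]) auto
    then have "xs = ys @ [b]" by simp
    then show False using xs h assms(3) by metis
  qed
qed

lemma root_not_near: "{w, x} \<in> E \<Longrightarrow> w \<notin> near E2 x k"
  using path_extend by (fastforce simp: near_def path_in_def)

lemma near_Suc: "near E w (Suc k) = insert w (\<Union>x\<in>{x. {w, x} \<in> E}. near E2 x k)"
proof (intro equalityI subsetI)
  fix z assume "z \<in> near E w (Suc k)"
  then obtain xs where xs: "path_in E xs" "hd xs = w" "length xs \<le> Suc k" "z = last xs"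
    by (auto simp: near_def)
  then obtain ys where ys: "xs = w # ys" by (cases xs) (auto simp: path_in_def)
  show "z \<in> insert w (\<Union>x\<in>{x. {w, x} \<in> E}. near E2 x k)"
  proof (cases "ys = []")
    case False
    then have "z \<in> near E2 (hd ys) k" "{w, hd ys} \<in> E"
      using path_tail[of ys] xs ys by (auto intro: nearI)
    then show ?thesis by auto
  qed (use xs ys in auto)
next
  fix z assume z: "z \<in> insert w (\<Union>x\<in>{x. {w, x} \<in> E}. near E2 x k)"
  show "z \<in> near E w (Suc k)"
  proof (cases "z = w")
    case True
    then show ?thesis using nearI[of E "[w]" w "Suc k"] by (auto simp: path_in_def)
  next
    case False
    then obtain x xs where x: "{w, x} \<in> E" "path_in E2 xs" "hd xs = x" "length xs \<le> k" "z = last xs"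
      using z by (auto simp: near_def)
    have "xs \<noteq> []" using x by (auto simp: path_in_def)
    then show ?thesis using nearI[of E "w # xs" w "Suc k"] path_extend[OF x(1-3)] x by auto
  qed
qed

lemma touching_Suc: "touching E (near E w (Suc k)) =
    (\<Union>x\<in>{x. {w, x} \<in> E}. insert {w, x} (touching E2 (near E2 x k)))"
proof (intro equalityI subsetI)
  fix e assume e: "e \<in> touching E (near E w (Suc k))"
  show "e \<in> (\<Union>x\<in>{x. {w, x} \<in> E}. insert {w, x} (touching E2 (near E2 x k)))"
  proof (cases "w \<in> e")
    case True
    have "e \<in> E" using e by (auto simp: touching_def)
    then obtain x where "e = {w, x}" using graph_on_edgeE[OF G _ True] by metis
    then show ?thesis using e by (auto simp: touching_def)
  next
    case False
    then show ?thesis using e unfolding near_Suc by (auto simp: touching_def E2_def star_def)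
  qed
next
  fix e assume "e \<in> (\<Union>x\<in>{x. {w, x} \<in> E}. insert {w, x} (touching E2 (near E2 x k)))"
  then show "e \<in> touching E (near E w (Suc k))"
    unfolding near_Suc by (auto simp: touching_def E2_def)
qed

end

section \<open>Messages in locally tree-like graphs\<close>

context rc_params
begin

fun mseq :: "nat \<Rightarrow> nat \<Rightarrow> real" where
  "mseq d 0 = 1 / (1 - p)"
| "mseq d (Suc k) = msg (mseq d k ^ d)"

lemma msg_ge_1: "1 \<le> X \<Longrightarrow> 1 \<le> msg X"
proof -
  assume X: "1 \<le> X"
  have "0 < cc * q + (1 - p) * (X - 1)"
    using cc_pos q_ge p_less X by (intro add_pos_nonneg) auto
  moreover have "(1 - p) * (X - 1) \<le> 1 * (X - 1)" using p_pos X by (intro mult_right_mono) auto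
  ultimately show ?thesis unfolding msg_def by simp
qed

lemma mseq_ge_1: "1 \<le> mseq d k"
  by (induction k) (use p_pos p_less in \<open>auto intro: msg_ge_1 one_le_power\<close>)

text \<open>The branches are attached to the lone root one after the other by
  \<open>root_bound_join\<close>. A root with fewer than \<open>d\<close> neighbours is covered
  because messages are at least 1.\<close>

lemma star_bound_imp:
  assumes "graph_on V E" "w \<in> V" "card (star E w) \<le> d" "unique_paths E w (Suc k)"
    and branch: "\<And>x. {w, x} \<in> E \<Longrightarrow>
      branch_bound x (near (E - star E w) x k)
        (touching (E - star E w) (near (E - star E w) x k)) (mseq d k)"
  shows "root_bound w (near E w (Suc k)) (touching E (near E w (Suc k))) (mseq d k ^ d)"
proof -
  let ?E2 = "E - star E w" and ?N = "{x. {w, x} \<in> E}"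
  let ?I = "\<lambda>x. near ?E2 x k" and ?T = "\<lambda>x. touching ?E2 (near ?E2 x k)"
  note G = assms(1) and U = assms(4)
  have "?N \<subseteq> V" using graph_on_edge[OF G] by auto
  then have finN: "finite ?N" using finite_V finite_subset by auto
  have main: "root_bound w (insert w (\<Union>x\<in>F. ?I x)) (\<Union>x\<in>F. insert {w, x} (?T x)) (mseq d k ^ card F)"
    if "F \<subseteq> ?N" "finite F" for F
    using that(2,1)
  proof (induction F rule: finite_induct)
    case empty
    then show ?case using root_bound_single[OF assms(2)] by simp
  next
    case (insert x F)
    have x: "{w, x} \<in> E" using insert by auto
    have xw: "x \<noteq> w" using graph_on_edge[OF G x] by auto
    have F: "{w, x'} \<in> E" "x \<noteq> x'" if "x' \<in> F" for x' using insert that by auto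
    have "root_bound w (insert w (\<Union>x\<in>F. ?I x) \<union> ?I x)
       (insert {w, x} ((\<Union>x\<in>F. insert {w, x} (?T x)) \<union> ?T x)) (mseq d k ^ card F * mseq d k)"
    proof (rule root_bound_join[OF _ branch[OF x]])
      show "root_bound w (insert w (\<Union>x\<in>F. ?I x)) (\<Union>x\<in>F. insert {w, x} (?T x)) (mseq d k ^ card F)"
        using insert by auto
      show "0 \<le> mseq d k ^ card F" using mseq_ge_1[of d k] by simp
      show "insert w (\<Union>x\<in>F. ?I x) \<inter> ?I x = {}"
        using near_disjoint[OF G U x F] root_not_near[OF G U x] by fastforce
      show "x \<notin> insert w (\<Union>x\<in>F. ?I x)"
        using child_not_near[OF G U x F] xw by auto
      show "\<forall>e\<in>\<Union>x\<in>F. insert {w, x} (?T x). e \<inter> ?I x = {}"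
      proof
        fix e assume "e \<in> (\<Union>x\<in>F. insert {w, x} (?T x))"
        then obtain x' where x': "x' \<in> F" "e = {w, x'} \<or> e \<in> ?T x'" by auto
        then show "e \<inter> ?I x = {}"
          using near_separated[OF G U x F, of x' e] child_not_near[OF G U F(1) x F(2)[symmetric], of x']
            root_not_near[OF G U x] by (auto simp: touching_def)
      qed
      show "\<forall>e\<in>?T x. e \<inter> insert w (\<Union>x\<in>F. ?I x) = {}"
      proof
        fix e assume e: "e \<in> ?T x"
        then have "w \<notin> e" by (auto simp: touching_def star_def)
        moreover have "e \<inter> ?I x' = {}" if "x' \<in> F" for x'
          using near_separated[OF G U x F, of x' e] that e by (auto simp: touching_def)
        ultimately show "e \<inter> insert w (\<Union>x\<in>F. ?I x) = {}" by auto
      qed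
      have notT: "{w, x} \<notin> ?T x'" for x' by (auto simp: touching_def star_def)
      show "{w, x} \<notin> (\<Union>x\<in>F. insert {w, x} (?T x))"
        using notT F xw by (auto simp: doubleton_eq_iff)
      show "{w, x} \<notin> ?T x" by (rule notT)
    qed
    moreover have "insert w (\<Union>x\<in>F. ?I x) \<union> ?I x = insert w (\<Union>x\<in>insert x F. ?I x)" by auto
    moreover have "insert {w, x} ((\<Union>x\<in>F. insert {w, x} (?T x)) \<union> ?T x)
       = (\<Union>x\<in>insert x F. insert {w, x} (?T x))" by auto
    moreover have "mseq d k ^ card F * mseq d k = mseq d k ^ card (insert x F)"
      using insert by simp
    ultimately show ?case by metis
  qed
  have "card ?N \<le> card (star E w)"
  proof (rule card_inj_on_le[of "\<lambda>x. {w, x}"])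
    show "inj_on (\<lambda>x. {w, x}) ?N" by (auto simp: inj_on_def doubleton_eq_iff)
    show "finite (star E w)" using graph_on_finite[OF G] by (auto simp: star_def)
  qed (auto simp: star_def)
  then have "mseq d k ^ card ?N \<le> mseq d k ^ d"
    using assms(3) mseq_ge_1 by (intro power_increasing) auto
  then show ?thesis
    unfolding touching_Suc[OF G U] unfolding near_Suc[OF G U]
    by (rule root_bound_mono[OF main[OF order_refl finN]])
qed

text \<open>A child loses its edge to \<open>w\<close>, so maximal degree \<open>Suc d\<close>
  leaves at most \<open>d\<close> branches below it.\<close>

lemma child_conditions:
  assumes G: "graph_on V E" and deg: "\<forall>v. card (star E v) \<le> Suc d" and x: "{w, x} \<in> E"
  shows "graph_on V (E - star E w)" "x \<in> V" "card (star (E - star E w) x) \<le> d"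
    "\<forall>v. card (star (E - star E w) v) \<le> Suc d"
proof -
  let ?E2 = "E - star E w"
  have finE: "finite E" using graph_on_finite[OF G] .
  show "graph_on V ?E2" by (rule graph_on_subset[OF G]) auto
  show "x \<in> V" using graph_on_edge[OF G x] by auto
  have "star ?E2 x \<subseteq> star E x - {{w, x}}" by (auto simp: star_def)
  then have "card (star ?E2 x) \<le> card (star E x - {{w, x}})"
    using finE by (intro card_mono) (auto simp: star_def)
  also have "\<dots> = card (star E x) - 1"
    using x finE by (subst card_Diff_singleton) (auto simp: star_def)
  also have "\<dots> \<le> d" using deg by (simp add: le_diff_conv)
  finally show "card (star ?E2 x) \<le> d" .
  show "\<forall>v. card (star ?E2 v) \<le> Suc d"
  proof
    fix v
    have "card (star ?E2 v) \<le> card (star E v)"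
      using finE by (intro card_mono) (auto simp: star_def)
    then show "card (star ?E2 v) \<le> Suc d" using deg le_trans by blast
  qed
qed

lemma branch_bound_near:
  assumes "graph_on V E" "w \<in> V" "card (star E w) \<le> d" "\<forall>v. card (star E v) \<le> Suc d"
    "unique_paths E w k"
  shows "branch_bound w (near E w k) (touching E (near E w k)) (mseq d k)"
  using assms
proof (induction k arbitrary: E w)
  case 0
  then show ?case using branch_bound_leaf by (simp add: touching_def)
next
  case (Suc k)
  note G = Suc.prems(1) and deg = Suc.prems(4) and U = Suc.prems(5)
  have "branch_bound x (near (E - star E w) x k)
      (touching (E - star E w) (near (E - star E w) x k)) (mseq d k)"
    if x: "{w, x} \<in> E" for x
    using Suc.IH[OF child_conditions[OF G deg x] unique_paths_child[OF G U x]] .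
  then have "root_bound w (near E w (Suc k)) (touching E (near E w (Suc k))) (mseq d k ^ d)"
    by (intro star_bound_imp Suc.prems)
  then show ?case using root_imp_branch mseq_ge_1[of d k] by (simp add: one_le_power)
qed

text \<open>The last level stops before \<open>msg\<close> is applied, since the edge above the root
  is the one whose probability is to be estimated.\<close>

lemma root_bound_near:
  assumes "graph_on V E" "w \<in> V" "card (star E w) \<le> d" "\<forall>v. card (star E v) \<le> Suc d"
    "unique_paths E w (Suc k)"
  shows "root_bound w (near E w (Suc k)) (touching E (near E w (Suc k))) (mseq d k ^ d)"
  using branch_bound_near[OF child_conditions[OF assms(1,4)] unique_paths_child[OF assms(1,5)]]
  by (intro star_bound_imp assms(1-3,5))

end

section \<open>Long paths are rarely open\<close>

definition list_edges :: "'a list \<Rightarrow> 'a set set" where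
  "list_edges xs = {{xs ! j, xs ! Suc j} | j. Suc j < length xs}"

lemma successively_imp_edge:
  "successively (\<lambda>x y. {x, y} \<in> E) xs \<Longrightarrow> Suc j < length xs \<Longrightarrow> {xs ! j, xs ! Suc j} \<in> E"
  by (simp add: successively_conv_nth)

lemma list_edges_subset: "path_in E xs \<Longrightarrow> list_edges xs \<subseteq> E"
  by (auto simp: list_edges_def path_in_def successively_imp_edge)

lemma list_edges_image: "list_edges xs = (\<lambda>j. {xs ! j, xs ! Suc j}) ` {..<length xs - 1}"
  unfolding list_edges_def by (auto simp: less_diff_conv)

lemma list_edges_take_Suc:
  assumes "Suc k < length vs"
  shows "list_edges (take (Suc (Suc k)) vs) = insert {vs ! k, vs ! Suc k} (list_edges (take (Suc k) vs))"
proof -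
  have take: "list_edges (take (Suc k) vs) = (\<lambda>j. {vs ! j, vs ! Suc j}) ` {..<k}" if "k < length vs" for k
    using that unfolding list_edges_image by (intro image_cong) auto
  show ?thesis using take[of k] take[of "Suc k"] assms by (simp add: lessThan_Suc)
qed

lemma card_list_edges: "finite (list_edges xs)" "card (list_edges xs) \<le> length xs - 1"
  unfolding list_edges_image
  using card_image_le[of "{..<length xs - 1}" "\<lambda>j. {xs ! j, xs ! Suc j}"] by auto

text \<open>Walks that stop on meeting \<open>B\<close> or themselves; the last condition excludes a final step back.\<close>

definition lollipop :: "'a set set \<Rightarrow> 'a \<Rightarrow> 'a set \<Rightarrow> nat \<Rightarrow> 'a list \<Rightarrow> bool" where
  "lollipop E w B k zs \<longleftrightarrow> 2 \<le> length zs \<and> length zs \<le> k \<and> hd zs = w \<and>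
     successively (\<lambda>x y. {x, y} \<in> E) zs \<and> distinct (butlast zs) \<and>
     last zs \<in> B \<union> set (butlast zs) \<and>
     (3 \<le> length zs \<longrightarrow> last zs \<noteq> zs ! (length zs - 3))"

text \<open>Strip the common end of the two paths until the vertices before it differ. Then follow
  the first path to its end and return along the second until it first meets the first path. The
  turn is no step back because the two neighbours of the end differ.\<close>

lemma lollipop_of_two_paths:
  assumes "path_in E xs" "path_in E ys" "hd xs = w" "hd ys = w" "last xs = last ys" "xs \<noteq> ys"
  shows "\<exists>zs. lollipop E w B (length xs + length ys) zs"
  using assms
proof (induction xs arbitrary: ys rule: rev_induct)
  case Nil
  then show ?case by (simp add: path_in_def)
next
  case (snoc z xs)
  obtain ys' where ys: "ys = ys' @ [z]"
    using snoc.prems by (cases ys rule: rev_cases) (auto simp: path_in_def)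
  show ?case
  proof (cases "xs = [] \<or> ys' = []")
    case True
    then have "xs = [] \<and> ys' = []"
      using snoc.prems ys by (cases xs; cases ys') (auto simp: path_in_def)
    then show ?thesis using snoc.prems ys by auto
  next
    case False
    then have px: "path_in E xs" "{last xs, z} \<in> E" "z \<notin> set xs"
      and py: "path_in E ys'" "{last ys', z} \<in> E" "z \<notin> set ys'"
      using snoc.prems ys by (auto simp: path_in_snoc)
    have hd: "hd xs = w" "hd ys' = w" using False snoc.prems ys by auto
    show ?thesis
    proof (cases "last xs = last ys'")
      case True
      have "xs \<noteq> ys'" using snoc.prems ys by auto
      then obtain zs where "lollipop E w B (length xs + length ys') zs"
        using snoc.IH[of ys'] px py hd True by auto
      then show ?thesis using ys unfolding lollipop_def by (intro exI[of _ zs]) auto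
    next
      case ne: False
      let ?xs = "xs @ [z]"
      have "w \<in> set (rev ys')" "w \<in> set ?xs" using False hd hd_in_set by fastforce+
      then have "\<exists>c \<in> set (rev ys'). c \<in> set ?xs" by blast
      then obtain us c vs where us: "rev ys' = us @ c # vs" "c \<in> set ?xs" "\<forall>u\<in>set us. u \<notin> set ?xs"
        using split_list_first_prop[of "rev ys'" "\<lambda>c. c \<in> set ?xs"] by blast
      have ys': "ys' = rev vs @ c # rev us" using arg_cong[OF us(1), of rev] by simp
      have d: "distinct us" using py(1) ys' by (auto simp: path_in_def)
      have suc: "successively (\<lambda>x y. {x, y} \<in> E) (us @ [c])"
      proof -
        have "successively (\<lambda>x y. {x, y} \<in> E) (c # rev us)"
          using py(1) unfolding ys' path_in_def by (simp add: successively_append_iff)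
        then have "successively (\<lambda>x y. {y, x} \<in> E) (rev (c # rev us))"
          by (simp only: successively_rev)
        then show ?thesis by (simp add: insert_commute)
      qed
      have hdus: "hd (us @ [c]) = last ys'" using ys' by (cases us) auto
      have cz: "c \<noteq> z" using py(3) ys' by auto
      let ?zs = "?xs @ us @ [c]"
      have "lollipop E w B (length ?xs + length ys) ?zs"
        unfolding lollipop_def
      proof (intro conjI impI)
        show "2 \<le> length ?zs" by simp
        show "length ?zs \<le> length ?xs + length ys" using ys ys' by simp
        show "hd ?zs = w" using hd False by auto
        show "successively (\<lambda>x y. {x, y} \<in> E) ?zs"
        proof -
          have "successively (\<lambda>x y. {x, y} \<in> E) (z # us @ [c])"
            using suc hdus py(2) by (cases us) (auto simp: insert_commute)
          then show ?thesis using px False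
            by (simp add: successively_append_iff path_in_def)
        qed
        show "distinct (butlast ?zs)"
          using snoc.prems(1) d us(3) by (auto simp: butlast_append path_in_def)
        show "last ?zs \<in> B \<union> set (butlast ?zs)" using us(2) by (auto simp: butlast_append)
        show "last ?zs \<noteq> ?zs ! (length ?zs - 3)"
        proof (cases us rule: rev_cases)
          case Nil
          then have "c = last ys'" using ys' by simp
          moreover have "?zs ! (length ?zs - 3) = last xs"
            using False Nil by (simp add: nth_append last_conv_nth)
          ultimately show ?thesis using ne by simp
        next
          case (snoc us' u)
          have "?zs ! (length ?zs - 3) = (?xs @ us') ! (length (?xs @ us') - 1)"
          proof -
            have "?zs = (?xs @ us') @ [u, c]" "length ?zs - 3 = length (?xs @ us') - 1"
              using snoc by simp_all
            then show ?thesis by (simp only: nth_append) simp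
          qed
          also have "\<dots> = last (?xs @ us')" by (simp add: last_conv_nth)
          finally have "?zs ! (length ?zs - 3) \<in> insert z (set us')"
            by (cases us' rule: rev_cases) auto
          then show ?thesis using cz us(2,3) snoc by auto
        qed
      qed
      then show ?thesis by blast
    qed
  qed
qed

text \<open>Two different paths with a common end, of at most \<open>h\<close> and
  \<open>Suc h\<close> vertices, make a lollipop of at most \<open>2 * h + 1\<close>; a path from
  \<open>w\<close> into \<open>B\<close> is a lollipop as it stands.\<close>

lemma lollipop_or_good:
  assumes "\<nexists>zs. lollipop E w B (2 * h + 1) zs" "w \<notin> B"
  shows "unique_paths E w h" "near E w h \<inter> B = {}"
proof -
  show "unique_paths E w h"
    unfolding unique_paths_def
  proof (intro allI impI, elim conjE, rule ccontr)
    fix xs ys assume "path_in E xs" "hd xs = w" "length xs \<le> h" "path_in E ys" "hd ys = w"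
      "length ys \<le> Suc h" "last xs = last ys" "xs \<noteq> ys"
    then obtain zs where "lollipop E w B (length xs + length ys) zs"
      using lollipop_of_two_paths by metis
    then have "lollipop E w B (2 * h + 1) zs"
      using \<open>length xs \<le> h\<close> \<open>length ys \<le> Suc h\<close> unfolding lollipop_def by auto
    then show False using assms by auto
  qed
  show "near E w h \<inter> B = {}"
  proof (rule ccontr)
    assume "near E w h \<inter> B \<noteq> {}"
    then obtain xs where xs: "path_in E xs" "hd xs = w" "length xs \<le> h" "last xs \<in> B"
      by (auto simp: near_def)
    have "length xs \<noteq> 1" using xs assms(2) by (cases xs) (auto simp: path_in_def)
    moreover have "length xs \<noteq> 0" using xs by (auto simp: path_in_def)
    ultimately have l: "2 \<le> length xs" by linarith
    have d: "distinct xs" using xs by (auto simp: path_in_def)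
    have "lollipop E w B (2 * h + 1) xs"
      using xs l d unfolding lollipop_def
      by (auto simp: path_in_def distinct_butlast last_conv_nth nth_eq_iff_index_eq)
    then show False using assms by auto
  qed
qed

lemma lollipop_nth:
  assumes "lollipop E w B k zs"
  shows "a < length zs - 1 \<Longrightarrow> b < length zs - 1 \<Longrightarrow> a \<noteq> b \<Longrightarrow> zs ! a \<noteq> zs ! b"
    and "2 \<le> length zs - 1 \<Longrightarrow> zs ! (length zs - 1) \<noteq> zs ! (length zs - 1 - 2)"
    and "last zs = zs ! (length zs - 1)"
proof -
  have "zs \<noteq> []" using assms by (auto simp: lollipop_def)
  then show l: "last zs = zs ! (length zs - 1)" by (rule last_conv_nth)
  show "zs ! a \<noteq> zs ! b" if "a < length zs - 1" "b < length zs - 1" "a \<noteq> b"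
  proof -
    have "distinct (butlast zs)" using assms by (auto simp: lollipop_def)
    then have "butlast zs ! a \<noteq> butlast zs ! b" using that by (subst nth_eq_iff_index_eq) auto
    then show ?thesis using that by (simp add: nth_butlast)
  qed
  show "zs ! (length zs - 1) \<noteq> zs ! (length zs - 1 - 2)" if "2 \<le> length zs - 1"
  proof -
    have "last zs \<noteq> zs ! (length zs - 3)" using assms that by (auto simp: lollipop_def)
    moreover have "length zs - 3 = length zs - 1 - 2" by simp
    ultimately show ?thesis using l by metis
  qed
qed

text \<open>All vertices but the last are distinct, so an edge could recur only by a final step
  back.\<close>

lemma lollipop_edges_inj:
  assumes "lollipop E w B k zs"
  shows "inj_on (\<lambda>j. {zs ! j, zs ! Suc j}) {..<length zs - 1}"
proof -
  let ?k = "length zs - 1"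
  note d = lollipop_nth(1)[OF assms] and lastne = lollipop_nth(2)[OF assms]
  have "False" if ab: "a < b" "b < ?k" and eq: "{zs ! a, zs ! Suc a} = {zs ! b, zs ! Suc b}" for a b
  proof -
    have "zs ! b \<noteq> zs ! a" using d[of b a] ab by auto
    then have 1: "zs ! b = zs ! Suc a" "zs ! a = zs ! Suc b" using eq by (auto simp: doubleton_eq_iff)
    then have "b = Suc a" using d[of b "Suc a"] ab by fastforce
    show False
    proof (cases "Suc b = ?k")
      case True
      then have "?k - 2 = a" "2 \<le> ?k" using \<open>b = Suc a\<close> by auto
      then show False using lastne 1 True by metis
    next
      case False
      then show False using d[of a "Suc b"] 1 ab by auto
    qed
  qed
  then show ?thesis unfolding inj_on_def by (metis lessThan_iff linorder_neqE_nat)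
qed

text \<open>A new vertex brings its incoming edge; the outgoing edge of the last new vertex is extra.\<close>

lemma lollipop_excess:
  assumes Z: "lollipop E w B k zs" and F: "\<Union>F \<subseteq> W" "B \<subseteq> W" "w \<in> W" and new: "\<not> list_edges zs \<subseteq> F"
  shows "card (set zs - W) + 1 \<le> card (list_edges zs - F)"
proof -
  let ?k = "length zs - 1" and ?e = "\<lambda>j. {zs ! j, zs ! Suc j}"
  have k: "length zs = Suc ?k" "1 \<le> ?k" using Z by (auto simp: lollipop_def)
  define J where "J = {j. 1 \<le> j \<and> j < ?k \<and> zs ! j \<notin> W}"
  have finJ: "finite J" by (rule finite_subset[of _ "{..<?k}"]) (auto simp: J_def)
  have edges: "list_edges zs = ?e ` {..<?k}"
    by (rule list_edges_image)
  have "set zs - W \<subseteq> (\<lambda>j. zs ! j) ` J"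
  proof
    fix z assume z: "z \<in> set zs - W"
    have "zs \<noteq> []" using k by auto
    then have "z \<in> set (butlast zs)"
    proof -
      have "zs = butlast zs @ [last zs]" using \<open>zs \<noteq> []\<close> by simp
      then have "z \<in> set (butlast zs) \<union> {last zs}" using z by (metis DiffD1 set_append list.set(1) list.set(2))
      then show ?thesis using Z F(2) z by (auto simp: lollipop_def)
    qed
    then obtain j where j: "j < ?k" "z = zs ! j" by (metis in_set_conv_nth length_butlast nth_butlast)
    have "zs ! 0 = w" using Z \<open>zs \<noteq> []\<close> by (auto simp: lollipop_def hd_conv_nth)
    then have "j \<noteq> 0" using z j F(3) by (metis DiffD2)
    then show "z \<in> (\<lambda>j. zs ! j) ` J" using j z by (auto simp: J_def)
  qed
  then have cJ: "card (set zs - W) \<le> card J" using finJ by (meson card_image_le card_mono finite_imageI le_trans)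
  have notF: "e \<notin> F" if "z \<in> e" "z \<notin> W" for e z using that F(1) by auto
  show ?thesis
  proof (cases "J = {}")
    case True
    have "list_edges zs - F \<noteq> {}" using new by auto
    then have "1 \<le> card (list_edges zs - F)"
      using card_list_edges(1)[of zs] by (metis card_0_eq finite_Diff less_one linorder_not_less)
    moreover have "card J = 0" using True by simp
    ultimately show ?thesis using cJ by linarith
  next
    case False
    define M where "M = Max J"
    have M: "M \<in> J" "\<And>j. j \<in> J \<Longrightarrow> j \<le> M" using False finJ by (auto simp: M_def)
    \<comment> \<open>Index \<open>j - 1\<close> stands for the edge into the new vertex at
      \<open>j\<close>, and \<open>M\<close> for the edge out of the last new vertex.\<close>
    let ?I = "insert M ((\<lambda>j. j - 1) ` J)"
    have "inj_on (\<lambda>j. j - 1) J" by (auto simp: inj_on_def J_def)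
    then have "card ((\<lambda>j. j - 1) ` J) = card J" by (rule card_image)
    moreover have "M \<notin> (\<lambda>j. j - 1) ` J"
    proof
      assume "M \<in> (\<lambda>j. j - 1) ` J"
      then obtain j where "j \<in> J" "M = j - 1" by auto
      then show False using M(2)[of j] by (auto simp: J_def)
    qed
    ultimately have cI: "card ?I = card J + 1" using finJ by simp
    have IK: "?I \<subseteq> {..<?k}" using M by (auto simp: J_def)
    have "?e ` ?I \<subseteq> list_edges zs - F"
    proof
      fix e assume "e \<in> ?e ` ?I"
      then consider "e = ?e M" | j where "j \<in> J" "e = ?e (j - 1)" by auto
      then have "\<exists>z. z \<in> e \<and> z \<notin> W"
      proof cases
        case 1 then show ?thesis using M by (auto simp: J_def)
      next
        case 2 then show ?thesis by (auto simp: J_def)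
      qed
      then have "e \<notin> F" using notF by blast
      moreover have "e \<in> list_edges zs"
        unfolding edges using \<open>e \<in> ?e ` ?I\<close> image_mono[OF IK] by (rule rev_subsetD)
      ultimately show "e \<in> list_edges zs - F" by simp
    qed
    then have "card (?e ` ?I) \<le> card (list_edges zs - F)"
      using card_list_edges(1)[of zs] by (intro card_mono) auto
    moreover have "card (?e ` ?I) = card ?I"
      using inj_on_subset[OF lollipop_edges_inj[OF Z] IK] by (rule card_image)
    ultimately show ?thesis using cI cJ by simp
  qed
qed

text \<open>The edge at position \<open>i\<close> is deleted, and the path up to
  \<open>vs ! i\<close> is what must be avoided. Without a lollipop, \<open>lollipop_or_good\<close>
  yields a tree neighbourhood disjoint from the revealed part.\<close>

definition bad_pos :: "'a set set \<Rightarrow> nat \<Rightarrow> 'a list \<Rightarrow> nat \<Rightarrow> bool" where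
  "bad_pos E h vs i \<longleftrightarrow> Suc i < length vs \<and>
     (\<exists>zs. lollipop (E - {{vs ! i, vs ! Suc i}}) (vs ! Suc i) (set (take (Suc i) vs)) (2 * h + 1) zs)"

text \<open>As long as it stays on the path, the lollipop runs forward: the edge behind its start is
  deleted and it never turns round. Running forward it meets no earlier vertex. So it leaves the
  path less than \<open>k\<close> steps after its start, at a vertex touched by
  \<open>X\<close>.\<close>

lemma lollipop_leaves_path:
  assumes d: "distinct vs" and i: "Suc i < length vs"
    and Z: "lollipop (E - {{vs ! i, vs ! Suc i}}) (vs ! Suc i) (set (take (Suc i) vs)) k zs"
    and sub: "list_edges zs \<subseteq> list_edges vs \<union> X"
  shows "\<exists>f\<in>X. \<exists>t<k. Suc (i + t) < length vs \<and> vs ! Suc (i + t) \<in> f"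
proof -
  let ?k = "length zs - 1" and ?e = "\<lambda>j. {zs ! j, zs ! Suc j}"
  have k: "length zs = Suc ?k" "1 \<le> ?k" using Z by (auto simp: lollipop_def)
  have "zs \<noteq> []" using k by auto
  note dz = lollipop_nth(1)[OF Z] and lastne = lollipop_nth(2)[OF Z] and lastz = lollipop_nth(3)[OF Z]
  have follow: "Suc (i + j) < length vs \<and> zs ! j = vs ! Suc (i + j)"
    if "j \<le> ?k" "\<forall>j'<j. ?e j' \<in> list_edges vs" for j
    using that
  proof (induction j rule: less_induct)
    case (less j)
    show ?case
    proof (cases j)
      case 0
      have "zs ! 0 = vs ! Suc i" using Z \<open>zs \<noteq> []\<close> by (auto simp: lollipop_def hd_conv_nth)
      then show ?thesis using i 0 by auto
    next
      case (Suc l)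
      then have IH: "Suc (i + l) < length vs" "zs ! l = vs ! Suc (i + l)"
        using less.IH[of l] less.prems by auto
      have "?e l \<in> list_edges vs" using less.prems Suc by auto
      then obtain a where a: "Suc a < length vs" "?e l = {vs ! a, vs ! Suc a}"
        by (auto simp: list_edges_def)
      have "?e l \<in> E - {{vs ! i, vs ! Suc i}}"
        using Z less.prems Suc k unfolding lollipop_def
        by (intro successively_imp_edge[of _ zs l]) auto
      then have nee: "?e l \<noteq> {vs ! i, vs ! Suc i}" by auto
      from a(2) consider "zs ! l = vs ! a" "zs ! Suc l = vs ! Suc a"
        | "zs ! l = vs ! Suc a" "zs ! Suc l = vs ! a" by (auto simp: doubleton_eq_iff)
      then show ?thesis
      proof cases
        case 1
        then have "a = Suc (i + l)" using IH a(1) d by (metis Suc_lessD nth_eq_iff_index_eq)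
        then show ?thesis using 1 a Suc by simp
      next
        case 2
        then have "Suc a = Suc (i + l)" using IH a(1) d by (metis nth_eq_iff_index_eq)
        then have ail: "a = i + l" by simp
        have False
        proof (cases l)
          case 0
          then show ?thesis using nee a(2) ail by simp
        next
          case (Suc l')
          then have "zs ! l' = vs ! Suc (i + l')" using less.IH[of l'] less.prems \<open>j = Suc l\<close> by auto
          then have eq: "zs ! l' = zs ! Suc l" using 2 ail Suc by simp
          show False
          proof (cases "Suc l = ?k")
            case True
            then have "?k - 2 = l'" "2 \<le> ?k" using Suc by auto
            then show False using lastne eq True by metis
          next
            case False
            then show False using dz[of l' "Suc l"] eq Suc \<open>j = Suc l\<close> less.prems(1) by auto
          qed
        qed
        then show ?thesis ..
      qed
    qed
  qed
  show ?thesis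
  proof (cases "\<forall>j<?k. ?e j \<in> list_edges vs")
    case True
    then have l: "Suc (i + ?k) < length vs" "last zs = vs ! Suc (i + ?k)"
      using follow[of ?k] lastz by auto
    have "last zs \<in> set (take (Suc i) vs) \<union> set (butlast zs)" using Z by (auto simp: lollipop_def)
    then have "\<exists>a < Suc (i + ?k). last zs = vs ! a"
    proof
      assume "last zs \<in> set (take (Suc i) vs)"
      then obtain a where "a < Suc i" "last zs = vs ! a" by (auto simp: in_set_conv_nth)
      then show ?thesis by (intro exI[of _ a]) auto
    next
      assume "last zs \<in> set (butlast zs)"
      then obtain b where b: "b < ?k" "last zs = zs ! b"
        by (metis in_set_conv_nth length_butlast nth_butlast)
      then have "zs ! b = vs ! Suc (i + b)" using follow[of b] True by auto
      then show ?thesis using b by (intro exI[of _ "Suc (i + b)"]) auto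
    qed
    then show ?thesis using l d by (metis less_irrefl nth_eq_iff_index_eq order.strict_trans)
  next
    case False
    define j where "j = (LEAST j. j < ?k \<and> ?e j \<notin> list_edges vs)"
    have j: "j < ?k \<and> ?e j \<notin> list_edges vs" unfolding j_def by (rule LeastI_ex) (use False in auto)
    have "\<forall>j'<j. ?e j' \<in> list_edges vs"
      using not_less_Least[of _ "\<lambda>j. j < ?k \<and> ?e j \<notin> list_edges vs"] j unfolding j_def
      by (meson order.strict_trans)
    then have f: "Suc (i + j) < length vs" "zs ! j = vs ! Suc (i + j)" using follow[of j] j by auto
    have "?e j \<in> list_edges zs" unfolding list_edges_def using j k by auto
    then have "?e j \<in> X" using sub j by auto
    moreover have "j < k" using j Z by (auto simp: lollipop_def)
    ultimately show ?thesis using f by (intro bexI[of _ "?e j"] exI[of _ j]) auto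
  qed
qed

text \<open>If every part of \<open>X\<close> is attached to the path,
  \<open>card X - card (\<Union>X - set vs)\<close> is the number of independent cycles that
  \<open>X\<close> adds to it; this surplus has to stay below \<open>m\<close>.\<close>

definition sparse_along :: "'a set set \<Rightarrow> 'a list \<Rightarrow> nat \<Rightarrow> nat \<Rightarrow> bool" where
  "sparse_along E vs D m \<longleftrightarrow>
     (\<forall>X. X \<subseteq> E - list_edges vs \<and> card X \<le> D \<longrightarrow> card X < card (\<Union>X - set vs) + m)"

lemma list_edges_vertices: "\<Union>(list_edges vs) \<subseteq> set vs"
  by (auto simp: list_edges_def)

text \<open>Greedy construction: among more than \<open>?M\<close> bad positions there is one not
  explained by the edges \<open>X\<close> found so far. Its lollipop adds at most
  \<open>2 * h\<close> edges and raises the surplus by at least one. After \<open>m\<close> rounds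
  sparsity is violated.\<close>

lemma card_bad_positions:
  assumes G: "graph_on V E" and vs: "path_in E vs" and sp: "sparse_along E vs (m * (2 * h)) m"
  shows "card {i. bad_pos E h vs i} \<le> m * (2 * h) * 2 * (2 * h + 1)"
proof (rule ccontr)
  let ?M = "m * (2 * h) * 2 * (2 * h + 1)"
  let ?Bad = "{i. bad_pos E h vs i}" and ?P = "list_edges vs"
  assume "\<not> card ?Bad \<le> ?M"
  then have many: "?M < card ?Bad" by simp
  have finE: "finite E" using graph_on_finite[OF G] .
  have d: "distinct vs" using vs by (auto simp: path_in_def)
  have "\<exists>X. X \<subseteq> E - ?P \<and> card X \<le> j * (2 * h) \<and> card (\<Union>X - set vs) + j \<le> card X" if "j \<le> m" for j
    using that
  proof (induction j)
    case 0
    then show ?case by (intro exI[of _ "{}"]) auto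
  next
    case (Suc j)
    then obtain X where X: "X \<subseteq> E - ?P" "card X \<le> j * (2 * h)" "card (\<Union>X - set vs) + j \<le> card X"
      by auto
    have finX: "finite X" using X finE finite_subset by blast
    have finUX: "finite (\<Union>X)"
      using G X(1) unfolding graph_on_def by (meson DiffD1 Union_least finite_subset subsetD)
    have "card (\<Union>X) \<le> (\<Sum>e\<in>X. card e)" by (rule card_Union_le_sum_card)
    also have "\<dots> = (\<Sum>e\<in>X. 2)" using G X by (intro sum.cong) (auto simp: graph_on_def)
    finally have cUX: "card (\<Union>X) \<le> 2 * card X" by simp
    let ?Q = "{a. a < length vs \<and> vs ! a \<in> \<Union>X}"
    \<comment> \<open>Positions whose lollipop may consist of known edges. Each path vertex touched
      by \<open>X\<close> accounts for at most \<open>2 * h + 1\<close> of them, and there are at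
      most \<open>2 * card X\<close> such vertices; these are the factors of
      \<open>?M\<close>.\<close>
    let ?Bl = "{i. \<exists>f\<in>X. \<exists>t<2 * h + 1. Suc (i + t) < length vs \<and> vs ! Suc (i + t) \<in> f}"
    have "card ?Q \<le> card (\<Union>X)"
      using d finUX by (intro card_inj_on_le[of "\<lambda>a. vs ! a"]) (auto simp: inj_on_def nth_eq_iff_index_eq)
    then have cQ: "card ?Q \<le> j * (2 * h) * 2" using cUX X(2) by linarith
    have sub: "?Bl \<subseteq> (\<lambda>(a, t). a - 1 - t) ` (?Q \<times> {..<2 * h + 1})"
    proof
      fix i assume "i \<in> ?Bl"
      then obtain f t where "f \<in> X" "t < 2 * h + 1" "Suc (i + t) < length vs" "vs ! Suc (i + t) \<in> f"
        by auto
      then show "i \<in> (\<lambda>(a, t). a - 1 - t) ` (?Q \<times> {..<2 * h + 1})"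
        by (intro image_eqI[of _ _ "(Suc (i + t), t)"]) auto
    qed
    have finQ: "finite (?Q \<times> {..<2 * h + 1})" by simp
    have finBl: "finite ?Bl" by (rule finite_subset[OF sub finite_imageI[OF finQ]])
    have "card ?Bl \<le> card (?Q \<times> {..<2 * h + 1})"
      by (rule order_trans[OF card_mono[OF finite_imageI[OF finQ] sub] card_image_le[OF finQ]])
    then have "card ?Bl \<le> card ?Q * (2 * h + 1)" by (simp add: card_cartesian_product)
    also have "\<dots> \<le> j * (2 * h) * 2 * (2 * h + 1)" using cQ by (rule mult_right_mono) simp
    also have "\<dots> \<le> ?M" using Suc.prems by (intro mult_right_mono) auto
    finally have "card ?Bl < card ?Bad" using many by simp
    then have "\<not> ?Bad \<subseteq> ?Bl" using card_mono[OF finBl, of ?Bad] by linarith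
    then obtain i where "i \<in> ?Bad" and iBl: "i \<notin> ?Bl" by blast
    then have i: "bad_pos E h vs i" "i \<notin> ?Bl" by simp_all
    then obtain zs where il: "Suc i < length vs" and
      Z: "lollipop (E - {{vs ! i, vs ! Suc i}}) (vs ! Suc i) (set (take (Suc i) vs)) (2 * h + 1) zs"
      by (auto simp: bad_pos_def)
    let ?F = "?P \<union> X" and ?W = "set vs \<union> \<Union>X" and ?N = "list_edges zs - (?P \<union> X)"
    have new: "\<not> list_edges zs \<subseteq> ?F"
    proof
      assume "list_edges zs \<subseteq> ?F"
      then show False using lollipop_leaves_path[OF d il Z] i(2) by auto
    qed
    have "card (set zs - ?W) + 1 \<le> card ?N"
    proof (rule lollipop_excess[OF Z _ _ _ new])
      show "\<Union>?F \<subseteq> ?W" using list_edges_vertices by fastforce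
      show "set (take (Suc i) vs) \<subseteq> ?W" by (meson le_supI1 set_take_subset)
      show "vs ! Suc i \<in> ?W" using il by auto
    qed
    moreover have "card ?N \<le> 2 * h"
    proof -
      have "card ?N \<le> card (list_edges zs)" using card_list_edges(1) by (intro card_mono) auto
      also have "\<dots> \<le> length zs - 1" by (rule card_list_edges(2))
      finally show ?thesis using Z by (auto simp: lollipop_def)
    qed
    moreover have "card (X \<union> ?N) = card X + card ?N"
      using finX card_list_edges(1) by (intro card_Un_disjoint) auto
    moreover have "list_edges zs \<subseteq> E"
    proof
      fix f assume "f \<in> list_edges zs"
      then obtain j where j: "Suc j < length zs" "f = {zs ! j, zs ! Suc j}"
        by (auto simp: list_edges_def)
      have "successively (\<lambda>x y. {x, y} \<in> E - {{vs ! i, vs ! Suc i}}) zs"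
        using Z unfolding lollipop_def by blast
      from successively_imp_edge[OF this j(1)] show "f \<in> E" using j(2) by simp
    qed
    moreover have "card (\<Union>(X \<union> ?N) - set vs) \<le> card (\<Union>X - set vs) + card (set zs - ?W)"
    proof -
      have "\<Union>(X \<union> ?N) - set vs \<subseteq> (\<Union>X - set vs) \<union> (set zs - ?W)"
        using list_edges_vertices[of zs] by fastforce
      then have "card (\<Union>(X \<union> ?N) - set vs) \<le> card ((\<Union>X - set vs) \<union> (set zs - ?W))"
        using finUX by (intro card_mono) auto
      also have "\<dots> \<le> card (\<Union>X - set vs) + card (set zs - ?W)" by (rule card_Un_le)
      finally show ?thesis .
    qed
    ultimately show ?case using X by (intro exI[of _ "X \<union> ?N"]) auto
  qed
  from this[of m] obtain X where "X \<subseteq> E - ?P" "card X \<le> m * (2 * h)" "card (\<Union>X - set vs) + m \<le> card X"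
    by auto
  then show False using sp unfolding sparse_along_def by (metis linorder_not_less)
qed

section \<open>Revealing a path edge by edge\<close>

context rc_params
begin

lemma open_weight_mono:
  assumes "finite E" "A \<subseteq> B"
  shows "open_weight E B \<le> open_weight E A"
  unfolding open_weight_def
proof (rule sum_mono2)
  show "finite {S. A \<subseteq> S \<and> S \<subseteq> E}" using assms by simp
  show "0 \<le> rc_weight V E p q S" for S using p_pos p_less q_ge by (simp add: rc_weight_def)
qed (use assms in auto)

lemma open_weight_nonneg: "0 \<le> open_weight E A"
  unfolding open_weight_def using p_pos p_less q_ge by (intro sum_nonneg) (simp add: rc_weight_def)

text \<open>Once the edge is deleted, \<open>?w\<close> has degree at most \<open>d\<close>; its
  neighbourhood \<open>?I\<close> avoids the revealed vertices, so \<open>open_weight_step\<close>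
  applies to the tree of the edges touching \<open>?I\<close>.\<close>

lemma open_weight_good_edge:
  assumes G: "graph_on V E" and deg: "\<forall>v. card (star E v) \<le> Suc d" and vs: "path_in E vs"
    and i: "Suc i < length vs" and good: "\<not> bad_pos E (Suc h) vs i"
  shows "open_weight E (insert {vs ! i, vs ! Suc i} (list_edges (take (Suc i) vs)))
    \<le> p / (p + (1 - p) * q) * mseq d h ^ d * open_weight E (list_edges (take (Suc i) vs))"
proof -
  let ?u = "vs ! i" and ?w = "vs ! Suc i" and ?A = "list_edges (take (Suc i) vs)"
    and ?B = "set (take (Suc i) vs)"
  let ?e = "{?u, ?w}" let ?E' = "E - {?e}" let ?I = "near ?E' ?w (Suc h)"
  have d: "distinct vs" and e: "?e \<in> E"
    using vs i by (auto simp: path_in_def successively_imp_edge)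
  have finE: "finite E" using graph_on_finite[OF G] .
  have G': "graph_on V ?E'" using graph_on_subset[OF G] by auto
  have V: "?u \<in> V" "?w \<in> V" "?u \<noteq> ?w" using graph_on_edge[OF G e] by auto
  have wB: "?w \<notin> ?B" using d i by (auto simp: in_set_conv_nth nth_eq_iff_index_eq)
  have uB: "?u \<in> ?B" using i by (auto simp: in_set_conv_nth intro!: exI[of _ i])
  have ok: "unique_paths ?E' ?w (Suc h)" "?I \<inter> ?B = {}"
    using lollipop_or_good[of ?E' ?w ?B "Suc h"] good i wB unfolding bad_pos_def by auto
  have AB: "\<Union>?A \<subseteq> ?B" by (rule list_edges_vertices)
  have AE: "?A \<subseteq> E"
  proof -
    have "list_edges (take (Suc i) vs) \<subseteq> list_edges vs" by (fastforce simp: list_edges_def)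
    then show ?thesis using list_edges_subset[OF vs] by auto
  qed
  have st: "star ?E' v \<subseteq> star E v" for v by (auto simp: star_def)
  have finst: "finite (star E v)" for v using finE by (auto simp: star_def)
  have "star ?E' ?w = star E ?w - {?e}" by (auto simp: star_def)
  then have "card (star ?E' ?w) = card (star E ?w) - 1"
    using e finst by (simp add: card_Diff_singleton star_def)
  then have deg_w: "card (star ?E' ?w) \<le> d" using deg by (simp add: le_diff_conv)
  have deg': "\<forall>v. card (star ?E' v) \<le> Suc d"
    using deg card_mono[OF finst st] le_trans by blast
  have root: "root_bound ?w ?I (touching ?E' ?I) (mseq d h ^ d)"
    by (rule root_bound_near[OF G' V(2) deg_w deg' ok(1)])
  show ?thesis
  proof (rule open_weight_step[OF finE AE _ V(1) root])
    show "?e \<in> E - ?A" using e wB AB by auto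
    show "touching ?E' ?I \<subseteq> E - ?A - {?e}" using ok(2) AB by (fastforce simp: touching_def)
    show "?u \<notin> ?I" using uB ok by auto
    show "\<forall>e\<in>E - {?e}. e \<inter> ?I \<noteq> {} \<longrightarrow> e \<in> touching ?E' ?I" by (auto simp: touching_def)
  qed
qed

lemma open_weight_path:
  assumes G: "graph_on V E" and deg: "\<forall>v. card (star E v) \<le> Suc d" and vs: "path_in E vs"
    and \<kappa>: "\<kappa> = p / (p + (1 - p) * q) * mseq d h ^ d"
    and n: "n < length vs"
  shows "open_weight E (list_edges (take (Suc n) vs)) \<le>
     (\<Prod>i<n. if bad_pos E (Suc h) vs i then 1 else \<kappa>) * open_weight E {}"
  using n
proof (induction n)
  case 0
  have "list_edges (take (Suc 0) vs) = {}" by (auto simp: list_edges_def)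
  then show ?case by simp
next
  case (Suc n)
  let ?A = "list_edges (take (Suc n) vs)" and ?e = "{vs ! n, vs ! Suc n}"
  note ins = list_edges_take_Suc[OF Suc.prems]
  have \<kappa>0: "0 \<le> \<kappa>" unfolding \<kappa> using p_pos p_less q_ge mseq_ge_1[of d h] by simp
  have "open_weight E (insert ?e ?A) \<le> (if bad_pos E (Suc h) vs n then 1 else \<kappa>) * open_weight E ?A"
  proof (cases "bad_pos E (Suc h) vs n")
    case True
    then show ?thesis using open_weight_mono[OF graph_on_finite[OF G], of ?A "insert ?e ?A"] by auto
  next
    case False
    then show ?thesis using open_weight_good_edge[OF G deg vs Suc.prems False] unfolding \<kappa> by simp
  qed
  also have "\<dots> \<le> (if bad_pos E (Suc h) vs n then 1 else \<kappa>) *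
     ((\<Prod>i<n. if bad_pos E (Suc h) vs i then 1 else \<kappa>) * open_weight E {})"
    using Suc \<kappa>0 by (intro mult_left_mono) auto
  finally show ?case unfolding ins by (simp add: mult_ac)
qed

text \<open>Bad positions contribute 1 in place of \<open>\<kappa>\<close>. Their number is bounded
  independently of the length of the path, so restoring the full power costs a constant.\<close>

lemma open_weight_path_bound:
  assumes G: "graph_on V E" and deg: "\<forall>v. card (star E v) \<le> Suc d" and vs: "path_in E vs"
    and \<kappa>: "\<kappa> = p / (p + (1 - p) * q) * mseq d h ^ d" "\<kappa> \<le> 1"
    and sp: "sparse_along E vs (m * (2 * Suc h)) m"
  shows "open_weight E (list_edges vs) \<le>
     \<kappa> ^ (length vs - 1) / \<kappa> ^ (m * (2 * Suc h) * 2 * (2 * Suc h + 1)) * open_weight E {}"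
proof -
  let ?M = "m * (2 * Suc h) * 2 * (2 * Suc h + 1)" and ?l = "length vs - 1"
  let ?b = "\<lambda>i. bad_pos E (Suc h) vs i"
  have ne: "vs \<noteq> []" using vs by (auto simp: path_in_def)
  have \<kappa>0: "0 < \<kappa>" unfolding \<kappa> using p_pos p_less q_ge mseq_ge_1[of d h]
    by (intro mult_pos_pos divide_pos_pos add_pos_nonneg zero_less_power) auto
  have "open_weight E (list_edges (take (Suc ?l) vs)) \<le> (\<Prod>i<?l. if ?b i then 1 else \<kappa>) * open_weight E {}"
    using ne by (intro open_weight_path[OF G deg vs \<kappa>(1)]) auto
  moreover have "take (Suc ?l) vs = vs" using ne by simp
  ultimately have "open_weight E (list_edges vs) \<le> (\<Prod>i<?l. if ?b i then 1 else \<kappa>) * open_weight E {}"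
    by simp
  also have "\<dots> \<le> \<kappa> ^ ?l / \<kappa> ^ ?M * open_weight E {}"
  proof (rule mult_right_mono[OF _ open_weight_nonneg])
    have "(\<Prod>i<?l. if ?b i then 1 else \<kappa>) * \<kappa> ^ card {i. i < ?l \<and> ?b i} = \<kappa> ^ ?l"
    proof -
      have "\<kappa> ^ card {i. i < ?l \<and> ?b i} = (\<Prod>i<?l. if ?b i then \<kappa> else 1)"
        by (simp add: prod.If_cases Int_def conj_commute lessThan_def)
      then have "(\<Prod>i<?l. if ?b i then 1 else \<kappa>) * \<kappa> ^ card {i. i < ?l \<and> ?b i} =
          (\<Prod>i<?l. (if ?b i then 1 else \<kappa>) * (if ?b i then \<kappa> else 1))"
        by (simp only: prod.distrib)
      also have "\<dots> = (\<Prod>i<?l. \<kappa>)" by (rule prod.cong) auto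
      finally show ?thesis by simp
    qed
    moreover have "card {i. i < ?l \<and> ?b i} \<le> ?M"
    proof -
      have "{i. i < ?l \<and> ?b i} = {i. ?b i}" by (auto simp: bad_pos_def)
      then show ?thesis using card_bad_positions[OF G vs sp] by simp
    qed
    then have "\<kappa> ^ ?M \<le> \<kappa> ^ card {i. i < ?l \<and> ?b i}"
      using \<kappa>0 \<kappa>(2) by (intro power_decreasing) auto
    then have "(\<Prod>i<?l. if ?b i then 1 else \<kappa>) * \<kappa> ^ ?M
        \<le> (\<Prod>i<?l. if ?b i then 1 else \<kappa>) * \<kappa> ^ card {i. i < ?l \<and> ?b i}"
      using \<kappa>0 by (intro mult_left_mono prod_nonneg) auto
    ultimately have "(\<Prod>i<?l. if ?b i then 1 else \<kappa>) * \<kappa> ^ ?M \<le> \<kappa> ^ ?l" by linarith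
    then show "(\<Prod>i<?l. if ?b i then 1 else \<kappa>) \<le> \<kappa> ^ ?l / \<kappa> ^ ?M"
      using \<kappa>0 by (simp add: pos_le_divide_eq)
  qed
  finally show ?thesis .
qed

end

section \<open>The sampler is exact on configurations without long cycles\<close>

lemma cycle_edges_eq:
  assumes "vs \<noteq> []"
  shows "cycle_edges vs = insert {last vs, hd vs} (list_edges vs)"
proof -
  let ?n = "length vs"
  have n: "0 < ?n" using assms by simp
  have "cycle_edges vs = (\<lambda>i. {vs ! i, vs ! (Suc i mod ?n)}) ` {..<?n}"
    by (auto simp: cycle_edges_def)
  also have "{..<?n} = insert (?n - 1) {..<?n - 1}" using n by auto
  also have "(\<lambda>i. {vs ! i, vs ! (Suc i mod ?n)}) ` insert (?n - 1) {..<?n - 1} =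
     insert {last vs, hd vs} ((\<lambda>i. {vs ! i, vs ! Suc i}) ` {..<?n - 1})"
  proof -
    have "(\<lambda>i. {vs ! i, vs ! (Suc i mod ?n)}) ` {..<?n - 1} = (\<lambda>i. {vs ! i, vs ! Suc i}) ` {..<?n - 1}"
      by (intro image_cong) auto
    then show ?thesis using n assms by (simp add: last_conv_nth hd_conv_nth)
  qed
  finally show ?thesis unfolding list_edges_image .
qed

lemma path_in_iff_list_edges: "path_in E vs \<longleftrightarrow> vs \<noteq> [] \<and> distinct vs \<and> list_edges vs \<subseteq> E"
  by (auto simp: path_in_def list_edges_def successively_conv_nth)

lemma is_cycle_iff: "is_cycle E vs \<longleftrightarrow> 3 \<le> length vs \<and> path_in E vs \<and> {last vs, hd vs} \<in> E"
proof (cases "vs = []")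
  case False
  then show ?thesis by (auto simp: is_cycle_def path_in_iff_list_edges cycle_edges_eq)
qed (simp add: is_cycle_def)

lemma path_in_vertices:
  assumes "graph_on V E" "path_in E vs" "2 \<le> length vs"
  shows "set vs \<subseteq> V"
proof
  fix v assume v: "v \<in> set vs"
  have "{vs ! 0, vs ! 1} \<in> E" using assms by (auto simp: path_in_def successively_imp_edge)
  then have "hd vs \<in> V" using assms by (cases vs) (auto simp: graph_on_def)
  then show "v \<in> V"
    using path_vertex_touched[OF assms(2) v] assms(1) by (cases "v = hd vs") (auto simp: graph_on_def)
qed

lemma ncomp_union_le:
  assumes V: "finite V" and "finite F" and "\<forall>e\<in>F. e \<subseteq> V \<and> card e = 2"
  shows "ncomp V S \<le> ncomp V (S \<union> F) + card F"
  using assms(2,3)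
proof (induction F rule: finite_induct)
  case (insert f F)
  then obtain a b where f: "f = {a, b}" "a \<in> V" "b \<in> V" by (auto simp: card_2_iff)
  have "ncomp V (S \<union> F) \<le> Suc (ncomp V (S \<union> insert f F))"
    using ncomp_insert_le(2)[OF V f(2,3), of "S \<union> F"] f by simp
  then show ?case using insert by auto
qed simp

text \<open>Add the edges of \<open>F\<close> one at a time. If one of them joined connected
  vertices, a path between these would be closed by it to a cycle, of length at least 3 because the
  edge is new and no loop.\<close>

lemma ncomp_union_eq:
  assumes V: "finite V" and "finite F" and "\<forall>e\<in>F. e \<subseteq> V \<and> card e = 2" and "S \<inter> F = {}"
    and nocyc: "\<forall>e\<in>F. \<nexists>vs. is_cycle (S \<union> F) vs \<and> e \<in> cycle_edges vs"
  shows "ncomp V S = ncomp V (S \<union> F) + card F"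
  using assms(2-)
proof (induction F rule: finite_induct)
  case (insert f F)
  then obtain a b where f: "f = {a, b}" "a \<in> V" "b \<in> V" "a \<noteq> b" by (auto simp: card_2_iff)
  have "(a, b) \<notin> link (S \<union> F)"
  proof
    assume "(a, b) \<in> link (S \<union> F)"
    then obtain xs where xs: "path_in (S \<union> F) xs" "hd xs = a" "last xs = b"
      using link_imp_path by metis
    have "xs \<noteq> []" using xs by (auto simp: path_in_def)
    have fS: "f \<notin> S \<union> F" using insert by auto
    have "length xs \<noteq> 1" using xs f(4) by (cases xs) (auto simp: path_in_def)
    moreover have "length xs \<noteq> 2"
    proof
      assume "length xs = 2"
      then have "xs = [a, b]" using xs by (cases xs; cases "tl xs") auto
      then show False using xs(1) fS f by (auto simp: path_in_def)
    qed
    ultimately have "3 \<le> length xs" using \<open>xs \<noteq> []\<close>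
      by (metis One_nat_def Suc_leI length_greater_0_conv nat_less_le numeral_2_eq_2 numeral_3_eq_3)
    moreover have "{last xs, hd xs} = f" using xs f by auto
    ultimately have "is_cycle (S \<union> insert f F) xs" "f \<in> cycle_edges xs"
      using path_in_mono[OF xs(1), of "S \<union> insert f F"] \<open>xs \<noteq> []\<close>
      by (auto simp: is_cycle_iff cycle_edges_eq)
    then show False using insert.prems by blast
  qed
  then have "ncomp V (S \<union> F) = Suc (ncomp V (S \<union> insert f F))"
    using ncomp_insert_unlinked[OF V f(2,3)] f by simp
  moreover have "ncomp V S = ncomp V (S \<union> F) + card F"
  proof (rule insert.IH)
    show "\<forall>e\<in>F. e \<subseteq> V \<and> card e = 2" "S \<inter> F = {}" using insert.prems by auto
    show "\<forall>e\<in>F. \<nexists>vs. is_cycle (S \<union> F) vs \<and> e \<in> cycle_edges vs"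
    proof (intro ballI notI)
      fix e assume e: "e \<in> F" and "\<exists>vs. is_cycle (S \<union> F) vs \<and> e \<in> cycle_edges vs"
      then obtain vs where "is_cycle (S \<union> F) vs" "e \<in> cycle_edges vs" by auto
      then have "is_cycle (S \<union> insert f F) vs" by (auto simp: is_cycle_def)
      then show False using insert.prems e \<open>e \<in> cycle_edges vs\<close> by blast
    qed
  qed
  ultimately show ?case using insert by simp
qed simp

text \<open>Domination outside \<open>B\<close> bounds the difference in one direction for every
  event \<open>A\<close>; the other direction is the same bound for the complement of
  \<open>A\<close>.\<close>

lemma tv_dist_le:
  assumes "\<And>x. x \<notin> B \<Longrightarrow> pmf \<mu> x \<le> pmf \<nu> x"
  shows "tv_dist \<nu> \<mu> \<le> measure_pmf.prob \<mu> B"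
proof -
  have le: "measure_pmf.prob \<mu> X \<le> measure_pmf.prob \<nu> X" if "X \<inter> B = {}" for X
  proof -
    have "emeasure (measure_pmf \<mu>) X \<le> emeasure (measure_pmf \<nu>) X"
      unfolding nn_integral_pmf[symmetric]
      by (intro nn_integral_mono) (use that assms in auto)
    then show ?thesis by (simp add: measure_pmf.emeasure_eq_measure)
  qed
  have one: "measure_pmf.prob \<mu> A - measure_pmf.prob \<nu> A \<le> measure_pmf.prob \<mu> B" for A
  proof -
    have "measure_pmf.prob \<mu> A \<le> measure_pmf.prob \<mu> ((A - B) \<union> B)"
      by (rule measure_pmf.finite_measure_mono) auto
    also have "\<dots> \<le> measure_pmf.prob \<mu> (A - B) + measure_pmf.prob \<mu> B"
      by (rule measure_Un_le) auto
    also have "measure_pmf.prob \<mu> (A - B) \<le> measure_pmf.prob \<nu> (A - B)" by (rule le) auto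
    also have "measure_pmf.prob \<nu> (A - B) \<le> measure_pmf.prob \<nu> A"
      by (rule measure_pmf.finite_measure_mono) auto
    finally show ?thesis by simp
  qed
  have compl: "measure_pmf.prob M (- A) = 1 - measure_pmf.prob M A" for M :: "'a pmf" and A
    using measure_pmf.prob_compl[of A M] by (simp add: Compl_eq_Diff_UNIV)
  have "\<bar>measure_pmf.prob \<nu> A - measure_pmf.prob \<mu> A\<bar> \<le> measure_pmf.prob \<mu> B" for A
    using one[of A] one[of "- A"] compl[of \<nu> A] compl[of \<mu> A] by linarith
  then show ?thesis unfolding tv_dist_def by (intro cSUP_least) auto
qed

section \<open>The law of the sampler and the probability of long open cycles\<close>

lemma prod_indicator_power:
  fixes a b :: real
  assumes "finite D"
  shows "(\<Prod>e\<in>D. if e \<in> S then a else b) = a ^ card (D \<inter> S) * b ^ card (D - S)"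
  using assms by (simp add: prod.If_cases Int_def Diff_eq Collect_neg_eq)

definition glue :: "real \<Rightarrow> 'a set set pmf \<Rightarrow> 'a set set \<Rightarrow> 'a set set pmf" where
  "glue r M D = map_pmf (\<lambda>(S', b). S' \<union> {e \<in> D. b e}) (pair_pmf M (Pi_pmf D False (\<lambda>_. bernoulli_pmf r)))"

text \<open>\<open>S\<close> determines both samples by its traces on \<open>E'\<close> and
  \<open>D\<close>. The map is therefore injective on the support, and the mass is a
  product.\<close>

lemma pmf_glue:
  assumes r: "0 < r" "r < 1" and D: "finite D" and M: "set_pmf M = Pow E'" and dis: "D \<inter> E' = {}"
    and S: "S \<subseteq> E' \<union> D"
  shows "pmf (glue r M D) S = pmf M (S \<inter> E') * (r ^ card (D \<inter> S) * (1 - r) ^ card (D - S))"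
proof -
  let ?P = "Pi_pmf D False (\<lambda>_. bernoulli_pmf r)" and ?f = "\<lambda>(S', b). S' \<union> {e \<in> D. b e}"
  let ?x = "(S \<inter> E', \<lambda>e. e \<in> D \<inter> S)"
  have setP: "set_pmf ?P \<subseteq> {b. \<forall>e. e \<notin> D \<longrightarrow> \<not> b e}"
    using set_Pi_pmf_subset[OF D, of False "\<lambda>_. bernoulli_pmf r"] by auto
  have pmfP: "pmf ?P (\<lambda>e. e \<in> D \<inter> S) = r ^ card (D \<inter> S) * (1 - r) ^ card (D - S)"
  proof -
    have "pmf ?P (\<lambda>e. e \<in> D \<inter> S) = (\<Prod>e\<in>D. pmf (bernoulli_pmf r) (e \<in> D \<inter> S))"
      using D by (subst pmf_Pi) auto
    also have "\<dots> = (\<Prod>e\<in>D. if e \<in> S then r else 1 - r)"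
      using r by (intro prod.cong) auto
    finally show ?thesis using D by (simp add: prod_indicator_power)
  qed
  have "inj_on ?f (set_pmf (pair_pmf M ?P))"
  proof (rule inj_onI, clarify)
    fix S1 b1 S2 b2 assume "(S1, b1) \<in> set_pmf (pair_pmf M ?P)" "(S2, b2) \<in> set_pmf (pair_pmf M ?P)"
      and eq: "S1 \<union> {e \<in> D. b1 e} = S2 \<union> {e \<in> D. b2 e}"
    then have sub: "S1 \<subseteq> E'" "S2 \<subseteq> E'" and b: "\<forall>e. e \<notin> D \<longrightarrow> \<not> b1 e" "\<forall>e. e \<notin> D \<longrightarrow> \<not> b2 e"
      using M setP by auto
    have "S1 = S2" using eq sub dis by blast
    moreover have "b1 e = b2 e" for e
    proof (cases "e \<in> D")
      case True
      then have "e \<notin> S1" "e \<notin> S2" using sub dis by auto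
      then have "b1 e \<longleftrightarrow> e \<in> S1 \<union> {e \<in> D. b1 e}" "b2 e \<longleftrightarrow> e \<in> S2 \<union> {e \<in> D. b2 e}" using True by simp_all
      then show ?thesis using eq by (simp only:)
    qed (use b in auto)
    ultimately show "S1 = S2 \<and> b1 = b2" by (simp add: fun_eq_iff)
  qed
  moreover have "?x \<in> set_pmf (pair_pmf M ?P)"
  proof -
    have "pmf ?P (\<lambda>e. e \<in> D \<inter> S) \<noteq> 0" unfolding pmfP using r by simp
    then show ?thesis using M by (simp add: set_pmf_iff)
  qed
  ultimately have "pmf (map_pmf ?f (pair_pmf M ?P)) (?f ?x) = pmf (pair_pmf M ?P) ?x"
    by (rule pmf_map_inj)
  moreover have "?f ?x = S" using S by auto
  ultimately have "pmf (glue r M D) S = pmf (pair_pmf M ?P) ?x" unfolding glue_def by simp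
  then show ?thesis by (simp only: pmf_pair pmfP)
qed

context rc_params
begin

lemma rc_weight_pos: "0 < rc_weight V E p q S"
  using p_pos p_less q_ge by (simp add: rc_weight_def)

lemma rc_partition_pos: "finite E \<Longrightarrow> 0 < rc_partition V E p q"
  unfolding rc_partition_def using rc_weight_pos by (intro sum_pos) auto

lemma set_pmf_random_cluster:
  assumes "finite E"
  shows "set_pmf (random_cluster V E p q) = Pow E"
proof -
  have "pmf (random_cluster V E p q) S \<noteq> 0 \<longleftrightarrow> S \<subseteq> E" for S
    using pmf_random_cluster[OF assms p_pos p_less, of q V S] q_ge rc_weight_pos[of E S]
      rc_partition_pos[OF assms] by simp
  then show ?thesis by (intro set_eqI) (simp add: set_pmf_iff)
qed

text \<open>One constant \<open>c\<close> serves twice: summing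
  \<open>c * pmf \<nu> S \<le> rc_weight V E p q S\<close> over all \<open>S\<close> gives
  \<open>c \<le> ?Z\<close>, and where equality holds this turns into domination of the
  random-cluster mass by that of \<open>\<nu>\<close>.\<close>

lemma sample_rc_tv:
  assumes G: "graph_on V E"
    and E': "E' = short_cycle_edges \<Delta> V E"
    and ok: "\<forall>C\<in>graph_components V E'. component_is_cycle E' C \<or> (\<exists>v. C = {v})"
  shows "\<exists>\<nu>. sample_rc \<Delta> p q V E = map_pmf Some \<nu> \<and> (\<forall>S\<in>set_pmf \<nu>. S \<subseteq> E) \<and>
     tv_dist \<nu> (random_cluster V E p q) \<le> measure_pmf.prob (random_cluster V E p q)
       {S. \<exists>vs. is_cycle S vs \<and> 1 / 5 * log (real \<Delta> - 1) (real (card V)) < real (length vs)}"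
proof -
  let ?\<phi> = "random_cluster V E p q"
  let ?B = "{S. \<exists>vs. is_cycle S vs \<and> 1 / 5 * log (real \<Delta> - 1) (real (card V)) < real (length vs)}"
  define r where "r = p / (p + (1 - p) * q)"
  define D where "D = E - E'"
  let ?M = "random_cluster V E' p q"
  define \<nu> where "\<nu> = glue r ?M D"
  have finE: "finite E" using graph_on_finite[OF G] .
  have sub: "E' \<subseteq> E" unfolding E' short_cycle_edges_def by auto
  have fin: "finite E'" "finite D" using finE sub finite_subset by (auto simp: D_def)
  have ED: "E = E' \<union> D" "D \<inter> E' = {}" using sub by (auto simp: D_def)
  have q0: "0 < q" using q_ge by simp
  have den: "0 < p + (1 - p) * q" using p_pos p_less q0 by (intro add_pos_pos) auto
  have r: "0 < r" "r < 1" using p_pos p_less q0 den by (auto simp: r_def)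
  have rr: "r = p / q / cc" "1 - r = (1 - p) / cc"
  proof -
    have c: "p + (1 - p) * q = q * cc" using q0 by (simp add: cc_def field_simps)
    show "r = p / q / cc" unfolding r_def c by simp
    have "1 - r = (p + (1 - p) * q - p) / (p + (1 - p) * q)"
      unfolding r_def using den by (simp add: field_simps)
    also have "\<dots> = (1 - p) * q / (q * cc)" unfolding c[symmetric] by simp
    finally show "1 - r = (1 - p) / cc" using q0 by simp
  qed
  have setM: "set_pmf ?M = Pow E'" by (rule set_pmf_random_cluster[OF fin(1)])
  have pmf\<nu>: "pmf \<nu> S = pmf ?M (S \<inter> E') * (r ^ card (D \<inter> S) * (1 - r) ^ card (D - S))" if "S \<subseteq> E" for S
    unfolding \<nu>_def using pmf_glue[OF r fin(2) setM ED(2)] that ED(1) by blast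
  have set\<nu>: "set_pmf \<nu> \<subseteq> Pow E" unfolding \<nu>_def glue_def using setM ED by auto
  have sample: "sample_rc \<Delta> p q V E = map_pmf Some \<nu>"
    using ok unfolding sample_rc_def Let_def E'[symmetric] \<nu>_def glue_def
    by (auto simp: D_def r_def pair_pmf_def map_bind_pmf bind_return_pmf bind_assoc_pmf map_pmf_def)
  let ?Z' = "rc_partition V E' p q" and ?Z = "rc_partition V E p q"
  \<comment> \<open>\<open>?Z'\<close> normalises the part inside \<open>E'\<close>, and each edge
    of \<open>D\<close> contributes \<open>cc\<close>, the sum of its two weights when it connects
    different components.\<close>
  define c where "c = ?Z' * cc ^ card D"
  have Z'0: "0 < ?Z'" and Z0: "0 < ?Z" using rc_partition_pos fin finE by auto
  have c0: "0 < c" unfolding c_def using Z'0 cc_pos by simp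
  have c\<nu>: "c * pmf \<nu> S = p ^ card S * (1 - p) ^ card (E - S) * q ^ ncomp V (S \<inter> E') / q ^ card (D \<inter> S)"
    if S: "S \<subseteq> E" for S
  proof -
    have fS: "finite S" using S finE finite_subset by blast
    have k1: "card D = card (D \<inter> S) + card (D - S)"
      using card_Un_disjoint[of "D \<inter> S" "D - S"] fin by (simp add: Int_Diff_Un Int_Diff_disjoint)
    have k2: "card S = card (S \<inter> E') + card (D \<inter> S)"
    proof -
      have "S = (S \<inter> E') \<union> (D \<inter> S)" using S ED by auto
      then show ?thesis using card_Un_disjoint[of "S \<inter> E'" "D \<inter> S"] fS fin ED by (auto simp: disjoint_iff)
    qed
    have k3: "card (E - S) = card (E' - S \<inter> E') + card (D - S)"
    proof -
      have "E - S = (E' - S \<inter> E') \<union> (D - S)" using ED by auto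
      then show ?thesis using card_Un_disjoint[of "E' - S \<inter> E'" "D - S"] fin ED by (auto simp: disjoint_iff)
    qed
    have "pmf ?M (S \<inter> E') = rc_weight V E' p q (S \<inter> E') / ?Z'"
      using pmf_random_cluster[OF fin(1) p_pos p_less q0, of V "S \<inter> E'"] by simp
    then have "c * pmf \<nu> S = rc_weight V E' p q (S \<inter> E') *
       (cc ^ card D * (r ^ card (D \<inter> S) * (1 - r) ^ card (D - S)))"
      unfolding pmf\<nu>[OF S] c_def using Z'0 by simp
    also have "cc ^ card D * (r ^ card (D \<inter> S) * (1 - r) ^ card (D - S)) =
        (cc * r) ^ card (D \<inter> S) * (cc * (1 - r)) ^ card (D - S)"
      unfolding k1 by (simp add: power_add power_mult_distrib)
    also have "cc * r = p / q" unfolding rr(1) using cc_pos by simp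
    also have "cc * (1 - r) = 1 - p" unfolding rr(2) using cc_pos by simp
    finally show ?thesis
      unfolding rc_weight_def k2 k3 by (simp add: power_add power_divide)
  qed
  have low: "c * pmf \<nu> S \<le> rc_weight V E p q S" if S: "S \<subseteq> E" for S
  proof -
    have "finite (D \<inter> S)" "\<forall>e\<in>D \<inter> S. e \<subseteq> V \<and> card e = 2" using fin G by (auto simp: D_def graph_on_def)
    from ncomp_union_le[OF finite_V this, of "S \<inter> E'"]
    have "ncomp V (S \<inter> E') \<le> ncomp V S + card (D \<inter> S)"
    proof -
      have "S \<inter> E' \<union> D \<inter> S = S" using S ED by auto
      then show ?thesis using \<open>ncomp V (S \<inter> E') \<le> _\<close> by simp
    qed
    then have "q ^ ncomp V (S \<inter> E') \<le> q ^ (ncomp V S + card (D \<inter> S))"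
      using q_ge by (intro power_increasing) auto
    then have "q ^ ncomp V (S \<inter> E') / q ^ card (D \<inter> S) \<le> q ^ ncomp V S"
      using q0 by (simp add: power_add pos_divide_le_eq)
    then have "p ^ card S * (1 - p) ^ card (E - S) * (q ^ ncomp V (S \<inter> E') / q ^ card (D \<inter> S))
       \<le> rc_weight V E p q S"
      unfolding rc_weight_def using p_pos p_less by (intro mult_left_mono) auto
    then show ?thesis unfolding c\<nu>[OF S] by simp
  qed
  \<comment> \<open>A cycle of \<open>S\<close> through an edge of \<open>D\<close> would have to be
    long, as no short cycle contains that edge; so each edge of \<open>D\<close> in \<open>S\<close>
    merges two components.\<close>
  have eq: "c * pmf \<nu> S = rc_weight V E p q S" if S: "S \<subseteq> E" "S \<notin> ?B" for S
  proof -
    have SE: "S \<inter> E' \<union> D \<inter> S = S" using S ED by auto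
    have "ncomp V (S \<inter> E') = ncomp V (S \<inter> E' \<union> D \<inter> S) + card (D \<inter> S)"
    proof (rule ncomp_union_eq[OF finite_V])
      show "finite (D \<inter> S)" using fin by simp
      show "\<forall>e\<in>D \<inter> S. e \<subseteq> V \<and> card e = 2" using G S(1) by (auto simp: graph_on_def)
      show "S \<inter> E' \<inter> (D \<inter> S) = {}" using ED(2) by blast
      show "\<forall>e\<in>D \<inter> S. \<nexists>vs. is_cycle (S \<inter> E' \<union> D \<inter> S) vs \<and> e \<in> cycle_edges vs"
        unfolding SE
      proof (intro ballI notI)
        fix e assume e: "e \<in> D \<inter> S" and "\<exists>vs. is_cycle S vs \<and> e \<in> cycle_edges vs"
        then obtain vs where vs: "is_cycle S vs" "e \<in> cycle_edges vs" by auto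
        then have "is_cycle E vs" using S(1) by (auto simp: is_cycle_def)
        moreover have "real (length vs) \<le> 1 / 5 * log (real \<Delta> - 1) (real (card V))"
          using vs S(2) by (auto simp: not_less)
        ultimately have "e \<in> E'" using e vs unfolding E' short_cycle_edges_def by (auto simp: D_def)
        then show False using e by (auto simp: D_def)
      qed
    qed
    then show ?thesis
      unfolding c\<nu>[OF S(1)] SE rc_weight_def using q0 by (simp add: power_add)
  qed
  have "c \<le> ?Z"
  proof -
    have "c = (\<Sum>S\<in>Pow E. c * pmf \<nu> S)"
      using sum_pmf_eq_1[of "Pow E" \<nu>] finE set\<nu> by (simp add: sum_distrib_left[symmetric])
    also have "\<dots> \<le> ?Z" unfolding rc_partition_def using low by (intro sum_mono) auto
    finally show ?thesis .
  qed
  have "tv_dist \<nu> ?\<phi> \<le> measure_pmf.prob ?\<phi> ?B"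
  proof (rule tv_dist_le)
    fix S :: "'a set set" assume S: "S \<notin> ?B"
    show "pmf ?\<phi> S \<le> pmf \<nu> S"
    proof (cases "S \<subseteq> E")
      case True
      then have "pmf ?\<phi> S = c * pmf \<nu> S / ?Z"
        using pmf_random_cluster[OF finE p_pos p_less q0, of V S] eq[OF True S] by simp
      also have "\<dots> \<le> pmf \<nu> S"
        using mult_right_mono[OF \<open>c \<le> ?Z\<close> pmf_nonneg[of \<nu> S]] Z0
        by (simp add: pos_divide_le_eq mult.commute)
      finally show ?thesis .
    next
      case False
      then show ?thesis using pmf_random_cluster[OF finE p_pos p_less q0, of V S] by simp
    qed
  qed
  then show ?thesis using sample set\<nu> by blast
qed

lemma prob_open:
  assumes "finite E" "A \<subseteq> E"
  shows "measure_pmf.prob (random_cluster V E p q) {S. A \<subseteq> S} = open_weight E A / open_weight E {}"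
proof -
  let ?\<phi> = "random_cluster V E p q" let ?Z = "rc_partition V E p q"
  have Z: "?Z = open_weight E {}"
    unfolding rc_partition_def open_weight_def by (rule sum.cong) auto
  have "measure_pmf.prob ?\<phi> {S. A \<subseteq> S} = measure_pmf.prob ?\<phi> ({S. A \<subseteq> S} \<inter> set_pmf ?\<phi>)"
    by (rule measure_Int_set_pmf[symmetric])
  also have "{S. A \<subseteq> S} \<inter> set_pmf ?\<phi> = {S. A \<subseteq> S \<and> S \<subseteq> E}"
    using set_pmf_random_cluster[OF assms(1)] by auto
  also have "measure_pmf.prob ?\<phi> {S. A \<subseteq> S \<and> S \<subseteq> E} = (\<Sum>S\<in>{S. A \<subseteq> S \<and> S \<subseteq> E}. pmf ?\<phi> S)"
    using assms by (intro measure_measure_pmf_finite) auto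
  also have "\<dots> = (\<Sum>S\<in>{S. A \<subseteq> S \<and> S \<subseteq> E}. rc_weight V E p q S / ?Z)"
    using pmf_random_cluster[OF assms(1) p_pos p_less, of q V] q_ge by (intro sum.cong) auto
  finally show ?thesis unfolding Z open_weight_def by (simp add: sum_divide_distrib)
qed

text \<open>Union bound. From a cycle of length \<open>l\<close> only the \<open>l - 1\<close> edges
  of a path are used, at the price of one factor \<open>\<kappa>\<close>; a cycle longer than
  \<open>T\<close> is represented by an initial path with \<open>T\<close> edges.\<close>

lemma prob_long_cycle:
  assumes G: "graph_on V E" and deg: "\<forall>v. card (star E v) \<le> Suc d"
    and \<kappa>: "\<kappa> = p / (p + (1 - p) * q) * mseq d h ^ d" "\<kappa> \<le> 1"
    and sp: "\<forall>vs. path_in E vs \<and> 2 \<le> length vs \<and> length vs \<le> Suc T \<longrightarrow> sparse_along E vs (m * (2 * Suc h)) m"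
    and T: "T \<noteq> 0"
  shows "measure_pmf.prob (random_cluster V E p q) {S. \<exists>vs. is_cycle S vs \<and> L < real (length vs)} \<le>
    1 / \<kappa> ^ (m * (2 * Suc h) * 2 * (2 * Suc h + 1)) *
     ((\<Sum>l | L < real l \<and> l \<le> T. real (card {vs. is_cycle E vs \<and> length vs = l}) * \<kappa> ^ (l - 1)) +
      real (card {vs. path_in E vs \<and> length vs = Suc T}) * \<kappa> ^ T)"
proof -
  let ?\<phi> = "random_cluster V E p q" and ?K = "\<kappa> ^ (m * (2 * Suc h) * 2 * (2 * Suc h + 1))"
  let ?C = "\<lambda>l. {vs. is_cycle E vs \<and> length vs = l}" and ?P = "{vs. path_in E vs \<and> length vs = Suc T}"
  let ?L = "{l. L < real l \<and> l \<le> T}"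
  let ?ev = "\<lambda>vs. {S. list_edges vs \<subseteq> S}"
  have finE: "finite E" using graph_on_finite[OF G] .
  have \<kappa>0: "0 < \<kappa>" unfolding \<kappa> using p_pos p_less q_ge mseq_ge_1[of d h]
    by (intro mult_pos_pos divide_pos_pos add_pos_nonneg zero_less_power) auto
  note sub = path_in_vertices[OF G]
  have finl: "finite {vs. set vs \<subseteq> V \<and> length vs = l}" for l
    using finite_V by (rule finite_lists_length_eq)
  have finC: "finite (?C l)" for l
  proof (rule finite_subset[OF _ finl[of l]], rule subsetI)
    fix vs assume vs: "vs \<in> ?C l"
    then have "path_in E vs" "2 \<le> length vs" by (auto simp: is_cycle_iff)
    from sub[OF this] show "vs \<in> {vs. set vs \<subseteq> V \<and> length vs = l}" using vs by simp
  qed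
  have pathb: "measure_pmf.prob ?\<phi> (?ev vs) \<le> \<kappa> ^ (length vs - 1) / ?K"
    if "path_in E vs" "2 \<le> length vs" "length vs \<le> Suc T" for vs
  proof -
    have Z: "0 < open_weight E {}"
      using rc_partition_pos[OF finE] unfolding rc_partition_def open_weight_def by (simp add: Pow_def)
    have "open_weight E (list_edges vs) \<le> \<kappa> ^ (length vs - 1) / ?K * open_weight E {}"
      using open_weight_path_bound[OF G deg that(1) \<kappa>] sp that by blast
    then show ?thesis
      unfolding prob_open[OF finE list_edges_subset[OF that(1)]] using Z by (simp add: pos_divide_le_eq)
  qed
  have finP: "finite ?P"
  proof (rule finite_subset[OF _ finl[of "Suc T"]], rule subsetI)
    fix vs assume vs: "vs \<in> ?P"
    then have "path_in E vs" "2 \<le> length vs" using T by auto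
    from sub[OF this] show "vs \<in> {vs. set vs \<subseteq> V \<and> length vs = Suc T}" using vs by simp
  qed
  have "measure_pmf.prob ?\<phi> {S. \<exists>vs. is_cycle S vs \<and> L < real (length vs)}
    = measure_pmf.prob ?\<phi> ({S. \<exists>vs. is_cycle S vs \<and> L < real (length vs)} \<inter> set_pmf ?\<phi>)"
    by (rule measure_Int_set_pmf[symmetric])
  also have "\<dots> \<le> measure_pmf.prob ?\<phi> ((\<Union>l\<in>?L. \<Union>vs\<in>?C l. ?ev vs) \<union> (\<Union>vs\<in>?P. ?ev vs))"
  proof (rule measure_pmf.finite_measure_mono)
    show "{S. \<exists>vs. is_cycle S vs \<and> L < real (length vs)} \<inter> set_pmf ?\<phi>
       \<subseteq> (\<Union>l\<in>?L. \<Union>vs\<in>?C l. ?ev vs) \<union> (\<Union>vs\<in>?P. ?ev vs)"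
    proof
      fix S assume "S \<in> {S. \<exists>vs. is_cycle S vs \<and> L < real (length vs)} \<inter> set_pmf ?\<phi>"
      then obtain vs where vs: "is_cycle S vs" "L < real (length vs)" and SE: "S \<subseteq> E"
        using set_pmf_random_cluster[OF finE] by auto
      have cE: "is_cycle E vs" using vs SE by (auto simp: is_cycle_def)
      have pS: "path_in S vs" using vs by (auto simp: is_cycle_iff)
      show "S \<in> (\<Union>l\<in>?L. \<Union>vs\<in>?C l. ?ev vs) \<union> (\<Union>vs\<in>?P. ?ev vs)"
      proof (cases "length vs \<le> T")
        case True
        then show ?thesis using vs cE list_edges_subset[OF pS] by auto
      next
        case False
        have "path_in S (take (Suc T) vs @ drop (Suc T) vs)" using pS by simp
        then have "path_in S (take (Suc T) vs)"
          by (rule path_in_append1) (use False in auto)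
        then have "take (Suc T) vs \<in> ?P" "list_edges (take (Suc T) vs) \<subseteq> S"
          using path_in_mono[OF _ SE] list_edges_subset False by auto
        then show ?thesis by blast
      qed
    qed
  qed simp
  also have "\<dots> \<le> measure_pmf.prob ?\<phi> (\<Union>l\<in>?L. \<Union>vs\<in>?C l. ?ev vs) + measure_pmf.prob ?\<phi> (\<Union>vs\<in>?P. ?ev vs)"
    by (rule measure_Un_le) auto
  also have "measure_pmf.prob ?\<phi> (\<Union>vs\<in>?P. ?ev vs) \<le> (\<Sum>vs\<in>?P. measure_pmf.prob ?\<phi> (?ev vs))"
    using finP by (rule measure_UNION_le) auto
  also have "\<dots> \<le> (\<Sum>vs\<in>?P. \<kappa> ^ T / ?K)"
  proof (rule sum_mono)
    fix vs assume "vs \<in> ?P"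
    then show "measure_pmf.prob ?\<phi> (?ev vs) \<le> \<kappa> ^ T / ?K" using pathb[of vs] T by auto
  qed
  also have "measure_pmf.prob ?\<phi> (\<Union>l\<in>?L. \<Union>vs\<in>?C l. ?ev vs) \<le> (\<Sum>l\<in>?L. measure_pmf.prob ?\<phi> (\<Union>vs\<in>?C l. ?ev vs))"
    by (rule measure_UNION_le) auto
  also have "\<dots> \<le> (\<Sum>l\<in>?L. \<Sum>vs\<in>?C l. \<kappa> ^ (l - 1) / ?K)"
  proof (rule sum_mono)
    fix l assume l: "l \<in> ?L"
    have "measure_pmf.prob ?\<phi> (\<Union>vs\<in>?C l. ?ev vs) \<le> (\<Sum>vs\<in>?C l. measure_pmf.prob ?\<phi> (?ev vs))"
      using finC by (rule measure_UNION_le) auto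
    also have "\<dots> \<le> (\<Sum>vs\<in>?C l. \<kappa> ^ (l - 1) / ?K)"
    proof (rule sum_mono)
      fix vs assume "vs \<in> ?C l"
      then show "measure_pmf.prob ?\<phi> (?ev vs) \<le> \<kappa> ^ (l - 1) / ?K"
        using pathb[of vs] l by (auto simp: is_cycle_iff)
    qed
    finally show "measure_pmf.prob ?\<phi> (\<Union>vs\<in>?C l. ?ev vs) \<le> (\<Sum>vs\<in>?C l. \<kappa> ^ (l - 1) / ?K)" .
  qed
  finally show ?thesis
    by (simp add: sum_divide_distrib[symmetric] add_divide_distrib[symmetric])
qed

end

section \<open>Switchings\<close>

definition reg_count :: "nat \<Rightarrow> nat \<Rightarrow> nat set set \<Rightarrow> nat" where
  "reg_count \<Delta> n F = card {E \<in> regular_graphs \<Delta> n. F \<subseteq> E}"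

lemma finite_regular_graphs: "finite (regular_graphs \<Delta> n)"
  by (rule finite_subset[of _ "Pow (Pow {..<n})"]) (auto simp: regular_graphs_def)

lemma regular_graph_on: "E \<in> regular_graphs \<Delta> n \<Longrightarrow> graph_on {..<n} E"
  by (auto simp: regular_graphs_def graph_on_def)

lemma regular_card_star: "E \<in> regular_graphs \<Delta> n \<Longrightarrow> v < n \<Longrightarrow> card (star E v) = \<Delta>"
  by (auto simp: regular_graphs_def star_def)

lemma card_nbrs:
  assumes "graph_on V E"
  shows "card {y. {x, y} \<in> E} = card (star E x)"
proof -
  have "bij_betw (\<lambda>y. {x, y}) {y. {x, y} \<in> E} (star E x)"
    unfolding bij_betw_def
  proof
    show "inj_on (\<lambda>y. {x, y}) {y. {x, y} \<in> E}" by (auto simp: inj_on_def doubleton_eq_iff)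
    have "e \<in> (\<lambda>y. {x, y}) ` {y. {x, y} \<in> E}" if e: "e \<in> E" "x \<in> e" for e
    proof -
      obtain b where "e = {x, b}" using graph_on_edgeE[OF assms e] by blast
      then show ?thesis using e by auto
    qed
    then show "(\<lambda>y. {x, y}) ` {y. {x, y} \<in> E} = star E x" by (auto simp: star_def)
  qed
  then show ?thesis by (rule bij_betw_same_card)
qed

lemma finite_nbrs: "graph_on V E \<Longrightarrow> finite {y. {x, y} \<in> E}"
  by (rule finite_subset[of _ V]) (auto dest: graph_on_edge simp: graph_on_def)

text \<open>There are \<open>\<Delta> * n\<close> ordered pairs of adjacent vertices. Excluded are
  both orientations of at most \<open>card F + 1\<close> prescribed edges, and the pairs with
  \<open>x\<close> equal or adjacent to \<open>u\<close> or with \<open>y\<close> equal or adjacent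
  to \<open>v\<close>, at most \<open>\<Delta> * (\<Delta> + 1)\<close> of each kind.\<close>

lemma card_switchable:
  assumes E: "E \<in> regular_graphs \<Delta> n" "insert {u, v} F \<subseteq> E" and uv: "u < n" "v < n"
  defines "Sw \<equiv> {(x, y). {x, y} \<in> E - insert {u, v} F \<and> x \<noteq> u \<and> {u, x} \<notin> E \<and> y \<noteq> v \<and> {v, y} \<notin> E}"
  shows "\<Delta> * n - (2 * card F + 2 + 2 * \<Delta> * (\<Delta> + 1)) \<le> card Sw" "finite Sw"
proof -
  note G = regular_graph_on[OF E(1)]
  let ?N = "\<lambda>x. {y. {x, y} \<in> E}" and ?F = "insert {u, v} F"
  let ?O = "SIGMA x:{..<n}. ?N x"
  have finN: "finite (?N x)" for x by (rule finite_nbrs[OF G])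
  have cN: "card (?N x) = \<Delta>" if "x < n" for x
    using card_nbrs[OF G] regular_card_star[OF E(1) that] by simp
  have ltn: "x < n" "y < n" if "{x, y} \<in> E" for x y using graph_on_edge[OF G that] by auto
  have cO: "card ?O = \<Delta> * n" using finN cN by simp
  have finO: "finite ?O" using finN by auto
  show "finite Sw" by (rule finite_subset[OF _ finO]) (auto simp: Sw_def ltn)
  have finF: "finite ?F" by (rule finite_subset[OF E(2) graph_on_finite[OF G]])
  let ?X0 = "\<Union>f\<in>?F. {(x, y). {x, y} = f}"
  let ?X1 = "SIGMA x:insert u (?N u). ?N x" and ?X2 = "SIGMA x:insert v (?N v). ?N x"
  have pr: "card {(x, y). {x, y} = f} \<le> 2 \<and> finite {(x, y). {x, y} = f}" if f: "f \<in> ?F" for f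
  proof -
    have "f \<in> E" using f E(2) by blast
    then have "card f = 2" using G by (simp add: graph_on_def)
    then obtain a b where ab: "f = {a, b}" by (auto simp: card_2_iff)
    have sub: "{(x, y). {x, y} = f} \<subseteq> {(a, b), (b, a)}"
      unfolding ab by (simp add: subset_iff doubleton_eq_iff)
    have "card {(x, y). {x, y} = f} \<le> card {(a, b), (b, a)}" by (rule card_mono[OF _ sub]) simp
    also have "\<dots> \<le> 2" by (rule card_insert_le_m1) simp_all
    finally show ?thesis using finite_subset[OF sub] by simp
  qed
  have c0: "card ?X0 \<le> 2 * card F + 2"
  proof -
    have "card ?X0 \<le> (\<Sum>f\<in>?F. card {(x, y). {x, y} = f})" by (rule card_UN_le[OF finF])
    also have "\<dots> \<le> of_nat (card ?F) * 2"
      by (rule sum_bounded_above) (use pr in blast)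
    finally have "card ?X0 \<le> card ?F * 2" unfolding of_nat_id .
    moreover have "card ?F \<le> Suc (card F)"
      by (rule card_insert_le_m1) simp_all
    ultimately show ?thesis by linarith
  qed
  have cX: "card (SIGMA x:insert w (?N w). ?N x) \<le> \<Delta> * (\<Delta> + 1)" if "w < n" for w
  proof -
    have "card (SIGMA x:insert w (?N w). ?N x) = (\<Sum>x\<in>insert w (?N w). card (?N x))"
      using finN by (intro card_SigmaI) auto
    also have "\<dots> = (\<Sum>x\<in>insert w (?N w). \<Delta>)" using that ltn cN by (intro sum.cong) auto
    also have "\<dots> = card (insert w (?N w)) * \<Delta>" by simp
    also have "\<dots> \<le> (\<Delta> + 1) * \<Delta>"
      using finN[of w] cN[OF that] by (intro mult_right_mono) (simp_all add: card_insert_if)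
    finally show ?thesis by simp
  qed
  let ?X2' = "prod.swap ` ?X2"
  have fin: "finite ?X0" "finite ?X1" "finite ?X2'" using pr finF finN by auto
  have "?O \<subseteq> Sw \<union> (?X0 \<union> (?X1 \<union> ?X2'))"
  proof
    fix z assume "z \<in> ?O"
    then obtain x y where z: "z = (x, y)" "{x, y} \<in> E" by auto
    show "z \<in> Sw \<union> (?X0 \<union> (?X1 \<union> ?X2'))"
    proof (cases "x = u \<or> {u, x} \<in> E \<or> y = v \<or> {v, y} \<in> E")
      case True
      then have "(x, y) \<in> ?X1 \<or> (y, x) \<in> ?X2" using z by (auto simp: insert_commute)
      then show ?thesis using z by (auto intro: rev_image_eqI)
    next
      case False
      then show ?thesis using z by (auto simp: Sw_def)
    qed
  qed
  then have "card ?O \<le> card (Sw \<union> (?X0 \<union> (?X1 \<union> ?X2')))"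
    using \<open>finite Sw\<close> fin by (intro card_mono) auto
  also have "\<dots> \<le> card Sw + card (?X0 \<union> (?X1 \<union> ?X2'))" by (rule card_Un_le)
  also have "card (?X0 \<union> (?X1 \<union> ?X2')) \<le> card ?X0 + card (?X1 \<union> ?X2')" by (rule card_Un_le)
  also have "card (?X1 \<union> ?X2') \<le> card ?X1 + card ?X2'" by (rule card_Un_le)
  also have "card ?X2' = card ?X2" by (rule card_image) (auto simp: inj_on_def)
  finally have "\<Delta> * n \<le> card Sw + (2 * card F + 2 + (\<Delta> * (\<Delta> + 1) + \<Delta> * (\<Delta> + 1)))"
    using c0 cX[OF uv(1)] cX[OF uv(2)] cO by linarith
  then show "\<Delta> * n - (2 * card F + 2 + 2 * \<Delta> * (\<Delta> + 1)) \<le> card Sw" by simp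
qed

text \<open>Each of the four vertices loses one edge and gains one. That \<open>x\<close> differs
  from \<open>v\<close>, and \<open>y\<close> from \<open>u\<close>, follows since \<open>uv\<close>
  is an edge while \<open>ux\<close> and \<open>vy\<close> are not.\<close>

lemma switched_regular:
  assumes E: "E \<in> regular_graphs \<Delta> n" and uv: "{u, v} \<in> E" and xy: "{x, y} \<in> E"
    and x: "x \<noteq> u" "{u, x} \<notin> E" and y: "y \<noteq> v" "{v, y} \<notin> E"
  shows "(E - {{u, v}, {x, y}}) \<union> {{u, x}, {v, y}} \<in> regular_graphs \<Delta> n"
proof -
  note G = regular_graph_on[OF E]
  let ?E = "(E - {{u, v}, {x, y}}) \<union> {{u, x}, {v, y}}"
  have ne: "u \<noteq> v" "x \<noteq> y" "u < n" "v < n" "x < n" "y < n"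
    using graph_on_edge[OF G uv] graph_on_edge[OF G xy] by auto
  have ne2: "x \<noteq> v" "y \<noteq> u" using uv x y by (auto simp: insert_commute)
  have fin: "finite (star E w)" for w using graph_on_finite[OF G] by (auto simp: star_def)
  have swap: "card (insert g (star E w - {f})) = \<Delta>" if "w < n" "f \<in> star E w" "g \<notin> E" for w f g
  proof -
    have "g \<notin> star E w - {f}" using that by (auto simp: star_def)
    then have "card (insert g (star E w - {f})) = Suc (card (star E w) - 1)"
      using fin that by (simp add: card_Diff_singleton)
    moreover have "card (star E w) > 0" using that fin by (auto simp: card_gt_0_iff)
    ultimately show ?thesis using regular_card_star[OF E that(1)] by simp
  qed
  have vy: "{v, y} \<notin> E" "{u, x} \<notin> E" by fact+
  have "card (star ?E w) = \<Delta>" if w: "w < n" for w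
  proof -
    consider "w = u" | "w = v" | "w = x" | "w = y" | "w \<notin> {u, v, x, y}" by auto
    then show ?thesis
    proof cases
      case 1
      then have "star ?E w = insert {u, x} (star E w - {{u, v}})"
        using ne ne2 x y by (auto simp: star_def)
      then show ?thesis using swap[OF w _ vy(2), of "{u, v}"] uv 1 by (simp add: star_def)
    next
      case 2
      then have "star ?E w = insert {v, y} (star E w - {{u, v}})"
        using ne ne2 x y by (auto simp: star_def)
      then show ?thesis using swap[OF w _ vy(1), of "{u, v}"] uv 2 by (simp add: star_def)
    next
      case 3
      then have "star ?E w = insert {u, x} (star E w - {{x, y}})"
        using ne ne2 x y by (auto simp: star_def)
      then show ?thesis using swap[OF w _ vy(2), of "{x, y}"] xy 3 by (simp add: star_def)
    next
      case 4
      then have "star ?E w = insert {v, y} (star E w - {{x, y}})"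
        using ne ne2 x y by (auto simp: star_def)
      then show ?thesis using swap[OF w _ vy(1), of "{x, y}"] xy 4 by (simp add: star_def)
    next
      case 5
      then have "star ?E w = star E w" by (auto simp: star_def)
      then show ?thesis using regular_card_star[OF E w] by simp
    qed
  qed
  moreover have "e \<subseteq> {..<n} \<and> card e = 2" if "e \<in> ?E" for e
    using that G ne ne2 x(1) y(1) by (auto simp: graph_on_def)
  ultimately show ?thesis unfolding regular_graphs_def star_def by blast
qed

text \<open>The switching \<open>uv, xy \<mapsto> ux, vy\<close> turns graphs containing \<open>uv\<close> into graphs without it.\<close>

lemma switching:
  assumes uv: "u < n" "v < n" "{u, v} \<notin> F"
  shows "reg_count \<Delta> n (insert {u, v} F) * (\<Delta> * n - (2 * card F + 2 + 2 * \<Delta> * (\<Delta> + 1)))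
    \<le> reg_count \<Delta> n F * ((\<Delta> - card (star F u)) * (\<Delta> - card (star F v)))"
proof -
  let ?A = "{E \<in> regular_graphs \<Delta> n. insert {u, v} F \<subseteq> E}" and ?B = "{E \<in> regular_graphs \<Delta> n. F \<subseteq> E}"
  let ?Sw = "\<lambda>E. {(x, y). {x, y} \<in> E - insert {u, v} F \<and> x \<noteq> u \<and> {u, x} \<notin> E \<and> y \<noteq> v \<and> {v, y} \<notin> E}"
  let ?Q = "\<lambda>E. {x. {u, x} \<in> E - F} \<times> {y. {v, y} \<in> E - F}"
  let ?g = "\<lambda>(E, x, y). ((E - {{u, v}, {x, y}}) \<union> {{u, x}, {v, y}}, x, y)"
  let ?c = "\<Delta> * n - (2 * card F + 2 + 2 * \<Delta> * (\<Delta> + 1))"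
  have finA: "finite ?A" "finite ?B" using finite_regular_graphs by auto
  have sw: "?c \<le> card (?Sw E)" "finite (?Sw E)" if "E \<in> ?A" for E
    using card_switchable[of E \<Delta> n u v F] that uv by auto
  have "reg_count \<Delta> n (insert {u, v} F) * ?c = (\<Sum>E\<in>?A. ?c)" by (simp add: reg_count_def)
  also have "\<dots> \<le> (\<Sum>E\<in>?A. card (?Sw E))" using sw by (intro sum_mono) auto
  also have "\<dots> = card (SIGMA E:?A. ?Sw E)"
    using finA sw by (intro card_SigmaI[symmetric]) auto
  also have "\<dots> \<le> card (SIGMA E:?B. ?Q E)"
  \<comment> \<open>Keeping \<open>x\<close> and \<open>y\<close> makes the switching reversible. In
    the image they are neighbours of \<open>u\<close> and \<open>v\<close> through edges outside
    \<open>F\<close>, so their number is bounded by the free degrees.\<close>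
  proof (rule card_inj_on_le[of ?g])
    show "inj_on ?g (SIGMA E:?A. ?Sw E)"
    proof (rule inj_onI)
      fix z z' assume z: "z \<in> (SIGMA E:?A. ?Sw E)" "z' \<in> (SIGMA E:?A. ?Sw E)" and eq: "?g z = ?g z'"
      obtain E x y where zE: "z = (E, x, y)" by (cases z)
      obtain E' where z'E: "z' = (E', x, y)" using eq zE by (cases z') auto
      have r: "H = ((H - A) \<union> B) - B \<union> A" if "A \<subseteq> H" "B \<inter> H = {}" for H A B :: "nat set set"
        using that by blast
      have H: "{{u, v}, {x, y}} \<subseteq> H" "{{u, x}, {v, y}} \<inter> H = {}" if "H = E \<or> H = E'" for H
        using z that unfolding zE z'E by auto
      have "(E - {{u, v}, {x, y}}) \<union> {{u, x}, {v, y}} = (E' - {{u, v}, {x, y}}) \<union> {{u, x}, {v, y}}"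
        using eq unfolding zE z'E by simp
      then have "E = E'" using r[OF H, of E] r[OF H, of E'] by simp
      then show "z = z'" using zE z'E by simp
    qed
    show "?g ` (SIGMA E:?A. ?Sw E) \<subseteq> (SIGMA E:?B. ?Q E)"
    proof (rule image_subsetI)
      fix z assume z: "z \<in> (SIGMA E:?A. ?Sw E)"
      obtain E x y where zE: "z = (E, x, y)" by (cases z)
      have E: "E \<in> regular_graphs \<Delta> n" "insert {u, v} F \<subseteq> E"
        and xy: "{x, y} \<in> E" "{x, y} \<notin> insert {u, v} F" "x \<noteq> u" "{u, x} \<notin> E" "y \<noteq> v" "{v, y} \<notin> E"
        using z unfolding zE by auto
      let ?E = "(E - {{u, v}, {x, y}}) \<union> {{u, x}, {v, y}}"
      have "?E \<in> regular_graphs \<Delta> n" using switched_regular[OF E(1) _ xy(1,3,4,5,6)] E(2) by auto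
      moreover have "F \<subseteq> ?E" using E xy uv by auto
      moreover have "{u, x} \<notin> F" "{v, y} \<notin> F" using E xy by auto
      ultimately show "?g z \<in> (SIGMA E:?B. ?Q E)" unfolding zE by simp
    qed
    have "finite (?Q E)" if "E \<in> ?B" for E
    proof -
      have "graph_on {..<n} (E - F)" using that regular_graph_on graph_on_subset by blast
      then show ?thesis by (intro finite_cartesian_product finite_nbrs)
    qed
    then show "finite (SIGMA E:?B. ?Q E)" using finA by auto
  qed
  also have "\<dots> = (\<Sum>E\<in>?B. card (?Q E))"
  proof (rule card_SigmaI[OF finA(2)], rule ballI)
    fix E assume "E \<in> ?B"
    then have "graph_on {..<n} (E - F)" using regular_graph_on graph_on_subset by blast
    then show "finite (?Q E)" by (intro finite_cartesian_product finite_nbrs)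
  qed
  also have "\<dots> = (\<Sum>E\<in>?B. (\<Delta> - card (star F u)) * (\<Delta> - card (star F v)))"
  proof (rule sum.cong[OF refl])
    fix E assume E: "E \<in> ?B"
    then have G: "graph_on {..<n} (E - F)" and fin: "finite E"
      using regular_graph_on graph_on_subset graph_on_finite by blast+
    have "card {x. {w, x} \<in> E - F} = \<Delta> - card (star F w)" if "w < n" for w
    proof -
      have "star (E - F) w = star E w - star F w" by (auto simp: star_def)
      moreover have "star F w \<subseteq> star E w" using E by (auto simp: star_def)
      moreover have "finite (star F w)" using E fin by (auto simp: star_def intro: finite_subset)
      ultimately have "card (star (E - F) w) = card (star E w) - card (star F w)"
        by (simp add: card_Diff_subset)
      then show ?thesis using card_nbrs[OF G] regular_card_star[of E \<Delta> n w] E that by simp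
    qed
    then show "card (?Q E) = (\<Delta> - card (star F u)) * (\<Delta> - card (star F v))"
      using uv by (simp only: card_cartesian_product)
  qed
  also have "\<dots> = reg_count \<Delta> n F * ((\<Delta> - card (star F u)) * (\<Delta> - card (star F v)))"
    by (simp add: reg_count_def)
  finally show ?thesis .
qed

text \<open>The end of the growing path already carries a path edge and has at most
  \<open>\<Delta> - 1\<close> free places; only the very first vertex has \<open>\<Delta>\<close>,
  which the factor \<open>\<Delta> / (\<Delta> - 1)\<close> corrects. This gain at each step is what
  makes paths grow at rate \<open>\<Delta> - 1\<close> and not \<open>\<Delta>\<close>.\<close>

lemma reg_count_path:
  fixes n \<Delta> :: nat and M :: real
  assumes \<Delta>: "2 \<le> \<Delta>" and vs: "distinct vs" "set vs \<subseteq> {..<n}" "k < length vs"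
    and M: "0 < M" "M \<le> real (\<Delta> * n) - real (2 * k + 2 + 2 * \<Delta> * (\<Delta> + 1))"
  shows "real (reg_count \<Delta> n (list_edges (take (Suc k) vs))) \<le>
    real (reg_count \<Delta> n {}) * (if k = 0 then 1 else real \<Delta> / real (\<Delta> - 1)) * (real (\<Delta> * (\<Delta> - 1)) / M) ^ k"
  using vs(3) M(2)
proof (induction k)
  case 0
  have "list_edges (take (Suc 0) vs) = {}" by (auto simp: list_edges_def)
  then show ?case by simp
next
  case (Suc k)
  let ?F = "list_edges (take (Suc k) vs)" and ?u = "vs ! k" and ?v = "vs ! Suc k"
  let ?c = "\<Delta> * n - (2 * card ?F + 2 + 2 * \<Delta> * (\<Delta> + 1))" and ?N = "real (reg_count \<Delta> n {})"
  note ins = list_edges_take_Suc[OF Suc.prems(1)]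
  have FV: "\<Union>?F \<subseteq> set (take (Suc k) vs)" by (rule list_edges_vertices)
  have vnew: "?v \<notin> set (take (Suc k) vs)"
    using vs(1) Suc.prems by (auto simp: in_set_conv_nth nth_eq_iff_index_eq)
  have "?u \<in> {..<n}" "?v \<in> {..<n}"
    by (rule subsetD[OF vs(2)], rule nth_mem, use Suc.prems in simp)+
  then have lt: "?u < n" "?v < n" by simp_all
  have "{?u, ?v} \<notin> ?F" using FV vnew by auto
  note S = switching[OF lt this, of \<Delta>]
  have cF: "card ?F \<le> k" using card_list_edges(2)[of "take (Suc k) vs"] by simp
  have Mc: "M \<le> real ?c"
  proof -
    have "2 * card ?F + 2 + 2 * \<Delta> * (\<Delta> + 1) \<le> 2 * Suc k + 2 + 2 * \<Delta> * (\<Delta> + 1)"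
      using cF by simp
    then show ?thesis using Suc.prems(2) by linarith
  qed
  have IH: "real (reg_count \<Delta> n ?F) \<le> ?N * (if k = 0 then 1 else real \<Delta> / real (\<Delta> - 1)) * (real (\<Delta> * (\<Delta> - 1)) / M) ^ k"
    using Suc by auto
  have deg: "(\<Delta> - card (star ?F ?u)) * (\<Delta> - card (star ?F ?v)) \<le> (if k = 0 then \<Delta> else \<Delta> - 1) * \<Delta>"
  proof (intro mult_mono)
    show "\<Delta> - card (star ?F ?u) \<le> (if k = 0 then \<Delta> else \<Delta> - 1)"
    proof (cases "k = 0")
      case False
      have "{vs ! (k - 1), vs ! k} \<in> star ?F ?u"
        using False Suc.prems by (auto simp: star_def list_edges_def intro!: exI[of _ "k - 1"])
      then have "0 < card (star ?F ?u)"
        using card_list_edges(1)[of "take (Suc k) vs"] by (auto simp: card_gt_0_iff star_def)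
      then show ?thesis using False by simp
    qed simp
  qed auto
  have "real (reg_count \<Delta> n (insert {?u, ?v} ?F)) * M \<le> real (reg_count \<Delta> n (insert {?u, ?v} ?F)) * real ?c"
    using Mc by (intro mult_left_mono) auto
  also have "\<dots> = real (reg_count \<Delta> n (insert {?u, ?v} ?F) * ?c)" by (simp only: of_nat_mult)
  also have "\<dots> \<le> real (reg_count \<Delta> n ?F * ((if k = 0 then \<Delta> else \<Delta> - 1) * \<Delta>))"
    using order_trans[OF S mult_left_mono[OF deg]] by (simp only: of_nat_le_iff le0)
  also have "\<dots> = real (reg_count \<Delta> n ?F) * real ((if k = 0 then \<Delta> else \<Delta> - 1) * \<Delta>)" by (simp only: of_nat_mult)
  also have "\<dots> \<le> (?N * (if k = 0 then 1 else real \<Delta> / real (\<Delta> - 1)) * (real (\<Delta> * (\<Delta> - 1)) / M) ^ k) *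
      real ((if k = 0 then \<Delta> else \<Delta> - 1) * \<Delta>)"
    using IH by (intro mult_right_mono) auto
  also have "\<dots> = ?N * (real \<Delta> / real (\<Delta> - 1)) * (real (\<Delta> * (\<Delta> - 1)) / M) ^ Suc k * M"
    using \<Delta> M(1) by (auto simp: field_simps)
  finally have "real (reg_count \<Delta> n (insert {?u, ?v} ?F)) * M \<le>
    ?N * (real \<Delta> / real (\<Delta> - 1)) * (real (\<Delta> * (\<Delta> - 1)) / M) ^ Suc k * M" .
  then have "real (reg_count \<Delta> n (insert {?u, ?v} ?F)) \<le>
    ?N * (real \<Delta> / real (\<Delta> - 1)) * (real (\<Delta> * (\<Delta> - 1)) / M) ^ Suc k"
    using M(1) by (rule mult_right_le_imp_le)
  then show ?case unfolding ins by (simp only: nat.distinct if_False)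
qed

text \<open>The edges of \<open>X\<close> may lie anywhere and get the crude factor
  \<open>\<Delta> * \<Delta>\<close>, which is harmless for a bounded number of edges.\<close>

lemma reg_count_path_union:
  fixes n \<Delta> :: nat and M :: real
  assumes \<Delta>: "2 \<le> \<Delta>" and vs: "distinct vs" "set vs \<subseteq> {..<n}" "length vs = Suc t"
    and X: "finite X" "\<forall>e\<in>X. e \<subseteq> {..<n} \<and> card e = 2" "X \<inter> list_edges vs = {}"
    and M: "0 < M" "M \<le> real (\<Delta> * n) - real (2 * (t + card X) + 2 + 2 * \<Delta> * (\<Delta> + 1))"
  shows "real (reg_count \<Delta> n (list_edges vs \<union> X)) \<le>
    real (reg_count \<Delta> n {}) * (real \<Delta> / real (\<Delta> - 1)) * (real (\<Delta> * (\<Delta> - 1)) / M) ^ t * (real (\<Delta> * \<Delta>) / M) ^ card X"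
  using X M(2)
proof (induction X rule: finite_induct)
  case empty
  have "real (reg_count \<Delta> n (list_edges (take (Suc t) vs))) \<le>
    real (reg_count \<Delta> n {}) * (if t = 0 then 1 else real \<Delta> / real (\<Delta> - 1)) * (real (\<Delta> * (\<Delta> - 1)) / M) ^ t"
    using empty vs by (intro reg_count_path \<Delta> M) auto
  also have "\<dots> \<le> real (reg_count \<Delta> n {}) * (real \<Delta> / real (\<Delta> - 1)) * (real (\<Delta> * (\<Delta> - 1)) / M) ^ t"
    using \<Delta> M by (intro mult_right_mono mult_left_mono) (auto simp: field_simps)
  finally show ?case using vs by simp
next
  case (insert e X)
  let ?F = "list_edges vs \<union> X"
  let ?c = "\<Delta> * n - (2 * card ?F + 2 + 2 * \<Delta> * (\<Delta> + 1))" and ?N = "real (reg_count \<Delta> n {})"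
  let ?R = "?N * (real \<Delta> / real (\<Delta> - 1)) * (real (\<Delta> * (\<Delta> - 1)) / M) ^ t"
  obtain u v where e: "e = {u, v}" "u < n" "v < n" using insert.prems by (auto simp: card_2_iff)
  have "{u, v} \<notin> ?F" using insert e by auto
  note S = switching[OF e(2,3) this, of \<Delta>]
  have "card ?F \<le> t + card X"
    using card_Un_le[of "list_edges vs" X] card_list_edges(2)[of vs] vs(3) by simp
  then have "2 * card ?F + 2 + 2 * \<Delta> * (\<Delta> + 1) \<le> 2 * (t + card (insert e X)) + 2 + 2 * \<Delta> * (\<Delta> + 1)"
    using insert by simp
  then have Mc: "M \<le> real ?c" using insert.prems(3) by linarith
  have IH: "real (reg_count \<Delta> n ?F) \<le> ?R * (real (\<Delta> * \<Delta>) / M) ^ card X"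
    using insert by auto
  have "real (reg_count \<Delta> n (insert {u, v} ?F)) * M \<le> real (reg_count \<Delta> n (insert {u, v} ?F)) * real ?c"
    using Mc by (intro mult_left_mono) auto
  also have "\<dots> = real (reg_count \<Delta> n (insert {u, v} ?F) * ?c)" by (simp only: of_nat_mult)
  also have "\<dots> \<le> real (reg_count \<Delta> n ?F * (\<Delta> * \<Delta>))"
  proof -
    have "(\<Delta> - card (star ?F u)) * (\<Delta> - card (star ?F v)) \<le> \<Delta> * \<Delta>" by (intro mult_mono) auto
    then show ?thesis using order_trans[OF S mult_left_mono] by (simp only: of_nat_le_iff le0)
  qed
  also have "\<dots> = real (reg_count \<Delta> n ?F) * real (\<Delta> * \<Delta>)" by (simp only: of_nat_mult)
  also have "\<dots> \<le> (?R * (real (\<Delta> * \<Delta>) / M) ^ card X) * real (\<Delta> * \<Delta>)"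
    using IH by (intro mult_right_mono) auto
  finally have "real (reg_count \<Delta> n (insert {u, v} ?F)) \<le> ?R * (real (\<Delta> * \<Delta>) / M) ^ card X * real (\<Delta> * \<Delta>) / M"
    using M(1) by (simp only: pos_le_divide_eq)
  also have "\<dots> = ?R * (real (\<Delta> * \<Delta>) / M) ^ card (insert e X)"
    using insert by simp
  finally show ?case using e by simp
qed

section \<open>Intersecting short cycles\<close>

lemma list_edges_simps [simp]:
  "list_edges [] = {}" "list_edges [x] = {}"
  "list_edges (x # y # zs) = insert {x, y} (list_edges (y # zs))"
proof -
  show "list_edges [] = {}" "list_edges [x] = {}" by (auto simp: list_edges_def)
  have "{..<length (x # y # zs) - 1} = insert 0 (Suc ` {..<length (y # zs) - 1})"
    by (simp add: lessThan_Suc_eq_insert_0)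
  then show "list_edges (x # y # zs) = insert {x, y} (list_edges (y # zs))"
    unfolding list_edges_image by (simp add: image_image)
qed

lemma list_edges_append:
  "xs \<noteq> [] \<Longrightarrow> ys \<noteq> [] \<Longrightarrow>
     list_edges (xs @ ys) = insert {last xs, hd ys} (list_edges xs \<union> list_edges ys)"
proof (induction xs rule: induct_list012)
  case (2 x)
  then show ?case by (cases ys) auto
next
  case (3 x y zs)
  then show ?case by auto
qed simp

lemma cycle_edges_rotate: "cycle_edges (xs @ ys) = cycle_edges (ys @ xs)"
proof (cases "xs = [] \<or> ys = []")
  case False
  then show ?thesis by (simp add: cycle_edges_eq list_edges_append insert_commute Un_commute)
qed auto

lemma is_cycle_rotate: "is_cycle E (xs @ ys) \<longleftrightarrow> is_cycle E (ys @ xs)"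
  by (auto simp: is_cycle_def cycle_edges_rotate[of xs ys])

lemma path_in_rev: "path_in E (rev xs) \<longleftrightarrow> path_in E xs"
  by (auto simp: path_in_def insert_commute)

lemma is_cycle_rev: "is_cycle E xs \<Longrightarrow> is_cycle E (rev xs)"
  by (cases "xs = []") (auto simp: is_cycle_iff path_in_rev hd_rev last_rev insert_commute)

lemma cycle_through_edge:
  assumes c: "is_cycle E c" and e: "{u, w} \<in> cycle_edges c"
  shows "\<exists>c'. is_cycle E c' \<and> hd c' = w \<and> last c' = u \<and> set c' = set c \<and> length c' = length c"
proof -
  obtain i where i: "i < length c" "{u, w} = {c ! i, c ! (Suc i mod length c)}"
    using e by (auto simp: cycle_edges_def)
  let ?c = "drop (Suc i) c @ take (Suc i) c"
  have c': "is_cycle E ?c" using c is_cycle_rotate[of E "drop (Suc i) c" "take (Suc i) c"] by simp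
  have last: "last ?c = c ! i" using i by (simp add: take_Suc_conv_app_nth)
  have hd: "hd ?c = c ! (Suc i mod length c)"
  proof (cases "Suc i < length c")
    case True
    then show ?thesis by (simp add: hd_drop_conv_nth)
  next
    case False
    then have "Suc i = length c" using i by simp
    moreover have "c \<noteq> []" using i by auto
    ultimately show ?thesis by (simp add: hd_conv_nth)
  qed
  have set: "set ?c = set c" "length ?c = length c"
  proof -
    have "set (take (Suc i) c) \<union> set (drop (Suc i) c) = set c" by (metis append_take_drop_id set_append)
    then show "set ?c = set c" by auto
    show "length ?c = length c" by simp
  qed
  have ne: "?c \<noteq> []" using i by auto
  from i(2) consider "u = c ! i" "w = c ! (Suc i mod length c)"
    | "w = c ! i" "u = c ! (Suc i mod length c)" by (auto simp: doubleton_eq_iff)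
  then show ?thesis
  proof cases
    case 1
    then show ?thesis using c' last hd set by (intro exI[of _ ?c]) simp
  next
    case 2
    have "hd (rev ?c) = w" "last (rev ?c) = u" using last hd 2 ne by (simp_all only: hd_rev last_rev)
    then show ?thesis using is_cycle_rev[OF c'] set by (intro exI[of _ "rev ?c"]) (simp only: set_rev length_rev)
  qed
qed

lemma cycle_ending_at:
  assumes c: "is_cycle E c" and u: "u \<in> set c"
  shows "\<exists>c'. is_cycle E c' \<and> last c' = u \<and> set c' = set c \<and> length c' = length c \<and>
    cycle_edges c' = cycle_edges c"
proof -
  obtain xs ys where "c = (xs @ [u]) @ ys" using u by (auto simp: in_set_conv_decomp)
  then show ?thesis
    using c is_cycle_rotate[of E "xs @ [u]" ys] cycle_edges_rotate[of "xs @ [u]" ys]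
    by (intro exI[of _ "ys @ xs @ [u]"]) auto
qed

lemma not_list_edge:
  assumes "distinct P" "Suc i < j" "j < length P"
  shows "{P ! i, P ! j} \<notin> list_edges P"
proof
  assume "{P ! i, P ! j} \<in> list_edges P"
  then obtain k where k: "Suc k < length P" "{P ! i, P ! j} = {P ! k, P ! Suc k}"
    by (auto simp: list_edges_def)
  then have "P ! i = P ! k \<and> P ! j = P ! Suc k \<or> P ! i = P ! Suc k \<and> P ! j = P ! k"
    by (auto simp: doubleton_eq_iff)
  then have "i = k \<and> j = Suc k \<or> i = Suc k \<and> j = k"
    using assms k(1) by (simp add: nth_eq_iff_index_eq)
  then show False using assms by auto
qed

lemma two_chords_not_sparse:
  assumes "{f, g} \<subseteq> E - list_edges P" "f \<noteq> g" "f \<union> g \<subseteq> set P"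
  shows "\<not> sparse_along E P 2 2"
proof
  assume s: "sparse_along E P 2 2"
  have "\<Union>{f, g} - set P = {}" using assms by auto
  moreover have "card {f, g} = 2" using assms by simp
  moreover have "card {f, g} \<le> 2 \<longrightarrow> card {f, g} < card (\<Union>{f, g} - set P) + 2"
    using s assms(1) unfolding sparse_along_def by blast
  ultimately show False by (metis add_0 card.empty less_irrefl order_refl)
qed

text \<open>Cut open at one edge, the cycle is a path; that edge and the chord are two surplus edges
  without new vertices.\<close>

lemma cycle_with_chord:
  assumes c: "is_cycle E c" and f: "f \<in> E" "f \<subseteq> set c" "f \<notin> cycle_edges c"
  shows "path_in E c \<and> \<not> sparse_along E c 2 2"
proof
  have ne: "c \<noteq> []" and p: "path_in E c" and l: "3 \<le> length c" and e: "{last c, hd c} \<in> E"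
    using c by (auto simp: is_cycle_iff path_in_def)
  show "path_in E c" by fact
  have "{c ! 0, c ! (length c - 1)} \<notin> list_edges c"
    using p l by (intro not_list_edge) (auto simp: path_in_def)
  then have n: "{last c, hd c} \<notin> list_edges c"
    using ne by (simp add: hd_conv_nth last_conv_nth insert_commute)
  show "\<not> sparse_along E c 2 2"
  proof (rule two_chords_not_sparse)
    show "{f, {last c, hd c}} \<subseteq> E - list_edges c" using f n e ne by (auto simp: cycle_edges_eq)
    show "f \<noteq> {last c, hd c}" using f(3) ne by (auto simp: cycle_edges_eq)
    show "f \<union> {last c, hd c} \<subseteq> set c" using f ne by auto
  qed
qed

text \<open>The path runs around the cycle and on through the ear. Surplus are the closing edge of
  the cycle and the edge by which the ear returns. If the ear returns to \<open>u\<close>, it needs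
  two vertices, as otherwise this edge would be the one by which it started.\<close>

lemma cycle_with_ear:
  assumes c: "is_cycle E c" and ws: "path_in E ws" "set ws \<inter> set c = {}"
    and u: "last c = u" "{u, hd ws} \<in> E" and u': "u' \<in> set c" "{last ws, u'} \<in> E"
    and nontriv: "u' = u \<Longrightarrow> 2 \<le> length ws"
  shows "path_in E (c @ ws) \<and> \<not> sparse_along E (c @ ws) 2 2"
proof
  let ?P = "c @ ws" and ?t = "length (c @ ws) - 1" and ?m = "length c"
  have ne: "c \<noteq> []" "ws \<noteq> []" and p: "path_in E c" and l: "3 \<le> length c" and e: "{last c, hd c} \<in> E"
    using c ws by (auto simp: is_cycle_iff path_in_def)
  show P: "path_in E ?P"
    using p ws u ne by (auto simp: path_in_def successively_append_iff)
  then have d: "distinct ?P" by (simp add: path_in_def)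
  have "{?P ! 0, ?P ! (?m - 1)} \<notin> list_edges ?P"
    using l d by (intro not_list_edge) auto
  then have n1: "{last c, hd c} \<notin> list_edges ?P"
    using ne by (simp add: hd_conv_nth last_conv_nth insert_commute nth_append)
  obtain j where j: "j < ?m" "u' = c ! j" using u' by (auto simp: in_set_conv_nth)
  have "Suc j < ?t"
  proof (cases "j = ?m - 1")
    case True
    then have "u' = u" using j u ne by (simp add: last_conv_nth)
    then show ?thesis using nontriv True l by simp
  next
    case False
    then show ?thesis using j ne by (cases ws) auto
  qed
  then have "{?P ! j, ?P ! ?t} \<notin> list_edges ?P"
    using ne d by (intro not_list_edge) auto
  moreover have "?P ! j = u'" using j by (simp add: nth_append)
  moreover have "?P ! ?t = last ws" using ne last_conv_nth[of ?P] by simp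
  ultimately have n2: "{last ws, u'} \<notin> list_edges ?P" by (metis insert_commute)
  have lw: "last ws \<notin> set c" using ws(2) last_in_set[OF ne(2)] by auto
  show "\<not> sparse_along E ?P 2 2"
  proof (rule two_chords_not_sparse)
    show "{{last c, hd c}, {last ws, u'}} \<subseteq> E - list_edges ?P" using n1 n2 e u' by simp
    show "{last c, hd c} \<noteq> {last ws, u'}" using lw ne by (metis insertI1 insert_iff last_in_set hd_in_set singletonD)
    show "{last c, hd c} \<union> {last ws, u'} \<subseteq> set ?P" using ne u' by auto
  qed
qed

text \<open>The second cycle leaves the first at \<open>u\<close>; followed from \<open>w\<close> up
  to its first return, it is the ear.\<close>

lemma two_cycles_not_sparse:
  assumes c1: "is_cycle E c1" and c2: "is_cycle E c2" and uw: "{u, w} \<in> cycle_edges c2"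
    and u: "u \<in> set c1" and w: "w \<notin> set c1"
  shows "\<exists>vs. path_in E vs \<and> 2 \<le> length vs \<and> length vs \<le> length c1 + length c2 \<and> \<not> sparse_along E vs 2 2"
proof -
  obtain c where c: "is_cycle E c" "last c = u" "set c = set c1" "length c = length c1"
    using cycle_ending_at[OF c1 u] by auto
  obtain b where b: "is_cycle E b" "hd b = w" "last b = u" "length b = length c2"
    using cycle_through_edge[OF c2 uw] by auto
  have pb: "path_in E b" "b \<noteq> []" "3 \<le> length b" using b by (auto simp: is_cycle_iff path_in_def)
  have "\<exists>z\<in>set b. z \<in> set c" using b(3) pb u c(3) last_in_set by metis
  then obtain ws u' rest where ws: "b = ws @ u' # rest" "u' \<in> set c" "\<forall>z\<in>set ws. z \<notin> set c"
    using split_list_first_prop[of b "\<lambda>z. z \<in> set c"] by blast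
  have ne: "ws \<noteq> []" using ws b(2) w c(3) by (cases ws) auto
  have pw: "path_in E ws" using path_in_append1[of E ws "u' # rest"] pb ne ws(1) by simp
  have e2: "{last ws, u'} \<in> E" using pb(1) ne unfolding ws(1) path_in_def
    by (simp add: successively_append_iff)
  have "hd ws = w" using ws(1) b(2) ne by simp
  moreover have "{last b, hd b} \<in> E" using b(1) by (simp add: is_cycle_iff)
  ultimately have e1: "{u, hd ws} \<in> E" using b by simp
  have "path_in E (c @ ws) \<and> \<not> sparse_along E (c @ ws) 2 2"
  proof (rule cycle_with_ear[OF c(1) pw _ c(2) e1 ws(2) e2])
    show "set ws \<inter> set c = {}" using ws(3) by auto
    \<comment> \<open>\<open>u\<close> is the last vertex of \<open>b\<close>, so an ear returning
      only there contains all of \<open>b\<close> but one vertex.\<close>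
    assume "u' = u"
    then have "rest = []" using pb(1) b(3) unfolding ws(1) path_in_def
      by (cases rest rule: rev_cases) auto
    then show "2 \<le> length ws" using pb(3) ws(1) by simp
  qed
  moreover have "length (c @ ws) \<le> length c1 + length c2" using c(4) b(4) ws(1) by simp
  moreover have "2 \<le> length (c @ ws)" using c(1) by (simp add: is_cycle_def)
  ultimately show ?thesis by blast
qed

text \<open>A component with more than one vertex contains a short cycle. If the cycle spans the
  component, some further edge is a chord; otherwise an edge leaves the cycle and lies on another
  short cycle. Either way surplus 2 occurs along a path of at most twice the short length.\<close>

lemma fail_imp_not_sparse:
  assumes G: "graph_on V E" and E': "E' = short_cycle_edges \<Delta> V E"
    and C: "C \<in> graph_components V E'" "\<not> component_is_cycle E' C" "\<nexists>v. C = {v}"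
  shows "\<exists>vs. path_in E vs \<and> 2 \<le> length vs \<and> real (length vs) \<le> 2 / 5 * log (real \<Delta> - 1) (real (card V)) \<and>
    \<not> sparse_along E vs 2 2"
proof -
  let ?L = "1 / 5 * log (real \<Delta> - 1) (real (card V))"
  have E'D: "\<exists>c. is_cycle E c \<and> e \<in> cycle_edges c \<and> real (length c) \<le> ?L" "e \<in> E" if "e \<in> E'" for e
    using that unfolding E' short_cycle_edges_def by auto
  have E'I: "cycle_edges c \<subseteq> E'" if "is_cycle E c" "real (length c) \<le> ?L" for c
    using that unfolding E' short_cycle_edges_def by (auto simp: is_cycle_def)
  obtain x where x: "x \<in> V" "C = comp_of V E' x" using C(1) by (auto simp: graph_components_eq)
  have "x \<in> C" using x by (simp add: comp_of_def)
  then obtain y where y: "y \<in> C" "y \<noteq> x" using C(3) by blast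
  have "(x, y) \<in> link E'" using y x by (simp add: comp_of_def)
  then obtain xs where xs: "path_in E' xs" "hd xs = x" "last xs = y" using link_imp_path by metis
  obtain x2 zs where xs2: "xs = x # x2 # zs"
    using xs y(2) by (cases xs; cases "tl xs") (auto simp: path_in_def)
  then have "{x, x2} \<in> E'" using xs(1) by (simp add: path_in_def)
  then obtain c1 where c1: "is_cycle E c1" "{x, x2} \<in> cycle_edges c1" "real (length c1) \<le> ?L"
    using E'D by blast
  have c1E': "is_cycle E' c1" using c1 E'I[OF c1(1,3)] by (auto simp: is_cycle_def)
  have ne1: "c1 \<noteq> []" using c1 by (auto simp: is_cycle_def)
  have ce: "\<Union>(cycle_edges c1) \<subseteq> set c1"
    unfolding cycle_edges_eq[OF ne1] using list_edges_vertices[of c1] ne1 by auto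
  have xc1: "x \<in> set c1" using ce c1(2) by auto
  have linked: "(x, z) \<in> link E'" if z: "z \<in> set c1" for z
  proof -
    obtain c where c: "is_cycle E' c" "last c = x" "set c = set c1"
      using cycle_ending_at[OF c1E' xc1] by auto
    have "z \<in> set c" using z c(3) by simp
    then obtain us vs where us: "c = us @ z # vs" by (auto simp: in_set_conv_decomp)
    have "path_in E' (z # vs)" using c(1) us
      by (auto simp: is_cycle_iff path_in_def successively_append_iff)
    then have "(z, x) \<in> link E'" using path_imp_link[of E' "z # vs"] c(2) us by simp
    then show ?thesis by (rule link_sym)
  qed
  have "set c1 \<subseteq> V" using path_in_vertices[OF G] c1(1) by (auto simp: is_cycle_iff)
  then have subC: "set c1 \<subseteq> C" using linked x by (auto simp: comp_of_def)
  show ?thesis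
  proof (cases "set c1 = C")
    case True
    have "cycle_edges c1 \<subseteq> {e \<in> E'. e \<subseteq> C}" using E'I[OF c1(1,3)] ce True by auto
    moreover have "{e \<in> E'. e \<subseteq> C} \<noteq> cycle_edges c1"
      using C(2) c1E' True unfolding component_is_cycle_def by blast
    ultimately obtain f where f: "f \<in> E'" "f \<subseteq> set c1" "f \<notin> cycle_edges c1" using True by blast
    have "path_in E c1 \<and> \<not> sparse_along E c1 2 2"
      using cycle_with_chord[OF c1(1) _ f(2,3)] E'D(2)[OF f(1)] by simp
    moreover have "0 \<le> ?L" using c1(3) of_nat_0_le_iff order_trans by blast
    moreover have "2 \<le> length c1" using c1(1) by (simp add: is_cycle_def)
    ultimately show ?thesis using c1(3) by (intro exI[of _ c1]) simp
  next
    case False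
    then obtain z where z: "z \<in> C" "z \<notin> set c1" using subC by auto
    have "(x, z) \<in> link E'" using z x by (simp add: comp_of_def)
    then have "z \<in> set c1 \<or> (\<exists>u w. u \<in> set c1 \<and> w \<notin> set c1 \<and> {u, w} \<in> E')"
      by (induction rule: link_induct) (use xc1 in blast)+
    then obtain u w where uw: "u \<in> set c1" "w \<notin> set c1" "{u, w} \<in> E'" using z by auto
    obtain c2 where c2: "is_cycle E c2" "{u, w} \<in> cycle_edges c2" "real (length c2) \<le> ?L"
      using E'D[OF uw(3)] by blast
    obtain vs where vs: "path_in E vs" "2 \<le> length vs" "length vs \<le> length c1 + length c2" "\<not> sparse_along E vs 2 2"
      using two_cycles_not_sparse[OF c1(1) c2(1,2) uw(1,2)] by blast
    have "real (length vs) \<le> real (length c1) + real (length c2)" using vs(3) by linarith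
    then show ?thesis using vs c1(3) c2(3) by (intro exI[of _ vs]) simp
  qed
qed

section \<open>Existence of regular graphs\<close>

text \<open>A circulant graph: since the set of shifts is closed under
  \<open>s \<mapsto> n - s\<close>, the edges at \<open>v\<close> are exactly those to
  \<open>v + s\<close> modulo \<open>n\<close> with \<open>s\<close> in \<open>S\<close>.\<close>

lemma circulant_regular:
  assumes S: "S \<subseteq> {1..<n}" "\<forall>s\<in>S. n - s \<in> S" "card S = \<Delta>"
  shows "regular_graphs \<Delta> n \<noteq> {}"
proof -
  define E where "E = {{v, (v + s) mod n} | v s. v < n \<and> s \<in> S}"
  have md: "(v + s) mod n = (if v + s < n then v + s else v + s - n)" if "v < n" "s < n" for v s
    using that by (simp add: le_mod_geq)
  have lt: "0 < s" "s < n" if "s \<in> S" for s using S(1) that by auto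
  have ne: "v \<noteq> (v + s) mod n" if "v < n" "s \<in> S" for v s
    using md[OF that(1) lt(2)[OF that(2)]] lt[OF that(2)] that by auto
  have "e \<subseteq> {..<n} \<and> card e = 2" if eE: "e \<in> E" for e
  proof -
    obtain v s where e: "e = {v, (v + s) mod n}" "v < n" "s \<in> S" using eE by (auto simp: E_def)
    then show ?thesis using ne[of v s] by auto
  qed
  moreover have "card {e \<in> E. v \<in> e} = \<Delta>" if v: "v < n" for v
  proof -
    have "{e \<in> E. v \<in> e} = (\<lambda>s. {v, (v + s) mod n}) ` S"
    proof (intro equalityI subsetI)
      fix e assume e: "e \<in> {e \<in> E. v \<in> e}"
      then obtain v' s where vs: "e = {v', (v' + s) mod n}" "v' < n" "s \<in> S" by (auto simp: E_def)
      show "e \<in> (\<lambda>s. {v, (v + s) mod n}) ` S"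
      proof (cases "v = v'")
        case True
        then show ?thesis using vs by auto
      next
        case False
        then have v2: "v = (v' + s) mod n" using e vs by auto
        have "(v + (n - s)) mod n = v'"
          using md[OF vs(2) lt(2)[OF vs(3)]] md[OF v, of "n - s"] lt[OF vs(3)] v2 vs(2)
          by (auto split: if_splits)
        then have "e = {v, (v + (n - s)) mod n}" using vs v2 by auto
        then show ?thesis using S(2) vs(3) by auto
      qed
    next
      fix e assume "e \<in> (\<lambda>s. {v, (v + s) mod n}) ` S"
      then show "e \<in> {e \<in> E. v \<in> e}" using v by (auto simp: E_def)
    qed
    moreover have "inj_on (\<lambda>s. {v, (v + s) mod n}) S"
    proof (rule inj_onI)
      fix s t assume st: "s \<in> S" "t \<in> S" "{v, (v + s) mod n} = {v, (v + t) mod n}"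
      then have "(v + s) mod n = (v + t) mod n" using ne[OF v] by (auto simp: doubleton_eq_iff)
      then show "s = t"
        using md[OF v lt(2)[OF st(1)]] md[OF v lt(2)[OF st(2)]] lt[OF st(1)] lt[OF st(2)]
        by (auto split: if_splits)
    qed
    ultimately show ?thesis using S(3) by (simp add: card_image)
  qed
  ultimately have "E \<in> regular_graphs \<Delta> n" unfolding regular_graphs_def by blast
  then show ?thesis by auto
qed

text \<open>\<open>pmf_of_set\<close> is uniform only on a nonempty set. For even
  \<open>\<Delta>\<close> take the shifts up to \<open>\<Delta> / 2\<close> in both directions; for
  odd \<open>\<Delta>\<close> the number \<open>n\<close> is even, and the shift by
  \<open>n / 2\<close> is added.\<close>

lemma regular_graphs_nonempty:
  assumes even: "even (\<Delta> * n)" and n: "\<Delta> + 1 < n"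
  shows "regular_graphs \<Delta> n \<noteq> {}"
proof (cases "even \<Delta>")
  case True
  then obtain a where a: "\<Delta> = 2 * a" by blast
  show ?thesis
  proof (rule circulant_regular)
    let ?S = "{1..a} \<union> {n - a..<n}"
    show "?S \<subseteq> {1..<n}" "\<forall>s\<in>?S. n - s \<in> ?S" using n a by auto
    have "card ?S = card {1..a} + card {n - a..<n}"
      using n a by (intro card_Un_disjoint) auto
    then show "card ?S = \<Delta>" using n a by simp
  qed
next
  case False
  then obtain a where a: "\<Delta> = 2 * a + 1" by (rule oddE)
  obtain b where b: "n = 2 * b" using even False by auto
  show ?thesis
  proof (rule circulant_regular)
    let ?S = "insert b ({1..a} \<union> {n - a..<n})"
    show "?S \<subseteq> {1..<n}" "\<forall>s\<in>?S. n - s \<in> ?S" using n a b by auto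
    have "card ({1..a} \<union> {n - a..<n}) = card {1..a} + card {n - a..<n}"
      using n a by (intro card_Un_disjoint) auto
    moreover have "b \<notin> {1..a} \<union> {n - a..<n}" using n a b by auto
    ultimately show "card ?S = \<Delta>" using n a by simp
  qed
qed

section \<open>First moments\<close>

abbreviation rprob :: "nat \<Rightarrow> nat \<Rightarrow> nat set set set \<Rightarrow> real" where
  "rprob \<Delta> n \<equiv> measure_pmf.prob (random_regular_graph \<Delta> n)"

lemma prob_random_regular:
  assumes "regular_graphs \<Delta> n \<noteq> {}"
  shows "rprob \<Delta> n A =
    real (card (regular_graphs \<Delta> n \<inter> A)) / real (card (regular_graphs \<Delta> n))"
  unfolding random_regular_graph_def using assms finite_regular_graphs by (simp add: measure_pmf_of_set)

lemma prob_contains: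
  assumes "regular_graphs \<Delta> n \<noteq> {}"
  shows "rprob \<Delta> n {E. F \<subseteq> E} =
    real (reg_count \<Delta> n F) / real (reg_count \<Delta> n {})"
proof -
  have "regular_graphs \<Delta> n \<inter> {E. F \<subseteq> E} = {E \<in> regular_graphs \<Delta> n. F \<subseteq> E}" by auto
  then show ?thesis unfolding prob_random_regular[OF assms] reg_count_def by simp
qed

lemma set_random_regular:
  assumes "regular_graphs \<Delta> n \<noteq> {}"
  shows "set_pmf (random_regular_graph \<Delta> n) = regular_graphs \<Delta> n"
  unfolding random_regular_graph_def using assms finite_regular_graphs by simp

text \<open>With \<open>s\<close> prescribed edges, each graph admits at least \<open>\<Delta> n / \<eta>\<close> switchings.\<close>

definition ample :: "nat \<Rightarrow> real \<Rightarrow> nat \<Rightarrow> nat \<Rightarrow> bool" where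
  "ample \<Delta> \<eta> s n \<longleftrightarrow> 0 < n \<and> regular_graphs \<Delta> n \<noteq> {} \<and>
     real (\<Delta> * n) / \<eta> \<le> real (\<Delta> * n) - real (2 * s + 2 + 2 * \<Delta> * (\<Delta> + 1))"

text \<open>The constant 2 bounds \<open>\<Delta> / (\<Delta> - 1)\<close>, and the loss
  \<open>\<eta>\<close> per edge accounts for the excluded switchings.\<close>

lemma prob_path_union:
  assumes \<Delta>: "2 \<le> \<Delta>" and \<eta>: "0 < \<eta>" and vs: "distinct vs" "set vs \<subseteq> {..<n}" "length vs = Suc t"
    and X: "finite X" "X \<inter> list_edges vs = {}" and s: "t + card X \<le> s" and n: "ample \<Delta> \<eta> s n"
  shows "rprob \<Delta> n {E. list_edges vs \<union> X \<subseteq> E} \<le>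
    2 * (real (\<Delta> - 1) * \<eta> / real n) ^ t * (real \<Delta> * \<eta> / real n) ^ card X"
proof (cases "\<forall>e\<in>X. e \<subseteq> {..<n} \<and> card e = 2")
  case True
  let ?M = "real (\<Delta> * n) / \<eta>"
  have n0: "0 < n" and ne: "regular_graphs \<Delta> n \<noteq> {}" using n by (auto simp: ample_def)
  have M: "0 < ?M" using \<Delta> \<eta> n0 by auto
  have "?M \<le> real (\<Delta> * n) - real (2 * s + 2 + 2 * \<Delta> * (\<Delta> + 1))" using n by (simp add: ample_def)
  also have "\<dots> \<le> real (\<Delta> * n) - real (2 * (t + card X) + 2 + 2 * \<Delta> * (\<Delta> + 1))"
  proof -
    have "2 * (t + card X) + 2 + 2 * \<Delta> * (\<Delta> + 1) \<le> 2 * s + 2 + 2 * \<Delta> * (\<Delta> + 1)" using s by simp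
    then have "real (2 * (t + card X) + 2 + 2 * \<Delta> * (\<Delta> + 1)) \<le> real (2 * s + 2 + 2 * \<Delta> * (\<Delta> + 1))"
      by (simp only: of_nat_le_iff)
    then show ?thesis by (rule diff_left_mono)
  qed
  finally have M2: "?M \<le> real (\<Delta> * n) - real (2 * (t + card X) + 2 + 2 * \<Delta> * (\<Delta> + 1))" .
  have N: "0 < reg_count \<Delta> n {}" unfolding reg_count_def using ne finite_regular_graphs
    by (simp add: card_gt_0_iff)
  have e1: "real (\<Delta> * (\<Delta> - 1)) / ?M = real (\<Delta> - 1) * \<eta> / real n"
    "real (\<Delta> * \<Delta>) / ?M = real \<Delta> * \<eta> / real n"
    using \<Delta> \<eta> n0 by (simp_all add: field_simps)
  have "real (reg_count \<Delta> n (list_edges vs \<union> X)) \<le> real (reg_count \<Delta> n {}) *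
      (real \<Delta> / real (\<Delta> - 1)) * (real (\<Delta> - 1) * \<eta> / real n) ^ t * (real \<Delta> * \<eta> / real n) ^ card X"
    using reg_count_path_union[OF \<Delta> vs X(1) True X(2) M M2] unfolding e1 .
  then have "rprob \<Delta> n {E. list_edges vs \<union> X \<subseteq> E} \<le>
      (real \<Delta> / real (\<Delta> - 1)) * (real (\<Delta> - 1) * \<eta> / real n) ^ t * (real \<Delta> * \<eta> / real n) ^ card X"
    unfolding prob_contains[OF ne] using N by (simp only: pos_divide_le_eq of_nat_0_less_iff mult_ac)
  also have "\<dots> \<le> 2 * (real (\<Delta> - 1) * \<eta> / real n) ^ t * (real \<Delta> * \<eta> / real n) ^ card X"
    using \<Delta> \<eta> by (intro mult_right_mono) (auto simp: field_simps)
  finally show ?thesis .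
next
  \<comment> \<open>Some member of \<open>X\<close> is no edge on \<open>{..<n}\<close>, so no
    regular graph contains \<open>X\<close>.\<close>
  case False
  have ne: "regular_graphs \<Delta> n \<noteq> {}" using n by (auto simp: ample_def)
  have "regular_graphs \<Delta> n \<inter> {E. list_edges vs \<union> X \<subseteq> E} = {}"
    using False by (auto simp: regular_graphs_def)
  then have "rprob \<Delta> n {E. list_edges vs \<union> X \<subseteq> E} = 0"
    unfolding prob_random_regular[OF ne] by (simp only: card.empty of_nat_0 div_0)
  moreover have "0 \<le> 2 * (real (\<Delta> - 1) * \<eta> / real n) ^ t * (real \<Delta> * \<eta> / real n) ^ card X"
    using \<eta> by simp
  ultimately show ?thesis by (simp only:)
qed

lemma prob_UN_le:
  assumes "finite I" "\<And>i. i \<in> I \<Longrightarrow> measure_pmf.prob M (A i) \<le> b"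
  shows "measure_pmf.prob M (\<Union>i\<in>I. A i) \<le> real (card I) * b"
proof -
  have "measure_pmf.prob M (\<Union>i\<in>I. A i) \<le> (\<Sum>i\<in>I. measure_pmf.prob M (A i))"
    using assms(1) by (rule measure_UNION_le) auto
  also have "\<dots> \<le> real (card I) * b" using assms(2) by (rule sum_bounded_above)
  finally show ?thesis .
qed

text \<open>A one-vertex list is a path in every edge set, whatever its vertex; from two vertices
  on, the path lies in the graph. \<open>Suc T\<close> vertices mean \<open>T\<close> edges.\<close>

definition dense_path :: "nat \<Rightarrow> nat \<Rightarrow> nat \<Rightarrow> nat set set \<Rightarrow> bool" where
  "dense_path T D m E \<longleftrightarrow> (\<exists>vs. path_in E vs \<and> 2 \<le> length vs \<and> length vs \<le> Suc T \<and> \<not> sparse_along E vs D m)"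

definition extra :: "nat list \<Rightarrow> (nat \<times> nat) list \<Rightarrow> nat set set" where
  "extra zs js = (\<lambda>(i, j). {zs ! i, zs ! j}) ` set js"

text \<open>The superfluous edges are coded by pairs of positions in the list of the vertices involved.\<close>

lemma extra_code:
  assumes X: "finite X" "\<forall>e\<in>X. card e = 2" "\<Union>X \<subseteq> set zs"
  shows "\<exists>js. length js = card X \<and> set js \<subseteq> {..<length zs} \<times> {..<length zs} \<and> extra zs js = X"
proof -
  obtain es where es: "set es = X" "length es = card X"
    using finite_distinct_list[OF X(1)] distinct_card by metis
  have "\<exists>ij. ij \<in> {..<length zs} \<times> {..<length zs} \<and> {zs ! fst ij, zs ! snd ij} = e" if e: "e \<in> X" for e
  proof -
    have "card e = 2" using X(2) e by blast
    then obtain a b where ab: "e = {a, b}" by (auto simp: card_2_iff)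
    then have "a \<in> set zs" "b \<in> set zs" using X(3) e by auto
    then obtain i j where "i < length zs" "zs ! i = a" "j < length zs" "zs ! j = b"
      by (auto simp: in_set_conv_nth)
    then show ?thesis using ab by (intro exI[of _ "(i, j)"]) auto
  qed
  then obtain c where c: "\<And>e. e \<in> X \<Longrightarrow> c e \<in> {..<length zs} \<times> {..<length zs} \<and> {zs ! fst (c e), zs ! snd (c e)} = e"
    by metis
  have "extra zs (map c es) = X"
    unfolding extra_def case_prod_beta using c es(1) by (auto simp: image_image)
  moreover have "set (map c es) \<subseteq> {..<length zs} \<times> {..<length zs}"
  proof
    fix z assume "z \<in> set (map c es)"
    then obtain e where "e \<in> X" "z = c e" using es(1) by auto
    then show "z \<in> {..<length zs} \<times> {..<length zs}" using c by blast
  qed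
  ultimately show ?thesis using es(2) by (intro exI[of _ "map c es"]) simp
qed

text \<open>The path has \<open>t + 1\<close> vertices and \<open>t\<close> edges, and there are
  \<open>x\<close> extra edges on \<open>y\<close> further vertices. So \<open>n\<close> occurs with
  the exponent \<open>1 + y - x\<close>, at most \<open>1 - m\<close>. The power
  \<open>2 * D\<close> counts codes, with two positions per extra edge.\<close>

lemma prob_dense_fixed:
  assumes \<Delta>: "2 \<le> \<Delta>" and \<eta>: "1 \<le> \<eta>" and n: "ample \<Delta> \<eta> (T + D) n"
    and t: "1 \<le> t" "t \<le> T" and x: "x \<le> D" "y + m \<le> x"
  shows "rprob \<Delta> n
     (\<Union>(vs, ys, js)\<in>{vs. set vs \<subseteq> {..<n} \<and> length vs = Suc t} \<times> {ys. set ys \<subseteq> {..<n} \<and> length ys = y} \<times>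
         {js. set js \<subseteq> {..<Suc t + y} \<times> {..<Suc t + y} \<and> length js = x}.
       {E. distinct vs \<and> extra (vs @ ys) js \<inter> list_edges vs = {} \<and> card (extra (vs @ ys) js) = x \<and>
           list_edges vs \<union> extra (vs @ ys) js \<subseteq> E})
    \<le> 2 * (real (\<Delta> - 1) * \<eta>) ^ T * (real \<Delta> * \<eta>) ^ D * real (Suc T + D) ^ (2 * D) * (real n / real n ^ m)"
proof -
  let ?I1 = "{vs. set vs \<subseteq> {..<n} \<and> length vs = Suc t}" and ?I2 = "{ys. set ys \<subseteq> {..<n} \<and> length ys = y}"
    and ?I3 = "{js. set js \<subseteq> {..<Suc t + y} \<times> {..<Suc t + y} \<and> length js = x}"
  let ?I = "?I1 \<times> ?I2 \<times> ?I3"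
  let ?A = "\<lambda>(vs, ys, js). {E. distinct vs \<and> extra (vs @ ys) js \<inter> list_edges vs = {} \<and>
      card (extra (vs @ ys) js) = x \<and> list_edges vs \<union> extra (vs @ ys) js \<subseteq> E}"
  let ?b = "2 * (real (\<Delta> - 1) * \<eta> / real n) ^ t * (real \<Delta> * \<eta> / real n) ^ x"
  have n0: "0 < n" using n by (simp add: ample_def)
  have b0: "0 \<le> ?b" using \<eta> by simp
  have fin: "finite ?I1" "finite ?I2" "finite ?I3" by (rule finite_lists_length_eq; simp)+
  have cards: "card ?I1 = n ^ Suc t" "card ?I2 = n ^ y" "card ?I3 = ((Suc t + y) * (Suc t + y)) ^ x"
    using card_lists_length_eq[of "{..<n}"] card_lists_length_eq[of "{..<Suc t + y} \<times> {..<Suc t + y}" x]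
    by (simp_all add: card_cartesian_product)
  have "rprob \<Delta> n (\<Union>i\<in>?I. ?A i) \<le> real (card ?I) * ?b"
  proof (rule prob_UN_le)
    show "finite ?I" using fin by (intro finite_cartesian_product)
    fix i assume i: "i \<in> ?I"
    obtain vs ys js where i': "i = (vs, ys, js)" by (cases i)
    let ?X = "extra (vs @ ys) js"
    show "rprob \<Delta> n (?A i) \<le> ?b"
    proof (cases "distinct vs \<and> ?X \<inter> list_edges vs = {} \<and> card ?X = x")
      case True
      then have "?A i = {E. list_edges vs \<union> ?X \<subseteq> E}" unfolding i' by auto
      moreover have "rprob \<Delta> n {E. list_edges vs \<union> ?X \<subseteq> E} \<le>
          2 * (real (\<Delta> - 1) * \<eta> / real n) ^ t * (real \<Delta> * \<eta> / real n) ^ card ?X"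
        using True i x(1) t(2) \<eta> unfolding i'
        by (intro prob_path_union[OF \<Delta> _ _ _ _ _ _ _ n]) (auto simp: extra_def)
      ultimately show ?thesis using True by simp
    next
      case False
      then have "?A i = {}" unfolding i' by auto
      then show ?thesis using b0 by simp
    qed
  qed
  also have "real (card ?I) = real n ^ Suc t * real n ^ y * real (Suc t + y) ^ (2 * x)"
    unfolding card_cartesian_product cards of_nat_mult of_nat_power
    by (simp only: power_mult power2_eq_square mult.assoc)
  also have "real n ^ Suc t * real n ^ y * real (Suc t + y) ^ (2 * x) * ?b =
     2 * (real (\<Delta> - 1) * \<eta>) ^ t * (real \<Delta> * \<eta>) ^ x * real (Suc t + y) ^ (2 * x) * (real n * real n ^ y / real n ^ x)"
    using n0 by (simp add: power_divide field_simps)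
  also have "\<dots> \<le> 2 * (real (\<Delta> - 1) * \<eta>) ^ T * (real \<Delta> * \<eta>) ^ D * real (Suc T + D) ^ (2 * D) * (real n / real n ^ m)"
  proof (intro mult_mono)
    have 1: "1 \<le> real (\<Delta> - 1) * \<eta>" "1 \<le> real \<Delta> * \<eta>" using \<Delta> \<eta> by (auto intro!: mult_ge1_I)
    show "(real (\<Delta> - 1) * \<eta>) ^ t \<le> (real (\<Delta> - 1) * \<eta>) ^ T" by (rule power_increasing[OF t(2) 1(1)])
    show "(real \<Delta> * \<eta>) ^ x \<le> (real \<Delta> * \<eta>) ^ D" by (rule power_increasing[OF x(1) 1(2)])
    have "real (Suc t + y) ^ (2 * x) \<le> real (Suc T + D) ^ (2 * x)" using t x by (intro power_mono) auto
    also have "\<dots> \<le> real (Suc T + D) ^ (2 * D)" using x by (intro power_increasing) auto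
    finally show "real (Suc t + y) ^ (2 * x) \<le> real (Suc T + D) ^ (2 * D)" .
    have "real n ^ y * real n ^ m \<le> real n ^ x"
      unfolding power_add[symmetric] using x(2) n0 by (intro power_increasing) auto
    then show "real n * real n ^ y / real n ^ x \<le> real n / real n ^ m"
      using n0 by (simp add: field_simps)
  qed (use \<eta> in auto)
  finally show ?thesis by (simp add: case_prod_beta')
qed

lemma prob_dense_path:
  assumes \<Delta>: "2 \<le> \<Delta>" and \<eta>: "1 \<le> \<eta>" and n: "ample \<Delta> \<eta> (T + D) n"
  shows "rprob \<Delta> n {E. dense_path T D m E} \<le>
    real (T * (Suc D * Suc D)) *
    (2 * (real (\<Delta> - 1) * \<eta>) ^ T * (real \<Delta> * \<eta>) ^ D * real (Suc T + D) ^ (2 * D) * (real n / real n ^ m))"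
proof -
  let ?M = "random_regular_graph \<Delta> n"
  let ?b = "2 * (real (\<Delta> - 1) * \<eta>) ^ T * (real \<Delta> * \<eta>) ^ D * real (Suc T + D) ^ (2 * D) * (real n / real n ^ m)"
  let ?A = "\<lambda>(t, x, y). (\<Union>(vs, ys, js)\<in>{vs. set vs \<subseteq> {..<n} \<and> length vs = Suc t} \<times> {ys. set ys \<subseteq> {..<n} \<and> length ys = y} \<times>
         {js. set js \<subseteq> {..<Suc t + y} \<times> {..<Suc t + y} \<and> length js = x}.
       {E. distinct vs \<and> extra (vs @ ys) js \<inter> list_edges vs = {} \<and> card (extra (vs @ ys) js) = x \<and>
           list_edges vs \<union> extra (vs @ ys) js \<subseteq> E})"
  let ?J = "{(t, x, y). t \<in> {1..T} \<and> x \<le> D \<and> y \<le> D \<and> y + m \<le> x}"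
  have ne: "regular_graphs \<Delta> n \<noteq> {}" using n by (simp add: ample_def)
  have Jsub: "?J \<subseteq> {1..T} \<times> {..D} \<times> {..D}" by auto
  then have finJ: "finite ?J" by (rule finite_subset) simp
  have "card ?J \<le> card ({1..T} \<times> {..D} \<times> {..D})" by (rule card_mono[OF _ Jsub]) simp
  then have cJ: "real (card ?J) \<le> real (T * (Suc D * Suc D))"
    unfolding of_nat_le_iff by (simp add: card_cartesian_product)
  have "measure_pmf.prob ?M {E. dense_path T D m E} = measure_pmf.prob ?M ({E. dense_path T D m E} \<inter> set_pmf ?M)"
    by (rule measure_Int_set_pmf[symmetric])
  also have "\<dots> \<le> measure_pmf.prob ?M (\<Union>i\<in>?J. ?A i)"
  proof (rule measure_pmf.finite_measure_mono)
    show "{E. dense_path T D m E} \<inter> set_pmf ?M \<subseteq> (\<Union>i\<in>?J. ?A i)"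
    proof
      fix E assume E: "E \<in> {E. dense_path T D m E} \<inter> set_pmf ?M"
      then have ER: "E \<in> regular_graphs \<Delta> n" using set_random_regular[OF ne] by auto
      note G = regular_graph_on[OF ER]
      obtain vs where vs: "path_in E vs" "2 \<le> length vs" "length vs \<le> Suc T" "\<not> sparse_along E vs D m"
        using E by (auto simp: dense_path_def)
      obtain X where X: "X \<subseteq> E - list_edges vs" "card X \<le> D" "card (\<Union>X - set vs) + m \<le> card X"
        using vs(4) by (auto simp: sparse_along_def not_less)
      have vsn: "set vs \<subseteq> {..<n}" by (rule path_in_vertices[OF G vs(1,2)])
      have finX: "finite X" using X(1) graph_on_finite[OF G] finite_subset by blast
      have Xg: "e \<subseteq> {..<n}" "card e = 2" if "e \<in> X" for e using that X(1) G by (auto simp: graph_on_def)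
      then have UX: "\<Union>X \<subseteq> {..<n}" by auto
      then have "finite (\<Union>X - set vs)" by (meson finite_Diff finite_lessThan finite_subset)
      then obtain ys where ys: "set ys = \<Union>X - set vs" "length ys = card (\<Union>X - set vs)"
        using finite_distinct_list distinct_card by metis
      have "\<Union>X \<subseteq> set (vs @ ys)" using ys by auto
      then obtain js where js: "length js = card X"
          "set js \<subseteq> {..<length (vs @ ys)} \<times> {..<length (vs @ ys)}" "extra (vs @ ys) js = X"
        using extra_code[OF finX] Xg by blast
      obtain t where t: "length vs = Suc t" "1 \<le> t" using vs(2) by (cases "length vs") auto
      have "(t, card X, length ys) \<in> ?J" using t vs(3) X ys by auto
      moreover have "E \<in> ?A (t, card X, length ys)"
      proof -
        have "E \<in> {E. distinct vs \<and> extra (vs @ ys) js \<inter> list_edges vs = {} \<and>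
            card (extra (vs @ ys) js) = card X \<and> list_edges vs \<union> extra (vs @ ys) js \<subseteq> E}"
          unfolding js(3) using X(1) vs(1) list_edges_subset[OF vs(1)] by (auto simp: path_in_def)
        moreover have "set vs \<subseteq> {..<n} \<and> length vs = Suc t" "set ys \<subseteq> {..<n} \<and> length ys = length ys"
          "set js \<subseteq> {..<Suc t + length ys} \<times> {..<Suc t + length ys} \<and> length js = card X"
          using vsn t ys UX js by auto
        ultimately show ?thesis by blast
      qed
      ultimately show "E \<in> (\<Union>i\<in>?J. ?A i)" by (rule UN_I)
    qed
  qed simp
  also have "\<dots> \<le> real (card ?J) * ?b"
  proof (rule prob_UN_le[OF finJ])
    fix i assume "i \<in> ?J"
    then obtain t x y where i: "i = (t, x, y)" "1 \<le> t" "t \<le> T" "x \<le> D" "y + m \<le> x" by auto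
    show "measure_pmf.prob ?M (?A i) \<le> ?b"
      unfolding i(1) prod.case by (rule prob_dense_fixed[OF \<Delta> \<eta> n i(2-5)])
  qed
  also have "\<dots> \<le> real (T * (Suc D * Suc D)) * ?b"
    using cJ \<eta> by (intro mult_right_mono) auto
  finally show ?thesis .
qed

section \<open>Expected numbers of paths and cycles\<close>

lemma sum_card_swap:
  assumes "finite A" "finite B"
  shows "(\<Sum>a\<in>A. card {b \<in> B. P a b}) = (\<Sum>b\<in>B. card {a \<in> A. P a b})"
proof -
  have "(\<Sum>a\<in>A. card {b \<in> B. P a b}) = (\<Sum>a\<in>A. \<Sum>b\<in>B. if P a b then 1 else 0)"
    using assms by (simp add: sum.inter_filter[symmetric])
  also have "\<dots> = (\<Sum>b\<in>B. \<Sum>a\<in>A. if P a b then 1 else 0)" by (rule sum.swap)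
  also have "\<dots> = (\<Sum>b\<in>B. card {a \<in> A. P a b})"
    using assms by (simp add: sum.inter_filter[symmetric])
  finally show ?thesis .
qed

lemma expected_count:
  assumes ne: "regular_graphs \<Delta> n \<noteq> {}"
    and P: "\<And>E vs. E \<in> regular_graphs \<Delta> n \<Longrightarrow> P E vs \<Longrightarrow> set vs \<subseteq> {..<n} \<and> length vs = l"
    and b: "\<And>vs. set vs \<subseteq> {..<n} \<Longrightarrow> length vs = l \<Longrightarrow>
       rprob \<Delta> n {E. P E vs} \<le> b"
  shows "(\<Sum>E\<in>regular_graphs \<Delta> n. real (card {vs. P E vs})) \<le> real (card (regular_graphs \<Delta> n)) * (real n ^ l * b)"
proof -
  let ?R = "regular_graphs \<Delta> n" and ?W = "{vs. set vs \<subseteq> {..<n} \<and> length vs = l}"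
  have finW: "finite ?W" by (rule finite_lists_length_eq) simp
  have N: "0 < real (card ?R)" using ne finite_regular_graphs by (simp add: card_gt_0_iff)
  have "(\<Sum>E\<in>?R. real (card {vs. P E vs})) = real (\<Sum>E\<in>?R. card {vs \<in> ?W. P E vs})"
    unfolding of_nat_sum
  proof (rule sum.cong[OF refl])
    fix E assume "E \<in> ?R"
    then have "{vs. P E vs} = {vs \<in> ?W. P E vs}" using P by blast
    then show "real (card {vs. P E vs}) = real (card {vs \<in> ?W. P E vs})" by (rule arg_cong)
  qed
  also have "(\<Sum>E\<in>?R. card {vs \<in> ?W. P E vs}) = (\<Sum>vs\<in>?W. card {E \<in> ?R. P E vs})"
    by (rule sum_card_swap[OF finite_regular_graphs finW])
  also have "real \<dots> = (\<Sum>vs\<in>?W. real (card {E \<in> ?R. P E vs}))" by (rule of_nat_sum)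
  also have "\<dots> \<le> real (card ?W) * (real (card ?R) * b)"
  proof (rule sum_bounded_above)
    fix vs assume "vs \<in> ?W"
    then have "real (card (?R \<inter> {E. P E vs})) / real (card ?R) \<le> b"
      using b[of vs] unfolding prob_random_regular[OF ne] by auto
    moreover have "?R \<inter> {E. P E vs} = {E \<in> ?R. P E vs}" by auto
    ultimately show "real (card {E \<in> ?R. P E vs}) \<le> real (card ?R) * b"
      using N by (simp add: pos_divide_le_eq mult.commute)
  qed
  also have "card ?W = n ^ l" using card_lists_length_eq[of "{..<n}" l] by simp
  finally show ?thesis by (simp add: mult_ac)
qed

lemma expected_paths:
  assumes \<Delta>: "2 \<le> \<Delta>" and \<eta>: "1 \<le> \<eta>" and n: "ample \<Delta> \<eta> s n" and T: "1 \<le> T" "T \<le> s"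
  shows "(\<Sum>E\<in>regular_graphs \<Delta> n. real (card {vs. path_in E vs \<and> length vs = Suc T})) \<le>
    real (card (regular_graphs \<Delta> n)) * (2 * real n * (real (\<Delta> - 1) * \<eta>) ^ T)"
proof -
  have n0: "0 < n" and ne: "regular_graphs \<Delta> n \<noteq> {}" using n by (auto simp: ample_def)
  let ?b = "2 * (real (\<Delta> - 1) * \<eta> / real n) ^ T"
  have "(\<Sum>E\<in>regular_graphs \<Delta> n. real (card {vs. path_in E vs \<and> length vs = Suc T})) \<le>
    real (card (regular_graphs \<Delta> n)) * (real n ^ Suc T * ?b)"
  proof (rule expected_count[OF ne])
    fix E vs assume "E \<in> regular_graphs \<Delta> n" "path_in E vs \<and> length vs = Suc T"
    then show "set vs \<subseteq> {..<n} \<and> length vs = Suc T"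
      using path_in_vertices[OF regular_graph_on] T(1) by auto
  next
    fix vs :: "nat list" assume vs: "set vs \<subseteq> {..<n}" "length vs = Suc T"
    show "rprob \<Delta> n {E. path_in E vs \<and> length vs = Suc T} \<le> ?b"
    proof (cases "distinct vs")
      case True
      have "rprob \<Delta> n {E. path_in E vs \<and> length vs = Suc T} \<le>
        rprob \<Delta> n {E. list_edges vs \<union> {} \<subseteq> E}"
        by (rule measure_pmf.finite_measure_mono) (auto dest: list_edges_subset)
      also have "\<dots> \<le> 2 * (real (\<Delta> - 1) * \<eta> / real n) ^ T * (real \<Delta> * \<eta> / real n) ^ card ({} :: nat set set)"
        using \<eta> T by (intro prob_path_union[OF \<Delta> _ True vs _ _ _ n]) auto
      finally show ?thesis by simp
    next
      case False
      then have "{E. path_in E vs \<and> length vs = Suc T} = {}" by (auto simp: path_in_def)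
      then show ?thesis using \<eta> by (simp only: measure_empty) simp
    qed
  qed
  also have "real n ^ Suc T * ?b = 2 * real n * (real (\<Delta> - 1) * \<eta>) ^ T"
    using n0 by (simp add: power_divide)
  finally show ?thesis .
qed

text \<open>\<open>n ^ l\<close> vertex lists meet \<open>l\<close> edges of probability of order
  \<open>1 / n\<close>, so the powers of \<open>n\<close> cancel. The factor 4 is 2 from
  \<open>prob_path_union\<close> times 2 from \<open>\<Delta> \<le> 2 * (\<Delta> - 1)\<close> for
  the closing edge.\<close>

lemma expected_cycles:
  assumes \<Delta>: "2 \<le> \<Delta>" and \<eta>: "1 \<le> \<eta>" and n: "ample \<Delta> \<eta> s n" and l: "l \<le> s"
  shows "(\<Sum>E\<in>regular_graphs \<Delta> n. real (card {vs. is_cycle E vs \<and> length vs = l})) \<le>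
    real (card (regular_graphs \<Delta> n)) * (4 * (real (\<Delta> - 1) * \<eta>) ^ l)"
proof (cases "3 \<le> l")
  case True
  have n0: "0 < n" and ne: "regular_graphs \<Delta> n \<noteq> {}" using n by (auto simp: ample_def)
  let ?b = "2 * (real (\<Delta> - 1) * \<eta> / real n) ^ (l - 1) * (real \<Delta> * \<eta> / real n)"
  obtain k where k: "l = Suc k" using True by (cases l) auto
  have "(\<Sum>E\<in>regular_graphs \<Delta> n. real (card {vs. is_cycle E vs \<and> length vs = l})) \<le>
    real (card (regular_graphs \<Delta> n)) * (real n ^ l * ?b)"
  proof (rule expected_count[OF ne])
    fix E vs assume "E \<in> regular_graphs \<Delta> n" "is_cycle E vs \<and> length vs = l"
    then show "set vs \<subseteq> {..<n} \<and> length vs = l"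
      using path_in_vertices[OF regular_graph_on] by (auto simp: is_cycle_iff)
  next
    fix vs :: "nat list" assume vs: "set vs \<subseteq> {..<n}" "length vs = l"
    show "rprob \<Delta> n {E. is_cycle E vs \<and> length vs = l} \<le> ?b"
    proof (cases "distinct vs")
      case d: True
      have ne': "vs \<noteq> []" using vs True by auto
      have "{vs ! 0, vs ! (length vs - 1)} \<notin> list_edges vs"
        using vs True by (intro not_list_edge d) auto
      then have nl: "{last vs, hd vs} \<notin> list_edges vs"
        using ne' by (simp add: hd_conv_nth last_conv_nth insert_commute)
      have "rprob \<Delta> n {E. is_cycle E vs \<and> length vs = l} \<le>
        rprob \<Delta> n {E. list_edges vs \<union> {{last vs, hd vs}} \<subseteq> E}"
        by (rule measure_pmf.finite_measure_mono) (auto simp: is_cycle_iff dest: list_edges_subset)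
      also have "\<dots> \<le> 2 * (real (\<Delta> - 1) * \<eta> / real n) ^ k * (real \<Delta> * \<eta> / real n) ^ card {{last vs, hd vs}}"
        using \<eta> l nl vs k by (intro prob_path_union[OF \<Delta> _ d vs(1) _ _ _ _ n]) auto
      finally show ?thesis using k by simp
    next
      case False
      then have "{E. is_cycle E vs \<and> length vs = l} = {}" by (auto simp: is_cycle_def)
      then show ?thesis using \<eta> by (simp only: measure_empty) simp
    qed
  qed
  also have "real n ^ l * ?b = 2 * (real (\<Delta> - 1) * \<eta>) ^ k * (real \<Delta> * \<eta>)"
    unfolding k using n0 by (simp add: power_divide)
  also have "\<dots> \<le> 4 * (real (\<Delta> - 1) * \<eta>) ^ l"
  proof -
    have "real \<Delta> * \<eta> \<le> 2 * (real (\<Delta> - 1) * \<eta>)" using \<Delta> \<eta> by (simp add: algebra_simps)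
    then have "2 * (real (\<Delta> - 1) * \<eta>) ^ k * (real \<Delta> * \<eta>) \<le> 2 * (real (\<Delta> - 1) * \<eta>) ^ k * (2 * (real (\<Delta> - 1) * \<eta>))"
      using \<eta> by (intro mult_left_mono) auto
    then show ?thesis unfolding k by (simp add: mult_ac)
  qed
  finally show ?thesis by (simp add: mult_left_mono)
next
  case False
  then have z: "card {vs. is_cycle E vs \<and> length vs = l} = 0" for E :: "nat set set"
    by (auto simp: is_cycle_def card_eq_0_iff)
  show ?thesis unfolding z using \<eta> by simp
qed

text \<open>The right-hand side of \<open>prob_long_cycle\<close> up to the constant.\<close>

definition cycle_sum :: "real \<Rightarrow> real \<Rightarrow> nat \<Rightarrow> nat set set \<Rightarrow> real" where
  "cycle_sum \<kappa> L T E = (\<Sum>l | L < real l \<and> l \<le> T. real (card {vs. is_cycle E vs \<and> length vs = l}) * \<kappa> ^ (l - 1)) +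
      real (card {vs. path_in E vs \<and> length vs = Suc T}) * \<kappa> ^ T"

lemma sum_power_above:
  fixes \<rho> L :: real
  assumes \<rho>: "0 < \<rho>" "\<rho> < 1" and L: "0 \<le> L"
  shows "(\<Sum>l | L < real l \<and> l \<le> T. \<rho> ^ l) \<le> \<rho> powr L / (1 - \<rho>)"
proof -
  let ?k = "nat \<lceil>L\<rceil>"
  have "(\<Sum>l | L < real l \<and> l \<le> T. \<rho> ^ l) \<le> (\<Sum>l\<in>{?k..?k + T}. \<rho> ^ l)"
  proof (rule sum_mono2)
    show "{l. L < real l \<and> l \<le> T} \<subseteq> {?k..?k + T}" by (auto simp: ceiling_le_iff)
  qed (use \<rho> in auto)
  also have "\<dots> = (\<Sum>j\<le>T. \<rho> ^ (?k + j))"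
    by (rule sum.reindex_bij_witness[of _ "\<lambda>j. ?k + j" "\<lambda>l. l - ?k"]) auto
  also have "\<dots> = \<rho> ^ ?k * (\<Sum>j\<le>T. \<rho> ^ j)" by (simp add: power_add sum_distrib_left)
  also have "\<dots> \<le> \<rho> powr L * (1 / (1 - \<rho>))"
  proof (rule mult_mono)
    have "\<rho> ^ ?k = \<rho> powr real ?k" using \<rho> by (simp add: powr_realpow)
    also have "\<dots> \<le> \<rho> powr L" using \<rho> by (intro powr_mono') (auto simp: real_nat_ceiling_ge)
    finally show "\<rho> ^ ?k \<le> \<rho> powr L" .
    show "(\<Sum>j\<le>T. \<rho> ^ j) \<le> 1 / (1 - \<rho>)" using \<rho> by (simp add: sum_gp0 divide_right_mono)
  qed (use \<rho> in \<open>auto intro: sum_nonneg\<close>)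
  finally show ?thesis by simp
qed

text \<open>Markov's inequality for the nonnegative variable \<open>cycle_sum\<close>. Its mean is
  bounded by a geometric tail in \<open>\<rho>\<close> starting at \<open>L\<close>, plus the
  contribution of the paths with \<open>T\<close> edges.\<close>

lemma prob_cycle_sum:
  assumes \<Delta>: "2 \<le> \<Delta>" and \<eta>: "1 \<le> \<eta>" and n: "ample \<Delta> \<eta> T n" and T: "1 \<le> T"
    and L: "0 \<le> L" and \<kappa>: "0 < \<kappa>" and \<rho>: "\<rho> = real (\<Delta> - 1) * \<eta> * \<kappa>" "\<rho> < 1" and a: "0 < a"
  shows "rprob \<Delta> n {E. a \<le> cycle_sum \<kappa> L T E} \<le>
    (4 / \<kappa> * (\<rho> powr L / (1 - \<rho>)) + 2 * real n * \<rho> ^ T) / a"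
proof -
  let ?R = "regular_graphs \<Delta> n" and ?L = "{l. L < real l \<and> l \<le> T}"
  have ne: "?R \<noteq> {}" using n by (auto simp: ample_def)
  let ?N = "real (card ?R)"
  let ?B = "4 / \<kappa> * (\<rho> powr L / (1 - \<rho>)) + 2 * real n * \<rho> ^ T"
  have N: "0 < ?N" using ne finite_regular_graphs by (simp add: card_gt_0_iff)
  have \<rho>0: "0 < \<rho>" unfolding \<rho> using \<Delta> \<eta> \<kappa> by simp
  have finL: "finite ?L" by simp
  have "(\<Sum>E\<in>?R. cycle_sum \<kappa> L T E) =
     (\<Sum>l\<in>?L. (\<Sum>E\<in>?R. real (card {vs. is_cycle E vs \<and> length vs = l})) * \<kappa> ^ (l - 1)) +
     (\<Sum>E\<in>?R. real (card {vs. path_in E vs \<and> length vs = Suc T})) * \<kappa> ^ T"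
    unfolding cycle_sum_def sum.distrib sum_distrib_right by (subst sum.swap) simp
  also have "\<dots> \<le> (\<Sum>l\<in>?L. ?N * (4 * (real (\<Delta> - 1) * \<eta>) ^ l) * \<kappa> ^ (l - 1)) +
      ?N * (2 * real n * (real (\<Delta> - 1) * \<eta>) ^ T) * \<kappa> ^ T"
    using \<kappa> T by (intro add_mono sum_mono mult_right_mono expected_cycles[OF \<Delta> \<eta> n] expected_paths[OF \<Delta> \<eta> n]) auto
  also have "\<dots> = ?N * ((\<Sum>l\<in>?L. 4 * (real (\<Delta> - 1) * \<eta>) ^ l * \<kappa> ^ (l - 1)) + 2 * real n * \<rho> ^ T)"
    unfolding \<rho> by (simp add: sum_distrib_left algebra_simps power_mult_distrib)
  also have "\<dots> \<le> ?N * ?B"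
  proof (intro mult_left_mono add_right_mono)
    have "(\<Sum>l\<in>?L. 4 * (real (\<Delta> - 1) * \<eta>) ^ l * \<kappa> ^ (l - 1)) \<le> (\<Sum>l\<in>?L. 4 / \<kappa> * \<rho> ^ l)"
    proof (rule sum_mono)
      fix l assume "l \<in> ?L"
      then obtain k where k: "l = Suc k" using L by (cases l) auto
      show "4 * (real (\<Delta> - 1) * \<eta>) ^ l * \<kappa> ^ (l - 1) \<le> 4 / \<kappa> * \<rho> ^ l"
        unfolding k \<rho> using \<kappa> by (simp add: power_mult_distrib)
    qed
    also have "\<dots> = 4 / \<kappa> * (\<Sum>l\<in>?L. \<rho> ^ l)" by (simp add: sum_distrib_left)
    also have "\<dots> \<le> 4 / \<kappa> * (\<rho> powr L / (1 - \<rho>))"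
      using \<kappa> sum_power_above[OF \<rho>0 \<rho>(2) L] by (intro mult_left_mono) auto
    finally show "(\<Sum>l\<in>?L. 4 * (real (\<Delta> - 1) * \<eta>) ^ l * \<kappa> ^ (l - 1)) \<le> 4 / \<kappa> * (\<rho> powr L / (1 - \<rho>))" .
  qed simp
  finally have total: "(\<Sum>E\<in>?R. cycle_sum \<kappa> L T E) \<le> ?N * ?B" .
  have nn: "0 \<le> cycle_sum \<kappa> L T E" for E
    unfolding cycle_sum_def using \<kappa> by (intro add_nonneg_nonneg sum_nonneg) auto
  have "real (card (?R \<inter> {E. a \<le> cycle_sum \<kappa> L T E})) * a \<le> (\<Sum>E\<in>?R \<inter> {E. a \<le> cycle_sum \<kappa> L T E}. cycle_sum \<kappa> L T E)"
    by (rule sum_bounded_below) auto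
  also have "\<dots> \<le> (\<Sum>E\<in>?R. cycle_sum \<kappa> L T E)"
    using nn finite_regular_graphs by (intro sum_mono2) auto
  finally have "real (card (?R \<inter> {E. a \<le> cycle_sum \<kappa> L T E})) * a \<le> ?N * ?B" using total by linarith
  then show ?thesis
    unfolding prob_random_regular[OF ne] using N a by (simp add: field_simps)
qed

section \<open>The uniqueness regime\<close>

text \<open>With \<open>I\<close> for the infimum, \<open>p_c\<close> is \<open>I / (1 + I)\<close>,
  so \<open>p < p_c\<close> means \<open>p / (1 - p) < I\<close>. The infimum is a genuine lower
  bound because \<open>pc_fun\<close> is nonnegative.\<close>

lemma p_c_bound:
  assumes d: "2 \<le> d" and q: "1 \<le> q" and p: "0 < p" "p < 1" "p < p_c q (Suc d)" and y: "1 < y"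
  shows "p / (1 - p) < (INF y\<in>{1<..}. pc_fun q (Suc d) y)"
    and "(INF y\<in>{1<..}. pc_fun q (Suc d) y) \<le> pc_fun q (Suc d) y"
proof -
  let ?f = "pc_fun q (Suc d)" and ?I = "INF y\<in>{1<..}. pc_fun q (Suc d) y"
  have nn: "0 \<le> ?f y" if "1 < y" for y
  proof -
    have "y ^ 1 < y ^ d" using d that by (intro power_strict_increasing) auto
    moreover have "0 \<le> y ^ d" using that by simp
    ultimately show ?thesis unfolding pc_fun_def using that q
      by (intro divide_nonneg_nonneg mult_nonneg_nonneg) auto
  qed
  have bdd: "bdd_below (?f ` {1<..})" by (rule bdd_belowI[of _ 0]) (use nn in auto)
  show "?I \<le> ?f y" by (rule cINF_lower[OF bdd]) (use y in auto)
  have I0: "0 \<le> ?I" by (rule cINF_greatest) (use nn y in auto)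
  have "1 / (1 + ?I) < 1 - p" using p unfolding p_c_def by simp
  then have "1 < (1 - p) * (1 + ?I)" using I0 by (simp add: pos_divide_less_eq)
  then have "p < ?I * (1 - p)" by (simp add: algebra_simps)
  then show "p / (1 - p) < ?I" using p by (simp add: pos_divide_less_eq)
qed

text \<open>As \<open>y\<close> tends to 1, the infimum is seen to be at most
  \<open>q / (d - 1)\<close>, and \<open>p / (1 - p) < q / (d - 1)\<close> is the claim rearranged.
  Bernoulli's inequality first bounds \<open>pc_fun\<close> by a function continuous at 1, which
  avoids the indeterminate quotient there.\<close>

lemma edge_prob_subcritical:
  assumes d: "2 \<le> d" and q: "1 \<le> q" and p: "0 < p" "p < 1" "p < p_c q (Suc d)"
  shows "p / (p + (1 - p) * q) * real d < 1"
proof -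
  let ?I = "INF y\<in>{1<..}. pc_fun q (Suc d) y"
  have up: "?I \<le> (y ^ d + q - 1) / real (d - 1)" if y: "1 < y" for y
  proof -
    obtain k where k: "d = Suc k" "1 \<le> k" using d by (cases d) auto
    have "1 + real k * (y - 1) \<le> (1 + (y - 1)) ^ k"
      using y by (intro Bernoulli_inequality) auto
    then have "real k * (y - 1) \<le> y ^ k - 1" by simp
    also have "\<dots> \<le> y * (y ^ k - 1)" using y one_le_power[of y k] mult_right_mono[of 1 y "y ^ k - 1"] by simp
    finally have b: "real k * (y - 1) \<le> y ^ d - y" unfolding k by (simp add: algebra_simps)
    have pos: "0 < real k * (y - 1)" using k y by simp
    have "1 \<le> y ^ d" using y by (intro one_le_power) simp
    then have yd: "0 \<le> y ^ d + q - 1" using q by linarith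
    have "?I \<le> pc_fun q (Suc d) y" by (rule p_c_bound(2)[OF d q p y])
    also have "\<dots> \<le> (y - 1) * (y ^ d + q - 1) / (real k * (y - 1))"
      unfolding pc_fun_def diff_Suc_1
    proof (rule divide_left_mono[OF b])
      show "0 \<le> (y - 1) * (y ^ d + q - 1)" using y yd by simp
      have "0 < y ^ d - y" using b pos by linarith
      then show "0 < (y ^ d - y) * (real k * (y - 1))" using pos by (rule mult_pos_pos)
    qed
    also have "\<dots> = (y ^ d + q - 1) / real (d - 1)" using y k by simp
    finally show ?thesis .
  qed
  have "((\<lambda>y. (y ^ d + q - 1) / real (d - 1)) \<longlongrightarrow> (1 ^ d + q - 1) / real (d - 1)) (at_right (1::real))"
    using d by (intro tendsto_intros) auto
  then have "?I \<le> (1 ^ d + q - 1) / real (d - 1)"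
    by (rule tendsto_lowerbound) (use up in \<open>auto simp: eventually_at_filter\<close>)
  then have "p / (1 - p) < q / real (d - 1)" using p_c_bound(1)[OF d q p, of 2] by simp
  then have "p * real (d - 1) < q * (1 - p)" using p d by (simp add: field_simps)
  then have "p * real d < p + (1 - p) * q" using d by (simp add: of_nat_diff algebra_simps)
  moreover have "0 < p + (1 - p) * q" using p q by (intro add_pos_nonneg) auto
  ultimately show ?thesis by (simp add: pos_divide_less_eq)
qed

text \<open>Solved for \<open>p / (1 - p)\<close>, the equation \<open>msg (y ^ d) = y\<close> reads
  \<open>p / (1 - p) = pc_fun q (Suc d) y\<close>. Below \<open>p_c\<close> the map thus lies
  strictly under the diagonal for \<open>y > 1\<close>, and the decreasing sequence can only tend to
  the fixed point 1.\<close>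

lemma mseq_tendsto_1:
  assumes d: "2 \<le> d" and q: "1 \<le> q" and p: "0 < p" "p < 1" "p < p_c q (Suc d)"
  shows "rc_params.mseq p q d \<longlonglongrightarrow> 1"
proof -
  \<comment> \<open>\<open>mseq\<close> does not depend on the vertex set; any finite one gives
    access to the lemmas about it.\<close>
  interpret rc_params "{} :: nat set" p q by unfold_locales (use p q in auto)
  have den: "0 < cc * q + (1 - p) * (y ^ d - 1)" if "1 \<le> y" for y :: real
    using cc_pos q p that by (intro add_pos_nonneg mult_pos_pos mult_nonneg_nonneg) auto
  have less: "msg (y ^ d) < y" if y: "1 < y" for y
  proof -
    have "y ^ 1 < y ^ d" using d y by (intro power_strict_increasing) auto
    then have yd: "0 < y ^ d - y" by simp
    have "p / (1 - p) < pc_fun q (Suc d) y" using p_c_bound[OF d q p y] by linarith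
    then have "p * (y ^ d - y) < (1 - p) * ((y - 1) * (y ^ d + q - 1))"
      unfolding pc_fun_def using p yd by (simp add: field_simps)
    moreover have c: "cc * q = q * (1 - p) + p" using q by (simp add: cc_def field_simps)
    ultimately have "cc * q + (y ^ d - 1) < y * (cc * q + (1 - p) * (y ^ d - 1))"
      unfolding c by (simp add: algebra_simps)
    then show ?thesis unfolding msg_def using den[of y] y by (simp add: pos_divide_less_eq)
  qed
  have msg1: "msg 1 = 1" using cc_pos q by (simp add: msg_def)
  have dec: "mseq d (Suc k) \<le> mseq d k" for k
    using less[of "mseq d k"] mseq_ge_1[of d k] msg1 by (cases "mseq d k = 1") auto
  then have "decseq (mseq d)" by (simp add: decseq_SucI)
  then obtain l where l: "mseq d \<longlonglongrightarrow> l" using mseq_ge_1 by (metis decseq_convergent)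
  have l1: "1 \<le> l" by (rule LIMSEQ_le_const[OF l]) (use mseq_ge_1 in auto)
  have "(\<lambda>k. msg (mseq d k ^ d)) \<longlonglongrightarrow> msg (l ^ d)"
    unfolding msg_def using den[OF l1] by (intro tendsto_intros l) auto
  moreover have "(\<lambda>k. msg (mseq d k ^ d)) \<longlonglongrightarrow> l" using LIMSEQ_Suc[OF l] by simp
  ultimately have "msg (l ^ d) = l" by (rule LIMSEQ_unique)
  then have "l = 1" using less[of l] l1 by fastforce
  then show ?thesis using l by simp
qed

text \<open>For positive \<open>j\<close>, distribute \<open>real n powr e\<close> over the
  \<open>j\<close> factors; each becomes a logarithmic term times a negative power of
  \<open>n\<close>.\<close>

lemma ln_power_powr_tendsto_0:
  fixes e K a :: real
  assumes "e < 0"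
  shows "(\<lambda>n. (K * ln (real n) + a) ^ j * real n powr e) \<longlonglongrightarrow> 0"
proof (cases "j = 0")
  case True
  then show ?thesis using assms by (simp, real_asymp)
next
  case False
  define b where "b = e / real j"
  have b: "b < 0" "b * real j = e" using assms False by (simp_all add: b_def divide_neg_pos)
  have "(\<lambda>n. (K * ln (real n) + a) * real n powr b) \<longlonglongrightarrow> 0" using b(1) by real_asymp
  then have "(\<lambda>n. ((K * ln (real n) + a) * real n powr b) ^ j) \<longlonglongrightarrow> 0 ^ j" by (rule tendsto_power)
  moreover have "((K * ln (real n) + a) * real n powr b) ^ j = (K * ln (real n) + a) ^ j * real n powr e" for n
    using b(2) False by (cases "n = 0") (auto simp: power_mult_distrib powr_power mult.commute)
  ultimately show ?thesis using False by (simp add: power_0_left)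
qed

section \<open>Main result\<close>

text \<open>For logarithmically many prescribed edges, the excluded pairs are of order
  \<open>ln n\<close> and thus below any fixed fraction of \<open>\<Delta> * n\<close>.\<close>

lemma ample_eventually:
  assumes \<Delta>: "1 \<le> \<Delta>" and \<eta>: "1 < \<eta>" and K: "0 \<le> K"
  shows "eventually (\<lambda>n. ample \<Delta> \<eta> (nat \<lfloor>K * ln (real n)\<rfloor> + D) n) (inf sequentially (principal {n. even (\<Delta> * n)}))"
proof -
  define c where "c = real \<Delta> * (1 - 1 / \<eta>)"
  have c: "0 < c" using \<Delta> \<eta> by (simp add: c_def)
  define b where "b = 2 * real D + 2 + 2 * real \<Delta> * (real \<Delta> + 1)"
  have "(\<lambda>n. (2 * (K * ln (real n)) + b) / real n) \<longlonglongrightarrow> 0" by real_asymp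
  then have "eventually (\<lambda>n. (2 * (K * ln (real n)) + b) / real n < c) sequentially"
    using c by (rule order_tendstoD)
  moreover have "eventually (\<lambda>n. \<Delta> + 1 < n) sequentially" by (rule eventually_gt_at_top)
  ultimately have "eventually (\<lambda>n. even (\<Delta> * n) \<longrightarrow> ample \<Delta> \<eta> (nat \<lfloor>K * ln (real n)\<rfloor> + D) n) sequentially"
  proof eventually_elim
    case (elim n)
    let ?T = "nat \<lfloor>K * ln (real n)\<rfloor>"
    have n: "0 < real n" "1 \<le> real n" using elim(2) by auto
    have "0 \<le> K * ln (real n)" using K n by simp
    then have T: "real ?T \<le> K * ln (real n)" by simp
    have "2 * (K * ln (real n)) + b < c * real n" using elim(1) n by (simp add: pos_divide_less_eq)
    moreover have "real (2 * (?T + D) + 2 + 2 * \<Delta> * (\<Delta> + 1)) = 2 * real ?T + b"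
      by (simp add: b_def algebra_simps)
    moreover have "c * real n = real (\<Delta> * n) - real (\<Delta> * n) / \<eta>"
      by (simp add: c_def algebra_simps)
    ultimately have "real (\<Delta> * n) / \<eta> \<le> real (\<Delta> * n) - real (2 * (?T + D) + 2 + 2 * \<Delta> * (\<Delta> + 1))"
      using T by linarith
    then show ?case using regular_graphs_nonempty[of \<Delta> n] elim(2) by (auto simp: ample_def)
  qed
  then show ?thesis by (simp add: eventually_inf_principal)
qed

lemma powr_ln_swap: "0 < a \<Longrightarrow> 0 < x \<Longrightarrow> a powr (K * ln x) = x powr (K * ln a)" for a x K :: real
  by (simp add: powr_def mult_ac)

text \<open>Up to powers of \<open>ln n\<close> the bound is \<open>n * A ^ T / n ^ m\<close> with
  \<open>A = (\<Delta> - 1) * \<eta>\<close>, and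
  \<open>A powr (K * ln n) = n powr (K * ln A)\<close>. The condition on \<open>m\<close> makes the
  total exponent \<open>e\<close> negative.\<close>

lemma dense_path_tendsto_0:
  assumes \<Delta>: "2 \<le> \<Delta>" and \<eta>: "1 < \<eta>" and K: "0 < K" and m: "1 + K * ln (real (\<Delta> - 1) * \<eta>) < real m"
  shows "((\<lambda>n. rprob \<Delta> n {E. dense_path (nat \<lfloor>K * ln (real n)\<rfloor>) D m E}) \<longlongrightarrow> 0)
    (inf sequentially (principal {n. even (\<Delta> * n)}))"
proof -
  let ?F = "inf sequentially (principal {n. even (\<Delta> * n)})"
  define A where "A = real (\<Delta> - 1) * \<eta>"
  let ?T = "\<lambda>n. nat \<lfloor>K * ln (real n)\<rfloor>"
  define e where "e = 1 + K * ln A - real m"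
  define C where "C = real (Suc D * Suc D) * 2 * (real \<Delta> * \<eta>) ^ D"
  let ?g = "\<lambda>n. C * ((K * ln (real n) + real (Suc D)) ^ (2 * D + 1) * real n powr e)"
  have A: "1 \<le> A" unfolding A_def using \<Delta> \<eta> mult_mono[of 1 "real (\<Delta> - 1)" 1 \<eta>] by simp
  have C0: "0 \<le> C" using \<eta> by (simp add: C_def)
  have "(\<lambda>n. (K * ln (real n) + real (Suc D)) ^ (2 * D + 1) * real n powr e) \<longlonglongrightarrow> 0"
    using m by (intro ln_power_powr_tendsto_0) (simp add: e_def A_def)
  then have "?g \<longlonglongrightarrow> 0" using tendsto_mult_right_zero by blast
  then have g: "(?g \<longlongrightarrow> 0) ?F" by (rule tendsto_mono[OF inf_le1])
  have "eventually (\<lambda>n. rprob \<Delta> n {E. dense_path (?T n) D m E} \<le> ?g n) ?F"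
    using ample_eventually[of \<Delta> \<eta> K D]
  proof (rule eventually_mono)
    fix n assume n: "ample \<Delta> \<eta> (?T n + D) n"
    have n1: "0 < real n" "1 \<le> real n" using n by (auto simp: ample_def)
    have kl: "0 \<le> K * ln (real n)" using K n1 by simp
    then have T: "real (?T n) \<le> K * ln (real n)" by simp
    let ?x = "K * ln (real n) + real (Suc D)"
    have "rprob \<Delta> n {E. dense_path (?T n) D m E} \<le>
      real (?T n * (Suc D * Suc D)) *
      (2 * A ^ ?T n * (real \<Delta> * \<eta>) ^ D * real (Suc (?T n) + D) ^ (2 * D) * (real n / real n ^ m))"
      unfolding A_def by (rule prob_dense_path[OF \<Delta> _ n]) (use \<eta> in simp)
    also have "\<dots> = C * (real (?T n) * real (Suc (?T n) + D) ^ (2 * D) * (A ^ ?T n * (real n / real n ^ m)))"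
      unfolding C_def of_nat_mult by (simp only: mult_ac)
    also have "\<dots> \<le> C * (?x * ?x ^ (2 * D) * real n powr e)"
    proof (intro mult_left_mono mult_mono)
      show "real (?T n) \<le> ?x" using T by linarith
      show "real (Suc (?T n) + D) ^ (2 * D) \<le> ?x ^ (2 * D)" using T by (intro power_mono) auto
      have "A ^ ?T n = A powr real (?T n)" by (rule powr_realpow[symmetric]) (use A in linarith)
      also have "\<dots> \<le> A powr (K * ln (real n))" using A T by (intro powr_mono) auto
      also have "\<dots> = real n powr (K * ln A)" by (rule powr_ln_swap) (use A n1 in linarith)+
      finally have 1: "A ^ ?T n \<le> real n powr (K * ln A)" .
      have "real n / real n ^ m = real n powr (1 - real m)"
        using n1 by (simp add: powr_diff powr_realpow)
      then have "A ^ ?T n * (real n / real n ^ m) \<le> real n powr (K * ln A) * real n powr (1 - real m)"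
        using 1 by (simp add: mult_right_mono)
      also have "\<dots> = real n powr e" by (simp add: e_def powr_add[symmetric] algebra_simps)
      finally show "A ^ ?T n * (real n / real n ^ m) \<le> real n powr e" .
    qed (use kl C0 A in auto)
    finally show "rprob \<Delta> n {E. dense_path (?T n) D m E} \<le> ?g n"
      by simp
  qed (use \<Delta> \<eta> K in auto)
  then show ?thesis
    by (rule tendsto_sandwich[OF _ _ tendsto_const g, rotated]) simp
qed

lemma tendsto_1_by_exceptions:
  assumes "eventually (\<lambda>n. set_pmf (M n) \<subseteq> A n \<union> B1 n \<union> B2 n \<union> B3 n) F"
    and "((\<lambda>n. measure_pmf.prob (M n) (B1 n)) \<longlongrightarrow> 0) F"
    and "((\<lambda>n. measure_pmf.prob (M n) (B2 n)) \<longlongrightarrow> 0) F"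
    and "((\<lambda>n. measure_pmf.prob (M n) (B3 n)) \<longlongrightarrow> 0) F"
  shows "((\<lambda>n. measure_pmf.prob (M n) (A n)) \<longlongrightarrow> (1::real)) F"
proof (rule tendsto_sandwich)
  let ?p = "\<lambda>n X. measure_pmf.prob (M n) X"
  show "eventually (\<lambda>n. 1 - (?p n (B1 n) + ?p n (B2 n) + ?p n (B3 n)) \<le> ?p n (A n)) F"
    using assms(1)
  proof eventually_elim
    case (elim n)
    have "1 = ?p n (set_pmf (M n))" by (simp add: measure_pmf.prob_eq_1 AE_measure_pmf)
    also have "\<dots> \<le> ?p n (A n \<union> B1 n \<union> B2 n \<union> B3 n)"
      using elim by (intro measure_pmf.finite_measure_mono) auto
    also have "\<dots> \<le> ?p n (A n \<union> B1 n \<union> B2 n) + ?p n (B3 n)" by (rule measure_Un_le) auto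
    also have "?p n (A n \<union> B1 n \<union> B2 n) \<le> ?p n (A n \<union> B1 n) + ?p n (B2 n)" by (rule measure_Un_le) auto
    also have "?p n (A n \<union> B1 n) \<le> ?p n (A n) + ?p n (B1 n)" by (rule measure_Un_le) auto
    finally show ?case by simp
  qed
  have "((\<lambda>n. 1 - (?p n (B1 n) + ?p n (B2 n) + ?p n (B3 n))) \<longlongrightarrow> 1 - (0 + 0 + 0)) F"
    by (intro tendsto_intros assms)
  then show "((\<lambda>n. 1 - (?p n (B1 n) + ?p n (B2 n) + ?p n (B3 n))) \<longlongrightarrow> 1) F" by simp
  show "((\<lambda>n. 1) \<longlongrightarrow> (1::real)) F" by simp
qed (simp add: measure_pmf.prob_le_1)

text \<open>At the threshold for short cycles \<open>\<rho> powr L\<close> is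
  \<open>n powr - \<beta>\<close>. The choice of \<open>K\<close> makes \<open>\<rho> ^ T\<close> of
  order \<open>n powr - 2\<close>, which beats the factor \<open>n\<close> from the starting vertex
  of a path. So every \<open>\<delta>\<close> below \<open>\<beta>\<close> and 1 works.\<close>

lemma cycle_sum_tendsto_0:
  assumes \<Delta>: "3 \<le> \<Delta>" and \<eta>: "1 < \<eta>" and \<kappa>: "0 < \<kappa>" and \<rho>: "\<rho> = real (\<Delta> - 1) * \<eta> * \<kappa>" "\<rho> < 1"
    and K: "K = 2 / (- ln \<rho>)" and \<delta>: "\<delta> < 1" "\<delta> < - ln \<rho> / (5 * ln (real (\<Delta> - 1)))"
  shows "((\<lambda>n. rprob \<Delta> n
      {E. real n powr - \<delta> \<le> cycle_sum \<kappa> (1 / 5 * log (real (\<Delta> - 1)) (real n)) (nat \<lfloor>K * ln (real n)\<rfloor>) E}) \<longlongrightarrow> 0)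
    (inf sequentially (principal {n. even (\<Delta> * n)}))"
proof -
  let ?F = "inf sequentially (principal {n. even (\<Delta> * n)})" and ?d = "real (\<Delta> - 1)"
  let ?T = "\<lambda>n. nat \<lfloor>K * ln (real n)\<rfloor>" and ?L = "\<lambda>n. 1 / 5 * log ?d (real n)"
  define \<beta> where "\<beta> = - ln \<rho> / (5 * ln ?d)"
  have \<rho>0: "0 < \<rho>" unfolding \<rho> using \<Delta> \<eta> \<kappa> by simp
  have ln\<rho>: "ln \<rho> < 0" using \<rho>0 \<rho>(2) by simp
  have K0: "0 < K" unfolding K using ln\<rho> by simp
  have lnd: "0 < ln ?d" using \<Delta> by simp
  define C1 where "C1 = 4 / \<kappa> / (1 - \<rho>)"
  define C2 where "C2 = 2 / \<rho>"
  let ?g = "\<lambda>n. C1 * real n powr (\<delta> - \<beta>) + C2 * real n powr (\<delta> - 1)"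
  have e: "\<delta> - \<beta> < 0" "\<delta> - 1 < 0" using \<delta> by (simp_all add: \<beta>_def)
  have "(\<lambda>n. real n powr a) \<longlonglongrightarrow> 0" if "a < 0" for a using that by real_asymp
  then have "?g \<longlonglongrightarrow> C1 * 0 + C2 * 0" using e by (intro tendsto_intros) auto
  then have g: "(?g \<longlongrightarrow> 0) ?F" by (simp add: tendsto_mono[OF inf_le1])
  have "eventually (\<lambda>n. 2 \<le> K * ln (real n)) sequentially" using K0 by real_asymp
  then have ev2: "eventually (\<lambda>n. 2 \<le> K * ln (real n)) ?F" by (rule filter_leD[OF inf_le1])
  have "eventually (\<lambda>n. rprob \<Delta> n
      {E. real n powr - \<delta> \<le> cycle_sum \<kappa> (?L n) (?T n) E} \<le> ?g n) ?F"
    using ample_eventually[of \<Delta> \<eta> K 0] ev2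
  proof (rule eventually_elim2)
    fix n assume "ample \<Delta> \<eta> (?T n + 0) n" and K2: "2 \<le> K * ln (real n)"
    then have n: "ample \<Delta> \<eta> (?T n) n" by simp
    have n1: "0 < real n" "1 \<le> real n" using n by (auto simp: ample_def)
    have L0: "0 \<le> ?L n" using \<Delta> n1 by (simp add: log_def)
    have T: "1 \<le> ?T n" using K2 by linarith
    have "rprob \<Delta> n {E. real n powr - \<delta> \<le> cycle_sum \<kappa> (?L n) (?T n) E} \<le>
      (4 / \<kappa> * (\<rho> powr ?L n / (1 - \<rho>)) + 2 * real n * \<rho> ^ ?T n) / real n powr - \<delta>"
      using \<Delta> \<eta> n1 by (intro prob_cycle_sum[OF _ _ n T L0 \<kappa> \<rho>]) auto
    also have "\<dots> \<le> (C1 * real n powr - \<beta> + C2 * real n powr - 1) / real n powr - \<delta>"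
    proof (intro divide_right_mono add_mono)
      have "\<rho> powr ?L n = real n powr - \<beta>"
        using \<rho>0 n1 lnd by (simp add: powr_def log_def \<beta>_def)
      then show "4 / \<kappa> * (\<rho> powr ?L n / (1 - \<rho>)) \<le> C1 * real n powr - \<beta>"
        by (simp add: C1_def)
      have "\<rho> ^ ?T n = \<rho> powr real (?T n)" using \<rho>0 by (simp add: powr_realpow)
      \<comment> \<open>Rounding \<open>T\<close> down costs at most a factor
        \<open>1 / \<rho>\<close>, which goes into \<open>C2\<close>.\<close>
      also have "\<dots> \<le> \<rho> powr (K * ln (real n) - 1)"
        using \<rho>0 \<rho>(2) by (intro powr_mono') (auto, linarith)
      also have "\<dots> = \<rho> powr (K * ln (real n)) / \<rho>" using \<rho>0 by (simp add: powr_diff)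
      also have "\<rho> powr (K * ln (real n)) = real n powr - 2"
        using \<rho>0 n1 ln\<rho> by (simp add: powr_def K)
      finally have "2 * real n * \<rho> ^ ?T n \<le> 2 * real n * (real n powr - 2 / \<rho>)"
        using n1 by (intro mult_left_mono) auto
      also have "\<dots> = 2 / \<rho> * (real n * real n powr - 2)" by simp
      also have "real n * real n powr - 2 = real n powr - 1"
        using n1 powr_add[of "real n" 1 "- 2"] by simp
      also have "2 / \<rho> * real n powr - 1 = C2 * real n powr - 1" unfolding C2_def ..
      finally show "2 * real n * \<rho> ^ ?T n \<le> C2 * real n powr - 1" .
    qed auto
    also have "\<dots> = ?g n"
      using n1 by (simp add: add_divide_distrib powr_minus powr_diff divide_inverse algebra_simps)
    finally show "rprob \<Delta> n
      {E. real n powr - \<delta> \<le> cycle_sum \<kappa> (?L n) (?T n) E} \<le> ?g n" .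
  qed (use \<Delta> \<eta> K0 in auto)
  then show ?thesis
    by (rule tendsto_sandwich[OF _ _ tendsto_const g, rotated]) simp
qed

theorem theorem5p5:
  fixes \<Delta> :: nat and p q :: real
  assumes "\<Delta> \<ge> 3" and "q \<ge> 1" and "0 < p" and "p < 1" and "p < p_c q \<Delta>"
  shows "\<exists>\<delta>>0. \<exists>C.
    ((\<lambda>n. measure_pmf.prob (random_regular_graph \<Delta> n)
        {E. \<exists>\<nu>. sample_rc \<Delta> p q {..<n} E = map_pmf Some \<nu> \<and>
                (\<forall>S\<in>set_pmf \<nu>. S \<subseteq> E) \<and>
                tv_dist \<nu> (random_cluster {..<n} E p q) \<le> C / real n powr \<delta>})
      \<longlongrightarrow> 1) (inf sequentially (principal {n. even (\<Delta> * n)}))"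
proof -
  let ?F = "inf sequentially (principal {n. even (\<Delta> * n)})"
  define d where "d = \<Delta> - 1"
  have d: "2 \<le> d" "\<Delta> = Suc d" "\<Delta> - 1 = d" "real \<Delta> - 1 = real d" using assms(1) by (auto simp: d_def)
  note q = assms(2) and p = assms(3,4) and pc = assms(5)[unfolded d(2)]
  define r where "r = p / (p + (1 - p) * q)"
  have "0 < p + (1 - p) * q" using p q by (intro add_pos_nonneg) auto
  then have r0: "0 < r" using p by (simp add: r_def)
  have rd: "r < 1 / real d" using edge_prob_subcritical[OF d(1) q p pc] d(1) by (simp add: r_def field_simps)
  have "(\<lambda>h. r * rc_params.mseq p q d h ^ d) \<longlonglongrightarrow> r * 1 ^ d"
    by (intro tendsto_intros mseq_tendsto_1[OF d(1) q p pc])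
  \<comment> \<open>The depth \<open>h\<close> is taken so large that the wired message, still above
    1, keeps the edge bound below \<open>1 / d\<close>.\<close>
  then have "eventually (\<lambda>h. r * rc_params.mseq p q d h ^ d < 1 / real d) sequentially"
    using rd by (intro order_tendstoD) auto
  then obtain h where h: "r * rc_params.mseq p q d h ^ d < 1 / real d"
    by (auto simp: eventually_sequentially)
  define \<kappa> where "\<kappa> = r * rc_params.mseq p q d h ^ d"
  interpret base: rc_params "{} :: nat set" p q by unfold_locales (use p q in auto)
  have \<kappa>0: "0 < \<kappa>" unfolding \<kappa>_def using r0 base.mseq_ge_1[of d h] by (intro mult_pos_pos zero_less_power) auto
  have \<kappa>d: "real d * \<kappa> < 1" using h d(1) by (simp add: \<kappa>_def field_simps)
  have "1 * \<kappa> \<le> real d * \<kappa>" using \<kappa>0 d(1) by (intro mult_right_mono) auto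
  then have \<kappa>1: "\<kappa> \<le> 1" using \<kappa>d by simp
  \<comment> \<open>The midpoint between 1 and \<open>1 / (d * \<kappa>)\<close> keeps
    \<open>\<rho>\<close> below 1; the cap 2 ensures \<open>\<eta> \<le> d\<close>, used below to
    exclude Fail.\<close>
  define \<eta> where "\<eta> = min 2 ((1 + 1 / (real d * \<kappa>)) / 2)"
  have d\<kappa>0: "0 < real d * \<kappa>" using \<kappa>0 d(1) by simp
  have \<eta>: "1 < \<eta>" "\<eta> \<le> 2" using \<kappa>d d\<kappa>0 by (auto simp: \<eta>_def)
  define \<rho> where "\<rho> = real (\<Delta> - 1) * \<eta> * \<kappa>"
  have "\<eta> \<le> (1 + 1 / (real d * \<kappa>)) / 2" unfolding \<eta>_def by (rule min.cobounded2)
  then have "real d * \<kappa> * \<eta> \<le> real d * \<kappa> * ((1 + 1 / (real d * \<kappa>)) / 2)"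
    using d\<kappa>0 by (intro mult_left_mono) auto
  moreover have "\<rho> = real d * \<kappa> * \<eta>" unfolding \<rho>_def d(3) by (simp only: mult_ac)
  ultimately have "\<rho> \<le> real d * \<kappa> * ((1 + 1 / (real d * \<kappa>)) / 2)" by simp
  also have "\<dots> = (real d * \<kappa> + 1) / 2" using \<kappa>0 d(1) by (simp add: field_simps)
  also have "\<dots> < 1" using \<kappa>d by simp
  finally have \<rho>1: "\<rho> < 1" .
  have \<rho>0: "0 < \<rho>" unfolding \<rho>_def d(3) using \<kappa>0 \<eta> d(1) by simp
  define K where "K = 2 / (- ln \<rho>)"
  have K0: "0 < K" unfolding K_def using \<rho>0 \<rho>1 by simp
  have lnd: "0 < ln (real d)" using d(1) by simp
  \<comment> \<open>\<open>K1 * ln n\<close> is twice the short length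
    \<open>1/5 log\<^sub>d n\<close>.\<close>
  define K1 where "K1 = 2 / (5 * ln (real d))"
  have K1: "0 < K1" using lnd by (simp add: K1_def)
  define \<beta> where "\<beta> = - ln \<rho> / (5 * ln (real d))"
  have \<beta>0: "0 < \<beta>" using \<rho>0 \<rho>1 lnd by (simp add: \<beta>_def divide_neg_pos)
  define \<delta> where "\<delta> = min 1 \<beta> / 2"
  have \<delta>: "0 < \<delta>" "\<delta> < 1" "\<delta> < \<beta>" using \<beta>0 by (auto simp: \<delta>_def min_def)
  obtain m :: nat where m: "1 + K * ln (real (\<Delta> - 1) * \<eta>) < real m" using reals_Archimedean2 by blast
  define D where "D = m * (2 * Suc h)"
  define Mb where "Mb = m * (2 * Suc h) * 2 * (2 * Suc h + 1)"
  let ?T = "\<lambda>n. nat \<lfloor>K * ln (real n)\<rfloor>" and ?T1 = "\<lambda>n. nat \<lfloor>K1 * ln (real n)\<rfloor>"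
  let ?L = "\<lambda>n. 1 / 5 * log (real (\<Delta> - 1)) (real n)"
  \<comment> \<open>The same for all \<open>n\<close> and all graphs, since \<open>\<kappa>\<close>,
    \<open>h\<close> and \<open>m\<close> are already fixed.\<close>
  let ?C = "1 / \<kappa> ^ Mb"
  let ?B1 = "\<lambda>n. {E. dense_path (?T1 n) 2 2 E}" and ?B2 = "\<lambda>n. {E. dense_path (?T n) D m E}"
    and ?B3 = "\<lambda>n. {E. real n powr - \<delta> \<le> cycle_sum \<kappa> (?L n) (?T n) E}"
  let ?A = "\<lambda>n. {E. \<exists>\<nu>. sample_rc \<Delta> p q {..<n} E = map_pmf Some \<nu> \<and> (\<forall>S\<in>set_pmf \<nu>. S \<subseteq> E) \<and>
                tv_dist \<nu> (random_cluster {..<n} E p q) \<le> ?C / real n powr \<delta>}"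
  \<comment> \<open>The deterministic part: a single graph outside the three exceptional sets has
    the claimed property. \<open>?B1\<close> prevents Fail, \<open>?B2\<close> bounds the bad
    positions, and \<open>?B3\<close> controls the union bound over cycles.\<close>
  have good: "E \<in> ?A n" if n: "1 \<le> ?T n" "0 < n" and E: "E \<in> regular_graphs \<Delta> n"
    "E \<notin> ?B1 n" "E \<notin> ?B2 n" "E \<notin> ?B3 n" for n E
  proof -
    interpret rc_params "{..<n}" p q by unfold_locales (use p q in auto)
    note G = regular_graph_on[OF E(1)]
    let ?E' = "short_cycle_edges \<Delta> {..<n} E"
    have "\<forall>C\<in>graph_components {..<n} ?E'. component_is_cycle ?E' C \<or> (\<exists>v. C = {v})"
    proof (rule ballI, rule ccontr)
      fix C assume C: "C \<in> graph_components {..<n} ?E'"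
      assume "\<not> (component_is_cycle ?E' C \<or> (\<exists>v. C = {v}))"
      then obtain vs where vs: "path_in E vs" "2 \<le> length vs"
        "real (length vs) \<le> 2 / 5 * log (real \<Delta> - 1) (real (card {..<n}))" "\<not> sparse_along E vs 2 2"
        using fail_imp_not_sparse[OF G refl C] by blast
      have "2 / 5 * log (real \<Delta> - 1) (real (card {..<n})) = K1 * ln (real n)"
        using d(4) by (simp add: K1_def log_def)
      then have "length vs \<le> Suc (?T1 n)" using vs(3) by linarith
      then show False using vs E(2) unfolding dense_path_def by blast
    qed
    from sample_rc_tv[OF G refl this]
    obtain \<nu> where \<nu>: "sample_rc \<Delta> p q {..<n} E = map_pmf Some \<nu>" "\<forall>S\<in>set_pmf \<nu>. S \<subseteq> E"
      and tv: "tv_dist \<nu> (random_cluster {..<n} E p q) \<le> measure_pmf.prob (random_cluster {..<n} E p q)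
       {S. \<exists>vs. is_cycle S vs \<and> 1 / 5 * log (real \<Delta> - 1) (real (card {..<n})) < real (length vs)}"
      by (elim exE conjE)
    have deg: "\<forall>v. card (star E v) \<le> Suc d"
    proof
      fix v
      show "card (star E v) \<le> Suc d"
      proof (cases "v < n")
        case True
        then show ?thesis using regular_card_star[OF E(1)] d(2) by simp
      next
        case False
        then have "star E v = {}" using G by (auto simp: star_def graph_on_def)
        then show ?thesis by simp
      qed
    qed
    have sp: "\<forall>vs. path_in E vs \<and> 2 \<le> length vs \<and> length vs \<le> Suc (?T n) \<longrightarrow> sparse_along E vs (m * (2 * Suc h)) m"
      using E(3) unfolding dense_path_def D_def by blast
    have "measure_pmf.prob (random_cluster {..<n} E p q) {S. \<exists>vs. is_cycle S vs \<and> ?L n < real (length vs)}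
      \<le> ?C * cycle_sum \<kappa> (?L n) (?T n) E"
      unfolding cycle_sum_def Mb_def
      by (rule prob_long_cycle[OF G deg _ \<kappa>1 sp]) (use n in \<open>auto simp: \<kappa>_def r_def\<close>)
    also have "\<dots> \<le> ?C * real n powr - \<delta>"
      using E(4) \<kappa>0 by (intro mult_left_mono) auto
    also have "\<dots> = ?C / real n powr \<delta>" by (simp add: powr_minus divide_inverse)
    finally have "tv_dist \<nu> (random_cluster {..<n} E p q) \<le> ?C / real n powr \<delta>"
      using tv d(3,4) by simp
    then show ?thesis using \<nu> by blast
  qed
  have "((\<lambda>n. rprob \<Delta> n (?A n)) \<longlongrightarrow> 1) ?F"
  proof (rule tendsto_1_by_exceptions)
    have "eventually (\<lambda>n. 2 \<le> K * ln (real n)) sequentially" using K0 by real_asymp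
    then have "eventually (\<lambda>n. 2 \<le> K * ln (real n)) ?F" by (rule filter_leD[OF inf_le1])
    moreover have "eventually (\<lambda>n. ample \<Delta> \<eta> (?T n + 0) n) ?F"
      using assms(1) \<eta> K0 by (intro ample_eventually) auto
    ultimately show "eventually (\<lambda>n. set_pmf (random_regular_graph \<Delta> n) \<subseteq> ?A n \<union> ?B1 n \<union> ?B2 n \<union> ?B3 n) ?F"
    proof eventually_elim
      case (elim n)
      then have ne: "regular_graphs \<Delta> n \<noteq> {}" "0 < n" by (auto simp: ample_def)
      have T: "1 \<le> ?T n" using elim(1) by linarith
      show ?case unfolding set_random_regular[OF ne(1)] using good[OF T ne(2)] by blast
    qed
    show "((\<lambda>n. rprob \<Delta> n (?B1 n)) \<longlongrightarrow> 0) ?F"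
    proof (rule dense_path_tendsto_0[OF _ \<eta>(1) K1])
      \<comment> \<open>Surplus 2 suffices at this length: with \<open>\<eta> \<le> d\<close> the
        exponent \<open>1 + K1 * ln (d * \<eta>)\<close> is at most \<open>1 + 4/5\<close>.\<close>
      have "ln (real d * \<eta>) \<le> ln (real d * real d)"
        using d(1) \<eta> by (intro ln_mono mult_left_mono mult_pos_pos) auto
      also have "\<dots> = 2 * ln (real d)" using d(1) by (simp add: ln_mult)
      finally have "K1 * ln (real d * \<eta>) \<le> K1 * (2 * ln (real d))" using K1 by (intro mult_left_mono) auto
      also have "\<dots> = 4 / 5" using lnd by (simp add: K1_def)
      finally show "1 + K1 * ln (real (\<Delta> - 1) * \<eta>) < real 2" unfolding d(3) by simp
    qed (use assms(1) in auto)
    show "((\<lambda>n. rprob \<Delta> n (?B2 n)) \<longlongrightarrow> 0) ?F"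
      by (rule dense_path_tendsto_0[OF _ \<eta>(1) K0 m]) (use assms(1) in auto)
    show "((\<lambda>n. rprob \<Delta> n (?B3 n)) \<longlongrightarrow> 0) ?F"
      by (rule cycle_sum_tendsto_0[OF assms(1) \<eta>(1) \<kappa>0 \<rho>_def \<rho>1 K_def \<delta>(2)])
        (use \<delta>(3) in \<open>simp only: \<beta>_def d(3)\<close>)
  qed
  then show ?thesis using \<delta>(1) by blast
qed

end
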